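(* Let $A$ be a purely infinite, stable $C^*$-algebra. Then the following are equivalent: (i) $A$ has the ideal property; (ii) for every $a\in A^+$, there exists a sequence $\{p_n\}$ of projections in $A$ such that $\langle a\rangle=\sup_{n\in\mathbb N}\langle p_n\rangle$ in $W(A)$; (iii) for every $a\in A^+$, there exists a sequence $\{q_n\}$ of projections in $A$ such that $\{\langle q_n\rangle\}$ is increasing in $W(A)$ and $\langle a\rangle=\sup_{n\in\mathbb N}\langle q_n\rangle$ in $W(A)$; (iv) for all $a\in A^+$, we have $\overline{AaA}=\overline{\bigcup_{n\ge1}I_n}$, where $\{I_n\}$ is an increasing sequence of ideals of $A$ and each $I_n$ is generated (as an ideal) by a single projection.
   Context: "Ideal" means closed two-sided ideal; $\overline{AaA}$ is the ideal of $A$ generated by $a$. A $C^*$-algebra $A$ has the ideal property if each of its ideals is generated (as an ideal) by the projections it contains. $A$ is stable if $A\cong A\otimes\mathcal K$, with $\mathcal K$ the compact operators on $\ell^2(\mathbb N)$. $M_\infty(A)$ is the algebraic inductive limit of the $M_n(A)$ under $x\mapsto x\oplus 0$, and $M_\infty(A)^+$ is its set of positive elements. For $a,b\in M_\infty(A)^+$ write $a\precsim b$ if for some $n$ with $a,b\in M_n(A)$ there is a sequence $\{x_k\}$ in $M_n(A)$ with $a=\lim_k x_k b x_k^*$; write $a\sim b$ if $a\precsim b$ and $b\precsim a$. The Cuntz semigroup is $W(A)=M_\infty(A)^+/\!\sim$, with classes $\langle a\rangle$, addition $\langle a\rangle+\langle b\rangle=\langle a\oplus b\rangle$, and order $\langle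 a\rangle\le\langle b\rangle\iff a\precsim b$. Suprema are order-theoretic suprema in $W(A)$. $A$ is purely infinite if $A$ has no non-zero abelian quotients and $a\precsim b$ whenever $a,b\in A^+$ satisfy $a\in\overline{AbA}$. *)

theory Defs
  imports "HOL-Analysis.Analysis"
begin

section \<open>C*-algebras\<close>

class complex_vector = real_vector +
  fixes scaleC :: "complex \<Rightarrow> 'a \<Rightarrow> 'a" (infixr \<open>*\<^sub>C\<close> 75)
  assumes scaleC_add_right: "c *\<^sub>C (x + y) = c *\<^sub>C x + c *\<^sub>C y"
    and scaleC_add_left: "(c + d) *\<^sub>C x = c *\<^sub>C x + d *\<^sub>C x"
    and scaleC_scaleC: "c *\<^sub>C d *\<^sub>C x = (c * d) *\<^sub>C x"
    and scaleR_scaleC: "r *\<^sub>R x = complex_of_real r *\<^sub>C x"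

text \<open>
  Algebras are not assumed to be unital, and the zero algebra is allowed.
\<close>

class cstar_algebra = complex_vector + real_normed_algebra + banach +
  fixes star :: "'a \<Rightarrow> 'a"
  assumes mult_scaleC_left: "(c *\<^sub>C x) * y = c *\<^sub>C (x * y)"
    and mult_scaleC_right: "x * (c *\<^sub>C y) = c *\<^sub>C (x * y)"
    and norm_scaleC: "norm (c *\<^sub>C x) = cmod c * norm x"
    and star_star: "star (star x) = x"
    and star_add: "star (x + y) = star x + star y"
    and star_scaleC: "star (c *\<^sub>C x) = cnj c *\<^sub>C star x"
    and star_mult: "star (x * y) = star y * star x"
    and cstar_identity: "norm (star x * x) = (norm x)\<^sup>2"

abbreviation clinear :: "('a::complex_vector \<Rightarrow> 'b::complex_vector) \<Rightarrow> bool" where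
  "clinear \<equiv> Vector_Spaces.linear scaleC scaleC"

abbreviation cspan :: "'a::complex_vector set \<Rightarrow> 'a set" where
  "cspan \<equiv> module.span scaleC"

definition projection :: "'a::cstar_algebra \<Rightarrow> bool" where
  "projection p \<longleftrightarrow> star p = p \<and> p * p = p"

definition cstar_positive :: "'a::cstar_algebra \<Rightarrow> bool" where
  "cstar_positive a \<longleftrightarrow> (\<exists>y. a = star y * y)"

definition ideal :: "'a::cstar_algebra set \<Rightarrow> bool" where
  "ideal I \<longleftrightarrow> closed I \<and> 0 \<in> I \<and> (\<forall>x\<in>I. \<forall>y\<in>I. x + y \<in> I) \<and> (\<forall>c. \<forall>x\<in>I. c *\<^sub>C x \<in> I) \<and>
     (\<forall>a. \<forall>x\<in>I. a * x \<in> I \<and> x * a \<in> I)"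

text \<open>
  The ideal generated by a set \<open>S\<close> is \<open>ideal hull S\<close>; in particular the closed linear span of
  \<open>A a A\<close> is \<open>ideal hull {a}\<close>.
\<close>

definition ideal_property :: "'a::cstar_algebra itself \<Rightarrow> bool" where
  "ideal_property _ \<longleftrightarrow> (\<forall>I :: 'a set. ideal I \<longrightarrow> I = ideal hull {p \<in> I. projection p})"

definition coset :: "'a::cstar_algebra set \<Rightarrow> 'a \<Rightarrow> 'a set" where
  "coset I a = {a + x | x. x \<in> I}"

definition quotient_nonzero :: "'a::cstar_algebra set \<Rightarrow> bool" where
  "quotient_nonzero I \<longleftrightarrow> (\<exists>a. coset I a \<noteq> coset I 0)"

definition quotient_abelian :: "'a::cstar_algebra set \<Rightarrow> bool" where
  "quotient_abelian I \<longleftrightarrow> (\<forall>a b. coset I (a * b) = coset I (b * a))"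


section \<open>Matrix algebras and the Cuntz semigroup\<close>

text \<open>
  \<open>M\<^sub>n(A)\<close> is represented by the infinite matrices supported on the upper left \<open>n \<times> n\<close> corner, so
  that the connecting maps \<open>x \<mapsto> x \<oplus> 0\<close> become inclusions and the inductive limit becomes a union.
\<close>

type_synonym 'a infmat = "nat \<Rightarrow> nat \<Rightarrow> 'a"

definition Mat :: "nat \<Rightarrow> 'a::cstar_algebra infmat set" where
  "Mat n = {x. \<forall>i j. n \<le> i \<or> n \<le> j \<longrightarrow> x i j = 0}"

definition mat_mult :: "nat \<Rightarrow> 'a::cstar_algebra infmat \<Rightarrow> 'a infmat \<Rightarrow> 'a infmat" where
  "mat_mult n x y = (\<lambda>i j. \<Sum>k<n. x i k * y k j)"

definition mat_star :: "'a::cstar_algebra infmat \<Rightarrow> 'a infmat" where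
  "mat_star x = (\<lambda>i j. star (x j i))"

text \<open>
  The C*-norm of \<open>M\<^sub>n(A)\<close>: the operator norm for the action of \<open>M\<^sub>n(A)\<close> on the Hilbert module
  \<open>A\<^sup>n\<close> with inner product \<open>\<langle>v, w\<rangle> = \<Sum>i<n. v\<^sub>i\<^sup>* w\<^sub>i\<close>.
\<close>

definition vec_norm :: "nat \<Rightarrow> (nat \<Rightarrow> 'a::cstar_algebra) \<Rightarrow> real" where
  "vec_norm n v = sqrt (norm (\<Sum>i<n. star (v i) * v i))"

definition mat_norm :: "nat \<Rightarrow> 'a::cstar_algebra infmat \<Rightarrow> real" where
  "mat_norm n x = Sup {vec_norm n (\<lambda>i. \<Sum>j<n. x i j * v j) | v. vec_norm n v \<le> 1}"

definition Mat_inf_pos :: "'a::cstar_algebra infmat set" where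
  "Mat_inf_pos = (\<Union>n. {mat_mult n (mat_star y) y | y. y \<in> Mat n})"

definition Cuntz_sub :: "'a::cstar_algebra infmat \<Rightarrow> 'a infmat \<Rightarrow> bool" (infix \<open>\<precsim>\<close> 50) where
  "a \<precsim> b \<longleftrightarrow> (\<exists>n. a \<in> Mat n \<and> b \<in> Mat n \<and> (\<exists>x :: nat \<Rightarrow> 'a infmat. (\<forall>k. x k \<in> Mat n) \<and>
     (\<lambda>k. mat_norm n (mat_mult n (mat_mult n (x k) b) (mat_star (x k)) - a)) \<longlonglongrightarrow> 0))"

definition Cuntz_rel :: "('a::cstar_algebra infmat \<times> 'a infmat) set" where
  "Cuntz_rel = {(a, b). a \<in> Mat_inf_pos \<and> b \<in> Mat_inf_pos \<and> a \<precsim> b \<and> b \<precsim> a}"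

definition Cuntz_W :: "'a::cstar_algebra infmat set set" where
  "Cuntz_W = Mat_inf_pos // Cuntz_rel"

definition Cuntz_le :: "'a::cstar_algebra infmat set \<Rightarrow> 'a infmat set \<Rightarrow> bool" where
  "Cuntz_le X Y \<longleftrightarrow> (\<exists>a\<in>X. \<exists>b\<in>Y. a \<precsim> b)"

definition Cuntz_is_sup :: "'a::cstar_algebra infmat set \<Rightarrow> 'a infmat set set \<Rightarrow> bool" where
  "Cuntz_is_sup s S \<longleftrightarrow> s \<in> Cuntz_W \<and> (\<forall>X\<in>S. Cuntz_le X s) \<and>
     (\<forall>u\<in>Cuntz_W. (\<forall>X\<in>S. Cuntz_le X u) \<longrightarrow> Cuntz_le s u)"

definition corner :: "'a::cstar_algebra \<Rightarrow> 'a infmat" where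
  "corner a = (\<lambda>i j. if i = 0 \<and> j = 0 then a else 0)"

definition Cuntz_class :: "'a::cstar_algebra \<Rightarrow> 'a infmat set" where
  "Cuntz_class a = Cuntz_rel `` {corner a}"

definition purely_infinite :: "'a::cstar_algebra itself \<Rightarrow> bool" where
  "purely_infinite _ \<longleftrightarrow>
     \<not> (\<exists>I :: 'a set. ideal I \<and> quotient_nonzero I \<and> quotient_abelian I) \<and>
     (\<forall>a b :: 'a. cstar_positive a \<and> cstar_positive b \<and> a \<in> ideal hull {b} \<longrightarrow> corner a \<precsim> corner b)"


section \<open>Compact operators and stability\<close>

typedef ell2 = "{f :: nat \<Rightarrow> complex. summable (\<lambda>n. (cmod (f n))\<^sup>2)}"
  morphisms ell2_coord Abs_ell2
  by (rule exI[of _ "\<lambda>_. 0"]) simp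

setup_lifting type_definition_ell2

lemma summable_ell2_add:
  assumes "summable (\<lambda>n. (cmod (f n))\<^sup>2)" "summable (\<lambda>n. (cmod (g n))\<^sup>2)"
  shows "summable (\<lambda>n. (cmod (f n + g n))\<^sup>2)"
proof (rule summable_comparison_test')
  show "summable (\<lambda>n. 2 * ((cmod (f n))\<^sup>2 + (cmod (g n))\<^sup>2))"
    using assms by (intro summable_mult summable_add)
  fix n
  have "(cmod (f n + g n))\<^sup>2 \<le> (cmod (f n) + cmod (g n))\<^sup>2"
    by (simp add: norm_triangle_ineq power_mono)
  also have "\<dots> \<le> 2 * ((cmod (f n))\<^sup>2 + (cmod (g n))\<^sup>2)"
    using zero_le_power2[of "cmod (f n) - cmod (g n)"] by (simp add: power2_eq_square algebra_simps)
  finally show "norm ((cmod (f n + g n))\<^sup>2) \<le> 2 * ((cmod (f n))\<^sup>2 + (cmod (g n))\<^sup>2)" by simp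
qed

lemma summable_ell2_scale:
  "summable (\<lambda>n. (cmod (f n))\<^sup>2) \<Longrightarrow> summable (\<lambda>n. (cmod (c * f n))\<^sup>2)"
  by (simp add: norm_mult power_mult_distrib summable_mult)

instantiation ell2 :: complex_vector
begin

lift_definition zero_ell2 :: ell2 is "\<lambda>_. 0" by simp
lift_definition plus_ell2 :: "ell2 \<Rightarrow> ell2 \<Rightarrow> ell2" is "\<lambda>f g n. f n + g n"
  by (rule summable_ell2_add)
lift_definition uminus_ell2 :: "ell2 \<Rightarrow> ell2" is "\<lambda>f n. - f n" by simp
lift_definition minus_ell2 :: "ell2 \<Rightarrow> ell2 \<Rightarrow> ell2" is "\<lambda>f g n. f n - g n"
  subgoal for f g using summable_ell2_add[of f "\<lambda>n. - g n"] by simp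
  done
lift_definition scaleC_ell2 :: "complex \<Rightarrow> ell2 \<Rightarrow> ell2" is "\<lambda>c f n. c * f n"
  by (rule summable_ell2_scale)
definition scaleR_ell2 :: "real \<Rightarrow> ell2 \<Rightarrow> ell2" where
  "scaleR_ell2 r x = complex_of_real r *\<^sub>C x"

instance
  by standard (unfold scaleR_ell2_def, (transfer, simp add: algebra_simps fun_eq_iff)+)

end

instantiation ell2 :: real_normed_vector
begin

lift_definition norm_ell2 :: "ell2 \<Rightarrow> real" is "\<lambda>f. sqrt (\<Sum>n. (cmod (f n))\<^sup>2)" .
definition dist_ell2 :: "ell2 \<Rightarrow> ell2 \<Rightarrow> real" where "dist_ell2 x y = norm (x - y)"
definition sgn_ell2 :: "ell2 \<Rightarrow> ell2" where "sgn_ell2 x = x /\<^sub>R norm x"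
definition uniformity_ell2 :: "(ell2 \<times> ell2) filter" where
  "uniformity_ell2 = (INF e\<in>{0<..}. principal {(x, y). dist x y < e})"
definition open_ell2 :: "ell2 set \<Rightarrow> bool" where
  "open_ell2 U \<longleftrightarrow> (\<forall>x\<in>U. \<forall>\<^sub>F (x', y) in uniformity. x' = x \<longrightarrow> y \<in> U)"

instance
proof
  fix x y :: ell2 and r :: real
  show "(norm x = 0) = (x = 0)"
    by transfer (simp add: suminf_eq_zero_iff fun_eq_iff)
  show "norm (x + y) \<le> norm x + norm y"
  proof transfer
    fix f g :: "nat \<Rightarrow> complex"
    assume f: "summable (\<lambda>n. (cmod (f n))\<^sup>2)" and g: "summable (\<lambda>n. (cmod (g n))\<^sup>2)"
    define C where "C = sqrt (\<Sum>n. (cmod (f n))\<^sup>2) + sqrt (\<Sum>n. (cmod (g n))\<^sup>2)"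
    have "(\<lambda>n. L2_set (\<lambda>i. cmod (f i + g i)) {..<n}) \<longlonglongrightarrow> sqrt (\<Sum>n. (cmod (f n + g n))\<^sup>2)"
      unfolding L2_set_def by (intro tendsto_real_sqrt summable_LIMSEQ summable_ell2_add f g)
    moreover have "L2_set (\<lambda>i. cmod (f i + g i)) {..<n} \<le> C" for n
    proof -
      have "L2_set (\<lambda>i. cmod (f i + g i)) {..<n} \<le> L2_set (\<lambda>i. cmod (f i) + cmod (g i)) {..<n}"
        by (intro L2_set_mono norm_triangle_ineq) auto
      also have "\<dots> \<le> L2_set (\<lambda>i. cmod (f i)) {..<n} + L2_set (\<lambda>i. cmod (g i)) {..<n}"
        by (rule L2_set_triangle_ineq)
      also have "\<dots> \<le> C"
        unfolding C_def L2_set_def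
        by (intro add_mono real_sqrt_le_mono sum_le_suminf f g) auto
      finally show ?thesis .
    qed
    ultimately show "sqrt (\<Sum>n. (cmod (f n + g n))\<^sup>2) \<le> C"
      by (intro LIMSEQ_le_const2) auto
  qed
  show "norm (r *\<^sub>R x) = \<bar>r\<bar> * norm x"
    unfolding scaleR_ell2_def
    by transfer (simp add: norm_mult power_mult_distrib suminf_mult real_sqrt_mult)
qed (rule dist_ell2_def sgn_ell2_def uniformity_ell2_def open_ell2_def)+

end

lift_definition ell2_inner :: "ell2 \<Rightarrow> ell2 \<Rightarrow> complex" is "\<lambda>f g. \<Sum>n. f n * cnj (g n)" .

definition ell2_adjoint :: "(ell2 \<Rightarrow> ell2) \<Rightarrow> (ell2 \<Rightarrow> ell2) \<Rightarrow> bool" where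
  "ell2_adjoint S T \<longleftrightarrow> (\<forall>x y. ell2_inner (S x) y = ell2_inner x (T y))"

definition compact_ops :: "(ell2 \<Rightarrow> ell2) set" where
  "compact_ops = {T. clinear T \<and> compact (closure (T ` cball 0 1))}"

text \<open>
  \<open>tensor_compacts \<tau>\<close> says that \<open>'b\<close>, with \<open>a \<otimes> T = \<tau> a T\<close>, is a C*-tensor product of \<open>'a\<close> with
  the compact operators: \<open>\<tau>\<close> is bilinear and hence a linear map on the algebraic tensor product,
  this map is an injective *-homomorphism, and its range is dense.  In other words, \<open>'b\<close> is the
  completion of the algebraic tensor product in a C*-norm.  Since the compact operators are nuclear,
  there is only one such norm, so this determines \<open>'b\<close> up to isomorphism.  Injectivity uses that an
  element of the algebraic tensor product can be written as \<open>\<Sum>i<n. a\<^sub>i \<otimes> T\<^sub>i\<close> with linearly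
  independent \<open>T\<^sub>i\<close>, and vanishes only if all \<open>a\<^sub>i\<close> do.  Values of \<open>\<tau>\<close> at non-compact operators are
  irrelevant.
\<close>

definition tensor_compacts ::
  "('a::cstar_algebra \<Rightarrow> (ell2 \<Rightarrow> ell2) \<Rightarrow> 'b::cstar_algebra) \<Rightarrow> bool" where
  "tensor_compacts \<tau> \<longleftrightarrow>
     (\<forall>T\<in>compact_ops. clinear (\<lambda>a. \<tau> a T)) \<and>
     (\<forall>a. \<forall>S\<in>compact_ops. \<forall>T\<in>compact_ops. \<tau> a (\<lambda>x. S x + T x) = \<tau> a S + \<tau> a T) \<and>
     (\<forall>a c. \<forall>T\<in>compact_ops. \<tau> a (\<lambda>x. c *\<^sub>C T x) = c *\<^sub>C \<tau> a T) \<and>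
     (\<forall>a b. \<forall>S\<in>compact_ops. \<forall>T\<in>compact_ops. \<tau> a S * \<tau> b T = \<tau> (a * b) (S \<circ> T)) \<and>
     (\<forall>a. \<forall>S\<in>compact_ops. \<forall>T\<in>compact_ops. ell2_adjoint S T \<longrightarrow> star (\<tau> a S) = \<tau> (star a) T) \<and>
     (\<forall>n. \<forall>T :: nat \<Rightarrow> ell2 \<Rightarrow> ell2. \<forall>a :: nat \<Rightarrow> 'a.
        (\<forall>i<n. T i \<in> compact_ops) \<and>
        (\<forall>c :: nat \<Rightarrow> complex. (\<forall>x. (\<Sum>i<n. c i *\<^sub>C T i x) = 0) \<longrightarrow> (\<forall>i<n. c i = 0)) \<and>
        (\<Sum>i<n. \<tau> (a i) (T i)) = 0 \<longrightarrow> (\<forall>i<n. a i = 0)) \<and>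
     closure (cspan {\<tau> a T | a T. T \<in> compact_ops}) = UNIV"

text \<open>
  An isomorphism of \<open>A \<otimes> K\<close> onto \<open>A\<close> transports the tensor product structure, so that \<open>A\<close> itself
  becomes a tensor product of \<open>A\<close> and \<open>K\<close>.
\<close>

definition cstar_stable :: "'a::cstar_algebra itself \<Rightarrow> bool" where
  "cstar_stable _ \<longleftrightarrow> (\<exists>\<tau> :: 'a \<Rightarrow> (ell2 \<Rightarrow> ell2) \<Rightarrow> 'a. tensor_compacts \<tau>)"

end

theory Submission
  imports Defs
begin

text \<open>
  In a purely infinite algebra, \<open>a \<precsim> b\<close> holds for positive \<open>a\<close> and \<open>b\<close> exactly if \<open>a\<close> lies in the
  ideal generated by \<open>b\<close>, so statements about the Cuntz semigroup become statements about ideals.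

  (i) implies (iv): the ideal property places \<open>a\<close> in the ideal generated by countably many projections,
  and stability replaces two projections by a single one, namely the sum of two orthogonal copies.

  (iv) implies (iii): let \<open>b\<close> be an upper bound of the \<open>q\<^sub>n\<close>.  Write \<open>a = y\<^sup>* y\<close> and approximate \<open>y\<close> by
  elements \<open>y\<^sub>k\<close> of the ideals generated by the \<open>q\<^sub>n\<close>.  Then \<open>y\<^sub>k\<^sup>* y\<^sub>k \<precsim> b\<close>, hence \<open>a \<precsim> b\<close> in the limit.

  (ii) implies (i): \<open>b = \<Sum>n. 2\<^sup>-\<^sup>n p\<^sub>n\<close> is an upper bound of the \<open>p\<^sub>n\<close>, so \<open>a\<close> is in the ideal generated by \<open>b\<close>
  and therefore in the one generated by the \<open>p\<^sub>n\<close>.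
\<close>

section \<open>Positivity in unital C*-algebras\<close>

text \<open>What links the order to ideals is heredity: \<open>star x * x \<le> k\<close> puts
  \<open>x\<close> into the ideal generated by \<open>k\<close>, which brings each
  \<open>p\<^sub>n\<close> into the ideal of the series \<open>b\<close>. It needs an order on
  self-adjoint elements, built here from a square root by norm estimates and without spectral
  theory; the obstacle is that \<open>star y * y\<close> must be shown to be the square of a
  self-adjoint element.

  An upper bound in the Cuntz semigroup is the class of a matrix of any size, while pure
  infiniteness speaks of elements of the algebra. Hence the passage to the limit from (iv) to (iii),
  and hence the factor \<open>y\<close>: approximants of \<open>a\<close> itself could fail to be
  positive.

  Countably many projections suffice because the elements reached from countable sets of generators
  already form a closed ideal. The orthogonal copies come from two isometries that move the standard
  basis to the even and to the odd positions. Tensored with \<open>1\<close> they are multipliers,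
  in general not elements of the algebra, so they act on approximations from the algebraic tensor
  product.\<close>

lemma star_zero [simp]: "star (0::'a::cstar_algebra) = 0"
proof -
  have "star (0::'a) = star 0 + star 0"
    using star_add[of "0::'a" 0] by simp
  then show ?thesis by simp
qed

lemma star_minus [simp]: "star (- x::'a::cstar_algebra) = - star x"
proof -
  have "star x + star (- x) = 0"
    by (simp add: star_add[symmetric])
  then show ?thesis by (simp add: eq_neg_iff_add_eq_0 add.commute)
qed

lemma star_diff: "star (x - y::'a::cstar_algebra) = star x - star y"
  using star_add[of x "- y"] by simp

lemma star_scaleR: "star (r *\<^sub>R x::'a::cstar_algebra) = r *\<^sub>R star x"
  by (simp add: scaleR_scaleC star_scaleC)

lemma star_sum: "star (\<Sum>i\<in>I. f i :: 'a::cstar_algebra) = (\<Sum>i\<in>I. star (f i))"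
  by (induction I rule: infinite_finite_induct) (auto simp: star_add)

lemma norm_star [simp]: "norm (star x::'a::cstar_algebra) = norm x"
proof -
  have *: "norm y \<le> norm (star y)" for y :: 'a
  proof (cases "y = 0")
    case False
    have "norm y * norm y \<le> norm (star y) * norm y"
      using norm_mult_ineq[of "star y" y] by (simp add: cstar_identity power2_eq_square)
    then show ?thesis using False by simp
  qed simp
  show ?thesis using *[of x] *[of "star x"] by (simp add: star_star)
qed

lemma cstar_identity': "norm (x * star x::'a::cstar_algebra) = (norm x)\<^sup>2"
  using cstar_identity[of "star x"] by (simp add: star_star)

lemma norm_selfadjoint_square: "star x = x \<Longrightarrow> norm (x * x::'a::cstar_algebra) = (norm x)\<^sup>2"
  using cstar_identity[of x] by simp

lemma bounded_linear_star: "bounded_linear (star :: 'a::cstar_algebra \<Rightarrow> 'a)"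
  by (rule bounded_linear_intro[where K = 1]) (auto simp: star_add star_scaleR)

lemmas tendsto_star = bounded_linear.tendsto[OF bounded_linear_star]

lemma star_one [simp]: "star (1::'a::{cstar_algebra,real_normed_algebra_1}) = 1"
proof -
  have "star (star (1::'a)) = star (star 1 * 1)" by simp
  also have "\<dots> = star 1 * star (star 1)" by (simp only: star_mult)
  finally show ?thesis by (simp add: star_star)
qed

lemma star_power: "star (x ^ n::'a::{cstar_algebra,real_normed_algebra_1}) = star x ^ n"
  by (induction n) (auto simp: star_mult power_commutes)

section \<open>Complex scalar multiplication\<close>

lemma scaleC_one [simp]: "1 *\<^sub>C x = (x::'a::complex_vector)"
  using scaleR_scaleC[of 1 x] by simp

lemma scaleC_zero_right [simp]: "c *\<^sub>C 0 = (0::'a::complex_vector)"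
  using scaleC_add_right[of c "0::'a" 0] by simp

lemma scaleC_minus_right: "c *\<^sub>C (- x) = - (c *\<^sub>C (x::'a::complex_vector))"
  using scaleC_add_right[of c x "- x"] by (simp add: eq_neg_iff_add_eq_0 add.commute)

lemma scaleC_minus_left: "(- c) *\<^sub>C x = - (c *\<^sub>C (x::'a::complex_vector))"
proof -
  have "c *\<^sub>C x + (- c) *\<^sub>C x = 0 *\<^sub>C x" by (simp add: scaleC_add_left[symmetric])
  also have "\<dots> = 0" using scaleR_scaleC[of 0 x] by simp
  finally show ?thesis by (simp add: eq_neg_iff_add_eq_0 add.commute)
qed

lemma scaleC_zero_left [simp]: "0 *\<^sub>C x = (0::'a::complex_vector)"
  using scaleR_scaleC[of 0 x] by simp

lemma scaleC_diff_right: "c *\<^sub>C (x - y) = c *\<^sub>C x - c *\<^sub>C (y::'a::complex_vector)"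
  using scaleC_add_right[of c x "- y"] by (simp add: scaleC_minus_right)

text \<open>
  The iteration \<open>y \<mapsto> (x + y\<^sup>2) / 2\<close> converges to \<open>1 - sqrt (1 - x)\<close> even for \<open>\<parallel>x\<parallel> = 1\<close>: its increments
  are dominated by those of the same iteration for the real number \<open>1\<close>, which is monotone and bounded.
\<close>

lemma sqrt_one_minus:
  fixes x :: "'a::{cstar_algebra,real_normed_algebra_1}"
  assumes x: "norm x \<le> 1" "star x = x"
  obtains r where "star r = r" "r * r = 1 - x" "\<And>z. z * x = x * z \<Longrightarrow> z * r = r * z"
proof -
  define y where "y = rec_nat (0::'a) (\<lambda>_ w. (1/2) *\<^sub>R (x + w * w))"
  define t where "t = rec_nat (0::real) (\<lambda>_ w. (1/2) * (1 + w * w))"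
  have y0: "y 0 = 0" and yS: "y (Suc n) = (1/2) *\<^sub>R (x + y n * y n)" for n
    by (auto simp: y_def)
  have t0: "t 0 = 0" and tS: "t (Suc n) = (1/2) * (1 + t n * t n)" for n
    by (auto simp: t_def)
  have t_bd: "0 \<le> t n \<and> t n \<le> 1" for n
  proof (induction n)
    case (Suc n)
    then have "t n * t n \<le> 1 * 1" by (intro mult_mono) auto
    then show ?case using Suc by (simp add: tS)
  qed (simp add: t0)
  have comm: "z * y n = y n * z" if "z * x = x * z" for z n
  proof (induction n)
    case (Suc n)
    have "z * (y n * y n) = (y n * y n) * z" using Suc by (metis mult.assoc)
    then show ?case by (simp add: yS that distrib_left distrib_right)
  qed (simp add: y0)
  have y_star: "star (y n) = y n" for n
    by (induction n) (auto simp: y0 yS star_scaleR star_add star_mult x)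
  have y_bd: "norm (y n) \<le> t n" for n
  proof (induction n)
    case (Suc n)
    have "norm (x + y n * y n) \<le> norm x + norm (y n) * norm (y n)"
      by (rule order_trans[OF norm_triangle_ineq]) (simp add: norm_mult_ineq)
    also have "\<dots> \<le> 1 + t n * t n"
      using Suc t_bd[of n] x by (intro add_mono mult_mono) auto
    finally show ?case by (simp add: yS tS)
  qed (simp add: y0 t0)
  have y_inc: "norm (y (Suc n) - y n) \<le> t (Suc n) - t n" for n
  proof (induction n)
    case 0
    then show ?case using x by (simp add: y0 yS t0 tS)
  next
    case (Suc n)
    \<comment> \<open>All iterates commute with \<open>x\<close>, hence with each other, so the
      difference of their squares factors.\<close>
    have c: "y n * y (Suc n) = y (Suc n) * y n"
      by (rule comm) (rule comm[OF refl, symmetric])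
    have "(y (Suc n) - y n) * (y (Suc n) + y n) = (x + y (Suc n) * y (Suc n)) - (x + y n * y n)"
      using c by (simp add: distrib_left left_diff_distrib)
    then have "y (Suc (Suc n)) - y (Suc n) = (1/2) *\<^sub>R ((y (Suc n) - y n) * (y (Suc n) + y n))"
      using yS[of "Suc n"] yS[of n] by (metis scaleR_diff_right)
    then have "norm (y (Suc (Suc n)) - y (Suc n)) \<le> (1/2) * (norm (y (Suc n) - y n) * norm (y (Suc n) + y n))"
      by (simp add: norm_mult_ineq)
    also have "\<dots> \<le> (1/2) * ((t (Suc n) - t n) * (t (Suc n) + t n))"
    proof (intro mult_left_mono mult_mono Suc)
      show "norm (y (Suc n) + y n) \<le> t (Suc n) + t n"
        by (rule order_trans[OF norm_triangle_ineq]) (intro add_mono y_bd)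
      show "0 \<le> t (Suc n) - t n" using Suc norm_ge_zero order_trans by blast
    qed auto
    also have "\<dots> = t (Suc (Suc n)) - t (Suc n)"
    proof -
      have "(t (Suc n) - t n) * (t (Suc n) + t n) = (1 + t (Suc n) * t (Suc n)) - (1 + t n * t n)"
        by (simp add: algebra_simps)
      then show ?thesis using tS[of "Suc n"] tS[of n] by (metis right_diff_distrib)
    qed
    finally show ?case .
  qed
  have t_mono: "incseq t"
    by (rule incseq_SucI, subst diff_ge_0_iff_ge[symmetric]) (rule order_trans[OF norm_ge_zero y_inc])
  have "Cauchy t"
    by (rule convergent_Cauchy, rule Bseq_mono_convergent)
      (use t_mono t_bd in \<open>auto simp: incseq_def intro!: BseqI'[of _ 1]\<close>)
  have y_diff: "norm (y (n + k) - y n) \<le> t (n + k) - t n" for n k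
  proof (induction k)
    case (Suc k)
    have "norm (y (n + Suc k) - y n) \<le> norm (y (Suc (n + k)) - y (n + k)) + norm (y (n + k) - y n)"
      using norm_triangle_ineq[of "y (Suc (n + k)) - y (n + k)" "y (n + k) - y n"] by simp
    then show ?case using Suc y_inc[of "n + k"] by simp
  qed simp
  have "Cauchy y"
  proof (rule metric_CauchyI)
    fix e :: real assume "e > 0"
    then obtain M where M: "\<And>m n. m \<ge> M \<Longrightarrow> n \<ge> M \<Longrightarrow> dist (t m) (t n) < e"
      using \<open>Cauchy t\<close> by (meson metric_CauchyD)
    have *: "dist (y m) (y n) < e" if "M \<le> n" "n \<le> m" for m n
    proof -
      have "dist (y m) (y n) \<le> t m - t n"
        using y_diff[of n "m - n"] that by (simp add: dist_norm)
      also have "\<dots> < e" using M[of m n] that by (auto simp: dist_real_def)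
      finally show ?thesis .
    qed
    have "dist (y m) (y n) < e" if "M \<le> n" "M \<le> m" for m n
      using *[of n m] *[of m n] that by (cases "n \<le> m") (auto simp: dist_commute)
    then show "\<exists>M. \<forall>m\<ge>M. \<forall>n\<ge>M. dist (y m) (y n) < e" by blast
  qed
  then obtain l where l: "y \<longlonglongrightarrow> l"
    using Cauchy_convergent convergent_def by blast
  have "(\<lambda>n. y (Suc n)) \<longlonglongrightarrow> (1/2) *\<^sub>R (x + l * l)"
    unfolding yS by (intro tendsto_intros l)
  then have fix_l: "l = (1/2) *\<^sub>R (x + l * l)"
    using LIMSEQ_Suc[OF l] LIMSEQ_unique by blast
  have "(\<lambda>n. star (y n)) \<longlonglongrightarrow> l" using l by (simp add: y_star)
  then have "star l = l" using LIMSEQ_unique tendsto_star[OF l] by blast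
  then have 1: "star (1 - l) = 1 - l" by (simp add: star_diff)
  have "l + l = x + l * l" using fix_l by (metis scaleR_half_double scaleR_right_distrib)
  then have 2: "(1 - l) * (1 - l) = 1 - x" by (simp add: algebra_simps)
  have 3: "z * (1 - l) = (1 - l) * z" if "z * x = x * z" for z
  proof -
    have "(\<lambda>n. z * y n) \<longlonglongrightarrow> l * z"
      unfolding comm[OF that] by (intro tendsto_intros l)
    moreover have "(\<lambda>n. z * y n) \<longlonglongrightarrow> z * l" by (intro tendsto_intros l)
    ultimately have "z * l = l * z" using LIMSEQ_unique by blast
    then show ?thesis by (simp add: right_diff_distrib left_diff_distrib)
  qed
  show ?thesis using that[OF 1 2 3] .
qed

section \<open>Norms of commuting self-adjoint elements\<close>

lemma star_complex_combination:
  fixes h k :: "'a::cstar_algebra"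
  assumes "star h = h" "star k = k"
  shows "star (h + \<i> *\<^sub>C k) = h - \<i> *\<^sub>C k"
  using assms by (simp add: star_add star_scaleC scaleC_minus_left)

lemma mult_star_complex_combination:
  fixes h k :: "'a::cstar_algebra"
  shows "(h - \<i> *\<^sub>C k) * (h + \<i> *\<^sub>C k) = h * h + k * k + \<i> *\<^sub>C (h * k - k * h)"
    and "(h + \<i> *\<^sub>C k) * (h - \<i> *\<^sub>C k) = h * h + k * k - \<i> *\<^sub>C (h * k - k * h)"
proof -
  have [simp]: "\<i> *\<^sub>C k * \<i> *\<^sub>C k = - (k * k)"
    by (simp add: mult_scaleC_left mult_scaleC_right scaleC_scaleC scaleC_minus_left)
  have [simp]: "h * \<i> *\<^sub>C k = \<i> *\<^sub>C (h * k)" "\<i> *\<^sub>C k * h = \<i> *\<^sub>C (k * h)"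
    by (simp_all add: mult_scaleC_left mult_scaleC_right)
  show "(h - \<i> *\<^sub>C k) * (h + \<i> *\<^sub>C k) = h * h + k * k + \<i> *\<^sub>C (h * k - k * h)"
    and "(h + \<i> *\<^sub>C k) * (h - \<i> *\<^sub>C k) = h * h + k * k - \<i> *\<^sub>C (h * k - k * h)"
    by (simp_all add: distrib_left distrib_right left_diff_distrib right_diff_distrib scaleC_diff_right)
qed

lemma norm_square_complex_combination:
  fixes h k :: "'a::cstar_algebra"
  assumes "star h = h" "star k = k" "h * k = k * h"
  shows "(norm (h + \<i> *\<^sub>C k))\<^sup>2 = norm (h * h + k * k)"
  by (simp add: cstar_identity[symmetric] star_complex_combination[OF assms(1,2)]
      mult_star_complex_combination assms(3))

text \<open>A substitute for monotonicity of the norm along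
  \<open>h\<^sup>2 \<le> h\<^sup>2 + k\<^sup>2\<close> while no order is available:
  \<open>u = h + \<i> *\<^sub>C k\<close> satisfies
  \<open>(norm u)\<^sup>2 = norm (h\<^sup>2 + k\<^sup>2)\<close>, and \<open>h\<close> and
  \<open>\<i> *\<^sub>C k\<close> are the means of \<open>u\<close> with \<open>star u\<close> and
  with \<open>- star u\<close>.\<close>

lemma selfadjoint_parts_le:
  fixes h k :: "'a::cstar_algebra"
  assumes "star h = h" "star k = k" "h * k = k * h" "norm (h * h + k * k) \<le> t\<^sup>2" "t \<ge> 0"
  shows "norm h \<le> t" "norm k \<le> t"
proof -
  define u where "u = h + \<i> *\<^sub>C k"
  have su: "star u = h - \<i> *\<^sub>C k"
    unfolding u_def by (rule star_complex_combination[OF assms(1,2)])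
  have u: "norm u \<le> t"
    using norm_square_complex_combination[OF assms(1-3)] assms(4,5) unfolding u_def
    by (metis power2_le_imp_le)
  have "2 *\<^sub>R h = u + star u" by (subst su) (simp add: u_def scaleR_2)
  then have "2 * norm h \<le> norm u + norm (star u)"
    by (metis norm_triangle_ineq norm_scaleR abs_numeral)
  then show "norm h \<le> t" using u by simp
  have "2 *\<^sub>R (\<i> *\<^sub>C k) = u - star u" by (subst su) (simp add: u_def scaleR_2)
  then have "2 * norm (\<i> *\<^sub>C k) \<le> norm u + norm (star u)"
    by (metis norm_triangle_ineq4 norm_scaleR abs_numeral)
  then show "norm k \<le> t" using u by (simp add: norm_scaleC)
qed

text \<open>The root \<open>r\<close> of \<open>1 - h\<^sup>2\<close> commutes with
  \<open>h\<close>, so \<open>h\<^sup>2 + r\<^sup>2 = 1\<close> bounds \<open>norm r\<close> by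
  \<open>1\<close>.\<close>

lemma norm_one_minus_square:
  fixes h :: "'a::{cstar_algebra,real_normed_algebra_1}"
  assumes "star h = h" "norm h \<le> 1"
  shows "norm (1 - h * h) \<le> 1"
proof -
  have h1: "norm (h * h) \<le> 1"
    using assms by (simp add: norm_selfadjoint_square power_le_one)
  have "star (h * h) = h * h" using assms(1) by (simp add: star_mult)
  from sqrt_one_minus[OF h1 this]
  obtain r where r: "star r = r" "r * r = 1 - h * h" "\<And>z. z * (h * h) = (h * h) * z \<Longrightarrow> z * r = r * z"
    by blast
  have hr: "h * r = r * h" by (rule r(3)) (simp add: mult.assoc)
  have "norm r \<le> 1"
    by (rule selfadjoint_parts_le(2)[OF assms(1) r(1) hr]) (simp_all add: r(2))
  then have "norm (r * r) \<le> 1" using r(1) by (simp add: norm_selfadjoint_square power_le_one)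
  then show ?thesis by (simp add: r)
qed

text \<open>Squares of self-adjoint elements rather than elements \<open>star y * y\<close>: the
  norm criterion \<open>upos_iff\<close> then follows from the square root, and the agreement of the
  two cones is left to \<open>upos_star_mult_self\<close>.\<close>

definition upos :: "'a::{cstar_algebra,real_normed_algebra_1} \<Rightarrow> bool" where
  "upos h \<longleftrightarrow> (\<exists>k. star k = k \<and> h = k * k)"

lemma upos_square: "star k = k \<Longrightarrow> upos (k * k)"
  by (auto simp: upos_def)

lemma upos_selfadjoint: "upos h \<Longrightarrow> star h = h"
  by (auto simp: upos_def star_mult)

text \<open>Rescaling by \<open>t\<close> brings \<open>h\<close> into the form \<open>1 - x\<close>
  with \<open>norm x \<le> 1\<close>. The commutation clause serves \<open>upos_norm_le\<close> and
  \<open>upos_mult_power_bound\<close>, where the root of one element must commute with another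
  element.\<close>

lemma upos_sqrt:
  fixes h :: "'a::{cstar_algebra,real_normed_algebra_1}"
  assumes "star h = h" "norm (t *\<^sub>R 1 - h) \<le> t"
  obtains r where "star r = r" "r * r = h" "\<And>z. z * h = h * z \<Longrightarrow> z * r = r * z"
proof (cases "t = 0")
  case True
  then have "h = 0" using assms by simp
  then show ?thesis by (intro that[of 0]) auto
next
  case False
  have t: "t > 0" using assms(2) norm_ge_zero[of "t *\<^sub>R 1 - h"] False by linarith
  define x where "x = 1 - (1/t) *\<^sub>R h"
  have "x = (1/t) *\<^sub>R (t *\<^sub>R 1 - h)" using t by (simp add: x_def scaleR_diff_right)
  then have "norm x = (1/t) * norm (t *\<^sub>R 1 - h)" using t by simp
  also have "\<dots> \<le> (1/t) * t" using assms(2) t by (intro mult_left_mono) auto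
  finally have x1: "norm x \<le> 1" using t by simp
  have "star x = x" using assms(1) by (simp add: x_def star_diff star_scaleR)
  from sqrt_one_minus[OF x1 this]
  obtain r where r: "star r = r" "r * r = 1 - x" "\<And>z. z * x = x * z \<Longrightarrow> z * r = r * z"
    by blast
  show ?thesis
  proof (rule that[of "sqrt t *\<^sub>R r"])
    show "sqrt t *\<^sub>R r * sqrt t *\<^sub>R r = h" using t r(2) by (simp add: x_def)
    fix z assume "z * h = h * z"
    then have "z * x = x * z" by (simp add: x_def algebra_simps)
    then have "z * r = r * z" by (rule r(3))
    then show "z * sqrt t *\<^sub>R r = sqrt t *\<^sub>R r * z" by simp
  qed (simp add: star_scaleR r)
qed

lemma upos_norm_diff_le:
  assumes "upos h" "norm h \<le> t"
  shows "norm (t *\<^sub>R 1 - h) \<le> t"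
proof (cases "t = 0")
  case True
  then show ?thesis using assms by simp
next
  case False
  have t: "t > 0" using assms(2) norm_ge_zero[of h] False by linarith
  obtain k where k: "star k = k" "h = k * k" using assms(1) by (auto simp: upos_def)
  define l where "l = (1 / sqrt t) *\<^sub>R k"
  have sl: "star l = l" by (simp add: l_def star_scaleR k)
  have ll: "l * l = (1/t) *\<^sub>R h" using t by (simp add: l_def k)
  have "(norm l)\<^sup>2 = (1/t) * norm h"
    using norm_selfadjoint_square[OF sl] ll t by simp
  also have "\<dots> \<le> 1" using assms(2) t by simp
  finally have "norm l \<le> 1" by (simp add: power2_le_iff_abs_le power_le_one_iff abs_square_le_1)
  then have "norm (1 - (1/t) *\<^sub>R h) \<le> 1" using norm_one_minus_square[OF sl] ll by simp
  then have "t * norm (1 - (1/t) *\<^sub>R h) \<le> t" using t by simp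
  moreover have "t *\<^sub>R 1 - h = t *\<^sub>R (1 - (1/t) *\<^sub>R h)" using t by (simp add: scaleR_diff_right)
  ultimately show ?thesis using t by simp
qed

text \<open>Positivity becomes a ball condition with centre \<open>t *\<^sub>R 1\<close> and radius
  \<open>t\<close>. Centres and radii add, and the inequality survives limits; closure under sums
  and limits is not visible from squares.\<close>

lemma upos_iff: "upos h \<longleftrightarrow> star h = h \<and> (\<exists>t. norm (t *\<^sub>R 1 - h) \<le> t)"
proof
  assume "upos h"
  then show "star h = h \<and> (\<exists>t. norm (t *\<^sub>R 1 - h) \<le> t)"
    using upos_norm_diff_le[of h "norm h"] upos_selfadjoint by blast
next
  assume "star h = h \<and> (\<exists>t. norm (t *\<^sub>R 1 - h) \<le> t)"
  then obtain t where "star h = h" "norm (t *\<^sub>R 1 - h) \<le> t" by blast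
  then show "upos h" using upos_sqrt[of h t] upos_def by metis
qed

lemma upos_add:
  assumes "upos h" "upos k"
  shows "upos (h + k)"
proof -
  have "norm ((norm h + norm k) *\<^sub>R 1 - (h + k)) \<le> norm (norm h *\<^sub>R 1 - h) + norm (norm k *\<^sub>R 1 - k)"
    using norm_triangle_ineq[of "norm h *\<^sub>R 1 - h" "norm k *\<^sub>R 1 - k"] by (simp add: algebra_simps)
  also have "\<dots> \<le> norm h + norm k"
    by (intro add_mono upos_norm_diff_le assms order_refl)
  finally show ?thesis
    using assms by (auto simp: upos_iff star_add)
qed

lemma upos_scaleR:
  assumes "upos h" "0 \<le> c"
  shows "upos (c *\<^sub>R h)"
proof -
  obtain k where k: "star k = k" "h = k * k" using assms(1) by (auto simp: upos_def)
  have "c *\<^sub>R h = (sqrt c *\<^sub>R k) * (sqrt c *\<^sub>R k)" using assms(2) by (simp add: k)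
  then show ?thesis using upos_square[of "sqrt c *\<^sub>R k"] k(1) by (simp only: star_scaleR)
qed

lemma upos_zero [simp]: "upos 0" and upos_one [simp]: "upos 1"
  using upos_square[of 0] upos_square[of 1] by auto

lemma upos_tendsto:
  assumes "\<And>n. upos (h n)" "h \<longlonglongrightarrow> l"
  shows "upos l"
proof -
  have "(\<lambda>n. star (h n)) \<longlonglongrightarrow> l" using assms by (simp add: upos_selfadjoint)
  then have "star l = l" using LIMSEQ_unique tendsto_star[OF assms(2)] by blast
  \<comment> \<open>The radius \<open>norm (h n)\<close> varies with \<open>n\<close> but converges
    along with \<open>h n\<close>.\<close>
  moreover have "norm (norm l *\<^sub>R 1 - l) \<le> norm l"
  proof (rule LIMSEQ_le)
    show "(\<lambda>n. norm (norm (h n) *\<^sub>R 1 - h n)) \<longlonglongrightarrow> norm (norm l *\<^sub>R 1 - l)"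
      by (intro tendsto_intros assms)
    show "(\<lambda>n. norm (h n)) \<longlonglongrightarrow> norm l" by (intro tendsto_intros assms)
  qed (use assms upos_norm_diff_le in blast)
  ultimately show ?thesis by (auto simp: upos_iff)
qed

text \<open>The roots of \<open>h\<close> and \<open>t *\<^sub>R 1 - h\<close> can be chosen to
  commute. Their squares add up to \<open>t *\<^sub>R 1\<close>, so
  \<open>selfadjoint_parts_le\<close> bounds the root of \<open>h\<close> by
  \<open>sqrt t\<close>.\<close>

lemma upos_norm_le:
  assumes "upos h" "upos (t *\<^sub>R 1 - h)" "t \<ge> 0"
  shows "norm h \<le> t"
proof -
  obtain k where k: "star k = k" "h = k * k" using assms(1) by (auto simp: upos_def)
  obtain c where c: "star c = c" "c * c = t *\<^sub>R 1 - h"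
      "\<And>z. z * (t *\<^sub>R 1 - h) = (t *\<^sub>R 1 - h) * z \<Longrightarrow> z * c = c * z"
    using upos_sqrt[OF upos_selfadjoint[OF assms(2)] upos_norm_diff_le[OF assms(2) order_refl]] by blast
  have kc: "k * c = c * k" by (rule c(3)) (simp add: k algebra_simps)
  have "norm k \<le> sqrt t"
    by (rule selfadjoint_parts_le(1)[OF k(1) c(1) kc]) (use c(2) k(2) assms(3) in auto)
  then have "(norm k)\<^sup>2 \<le> t"
    using assms(3) by (metis norm_ge_zero power_mono real_sqrt_pow2)
  then show ?thesis using k by (simp add: norm_selfadjoint_square)
qed

lemma upos_norm_minus:
  assumes "upos k"
  shows "upos (norm k *\<^sub>R 1 - k)"
  unfolding upos_iff
  by (intro conjI exI[of _ "norm k"]) (simp_all add: star_diff star_scaleR upos_selfadjoint[OF assms])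

lemma upos_norm_mono:
  assumes "upos h" "upos (k - h)"
  shows "norm h \<le> norm k"
proof (rule upos_norm_le[OF assms(1)])
  have "upos k" using upos_add[OF assms] by simp
  from upos_add[OF upos_norm_minus[OF this] assms(2)]
  show "upos (norm k *\<^sub>R 1 - h)" by (simp add: algebra_simps)
qed simp

section \<open>Positivity of \<open>star y * y\<close>\<close>

lemma selfadjoint_decomposition:
  fixes w :: "'a::cstar_algebra"
  obtains c d where "star c = c" "star d = d" "w = c + \<i> *\<^sub>C d"
proof -
  define c d where "c = (1/2) *\<^sub>R (w + star w)" and "d = (- \<i> / 2) *\<^sub>C (w - star w)"
  have "star c = c"
    by (simp add: c_def star_scaleR star_add star_star add.commute)
  moreover have "star d = d"
    using scaleC_minus_right[of "\<i> / 2" "w - star w"]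
    by (simp add: d_def star_scaleC star_diff star_star scaleC_minus_left)
  moreover have "\<i> *\<^sub>C d = (1/2) *\<^sub>R (w - star w)"
    by (simp add: d_def scaleC_scaleC scaleR_scaleC)
  then have "w = c + \<i> *\<^sub>C d"
    by (simp add: c_def scaleR_add_right[symmetric])
  ultimately show ?thesis by (rule that)
qed

text \<open>Neither summand is known to be positive at this point, but in terms of the real and
  imaginary parts of \<open>w\<close> the commutators cancel and twice a sum of two squares
  remains.\<close>

lemma upos_star_mult_add_mult_star:
  "upos (star w * w + w * star w)"
proof -
  obtain c d where cd: "star c = c" "star d = d" "w = c + \<i> *\<^sub>C d"
    by (rule selfadjoint_decomposition)
  have "star w * w + w * star w = 2 *\<^sub>R (c * c + d * d)"
    unfolding cd(3) star_complex_combination[OF cd(1,2)] mult_star_complex_combination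
    by (simp add: scaleR_2)
  then show ?thesis using cd(1,2) by (auto intro!: upos_scaleR upos_add upos_square)
qed

lemma upos_one_minus: 
  assumes "star h = h" "norm h \<le> 1"
  shows "upos (1 - h)"
  unfolding upos_iff using assms by (intro conjI exI[of _ 1]) (auto simp: star_diff)

text \<open>The scalar inequality \<open>(1 - s) s\<^sup>N \<le> 1\<close> for
  \<open>s \<ge> 0\<close>. Passing from \<open>N\<close> to \<open>N + 1\<close> adds
  \<open>(1 - s)\<^sup>2 s\<^sup>N\<close>, the square of \<open>(1 - s) r\<^sup>N\<close> for a
  root \<open>r\<close> of \<open>s\<close>.\<close>

lemma upos_one_minus_mult_power:
  assumes "upos s"
  shows "upos (1 - (1 - s) * s ^ N)"
proof (induction N)
  case (Suc N)
  obtain r where r: "star r = r" "s = r * r" using assms by (auto simp: upos_def)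
  have c1: "r ^ N * (1 - s) = (1 - s) * r ^ N"
    by (rule power_commuting_commutes) (simp add: r(2) algebra_simps)
  have rN: "r ^ N * r ^ N = s ^ N"
    unfolding r(2) by (metis power2_eq_square power_mult power_add mult_2)
  have "((1 - s) * r ^ N) * ((1 - s) * r ^ N) = (1 - s) * (1 - s) * s ^ N"
    by (metis c1 mult.assoc rN)
  moreover have "star ((1 - s) * r ^ N) = (1 - s) * r ^ N"
    by (simp add: star_mult star_power r(1) star_diff upos_selfadjoint[OF assms] c1)
  ultimately have "upos ((1 - s) * (1 - s) * s ^ N)" by (metis upos_square)
  moreover have "1 - (1 - s) * s ^ Suc N = (1 - (1 - s) * s ^ N) + (1 - s) * (1 - s) * s ^ N"
    by (simp add: distrib_left distrib_right left_diff_distrib right_diff_distrib mult.assoc)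
  ultimately show ?case using Suc upos_add by metis
qed (simp add: assms)

lemma norm_selfadjoint_power_two:
  fixes s :: "'a::{cstar_algebra,real_normed_algebra_1}"
  assumes "star s = s"
  shows "norm (s ^ (2 ^ m)) = norm s ^ (2 ^ m)"
proof (induction m)
  case (Suc m)
  have "s ^ (2 ^ Suc m) = s ^ (2 ^ m) * s ^ (2 ^ m)" by (simp add: power_add[symmetric] mult_2)
  then have "norm (s ^ (2 ^ Suc m)) = (norm (s ^ (2 ^ m)))\<^sup>2"
    using norm_selfadjoint_square[of "s ^ (2 ^ m)"] by (simp add: star_power assms)
  then show ?case by (simp add: Suc power_mult[symmetric] mult.commute)
qed simp

text \<open>On exponents \<open>2 ^ m\<close> the norm is multiplicative by the C*-identity, so
  \<open>norm s > 1\<close> would force exponential growth against a linear bound.\<close>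

lemma norm_selfadjoint_le_one:
  fixes s :: "'a::{cstar_algebra,real_normed_algebra_1}"
  assumes "star s = s" "\<And>k. norm (s ^ k) \<le> 1 + C * real k"
  shows "norm s \<le> 1"
proof (rule ccontr)
  assume "\<not> norm s \<le> 1"
  then have a: "norm s > 1" by simp
  have "(\<lambda>n. 1 / norm s ^ n + C * (real n / norm s ^ n)) \<longlonglongrightarrow> 0 + C * 0"
    using lim_n_over_pown[of "norm s"] LIMSEQ_inverse_realpow_zero[OF a] a
    by (intro tendsto_intros) (simp_all add: inverse_eq_divide)
  then have "eventually (\<lambda>n. 1 / norm s ^ n + C * (real n / norm s ^ n) < 1) sequentially"
    by (rule order_tendstoD) simp
  then obtain N where N: "\<And>n. n \<ge> N \<Longrightarrow> 1 / norm s ^ n + C * (real n / norm s ^ n) < 1"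
    by (auto simp: eventually_sequentially)
  have "N \<le> 2 ^ N" by (rule less_imp_le) (rule less_exp)
  then have "(1 + C * real (2 ^ N)) / norm s ^ (2 ^ N) < 1"
    using N[of "2 ^ N"] by (simp add: add_divide_distrib)
  then have "1 + C * real (2 ^ N) < norm s ^ (2 ^ N)"
    using a by (subst (asm) pos_divide_less_eq) (auto intro!: zero_less_power intro: less_trans[of 0 1])
  then show False using assms(2)[of "2 ^ N"] norm_selfadjoint_power_two[OF assms(1), of N] by simp
qed

text \<open>
  For \<open>h = y\<^sup>* y\<close> and \<open>s = 1 - h\<close>, the element \<open>h s\<^sup>2\<^sup>n = (y s\<^sup>n)\<^sup>* (y s\<^sup>n)\<close> is at most \<open>1\<close>, and so is
  \<open>(y s\<^sup>n) (y s\<^sup>n)\<^sup>*\<close>.  As \<open>w\<^sup>* w + w w\<^sup>* \<ge> 0\<close>, the former is also at least \<open>-1\<close>.  Hence \<open>\<parallel>h s\<^sup>k\<parallel>\<close> is bounded,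
  so the powers of \<open>s\<close> grow at most linearly, which forces \<open>\<parallel>1 - h\<parallel> \<le> 1\<close>.
\<close>

lemma upos_star_mult_self_aux:
  fixes y :: "'a::{cstar_algebra,real_normed_algebra_1}"
  assumes "norm y \<le> 1"
  shows "upos (star y * y)"
proof -
  define h Q where "h = star y * y" and "Q = y * star y"
  define s q where "s = 1 - h" and "q = 1 - Q"
  have nh: "norm h \<le> 1" and nQ: "norm Q \<le> 1"
    using assms by (auto simp: h_def Q_def cstar_identity cstar_identity' power_le_one)
  have sh: "star h = h" and sQ: "star Q = Q"
    by (simp_all add: h_def Q_def star_mult star_star)
  have s: "upos s" and q: "upos q"
    unfolding s_def q_def using nh nQ sh sQ by (auto intro: upos_one_minus)
  have h1: "1 - s = h" and Q1: "1 - q = Q" by (simp_all add: s_def q_def)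
  have sn: "star (s ^ n) = s ^ n" for n by (simp add: star_power upos_selfadjoint s)
  have comm: "s ^ n * h = h * s ^ n" for n
    by (rule power_commuting_commutes) (simp add: s_def algebra_simps)
  have commQ: "q ^ n * Q = Q * q ^ n" for n
    by (rule power_commuting_commutes) (simp add: q_def algebra_simps)
  \<comment> \<open>Since \<open>y (1 - star y * y) = (1 - y * star y) y\<close>, moving
    \<open>y\<close> across turns \<open>s\<close> into \<open>q\<close>. Thus
    \<open>w * star w\<close> below has the shape of \<open>star w * w\<close> with \<open>Q\<close>
    for \<open>h\<close>, and the same estimate covers both.\<close>
  have ys: "y * s ^ n = q ^ n * y" for n
  proof (induction n)
    case (Suc n)
    have "y * s = q * y" by (simp add: s_def q_def h_def Q_def algebra_simps)
    then have "y * s ^ Suc n = q * (y * s ^ n)" by (metis mult.assoc power_Suc)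
    then show ?case using Suc by (simp add: mult.assoc)
  qed simp
  have bound: "norm (h * s ^ (2 * n)) \<le> 2" for n
  proof -
    define w where "w = y * s ^ n"
    define H K where "H = h * s ^ (2 * n)" and "K = Q * q ^ (2 * n)"
    have "star w * w = s ^ n * h * s ^ n"
      by (simp add: w_def star_mult sn h_def mult.assoc)
    then have H: "star w * w = H" by (simp add: H_def comm mult.assoc power_add[symmetric] mult_2)
    have "w * star w = (y * s ^ (2 * n)) * star y"
      by (simp add: w_def star_mult sn mult.assoc power_add mult_2)
    then have K: "w * star w = K" by (simp add: ys K_def mult.assoc Q_def[symmetric] commQ)
    have 1: "upos (1 - H)" and "upos (1 - K)"
      using upos_one_minus_mult_power[OF s, of "2 * n"] upos_one_minus_mult_power[OF q, of "2 * n"]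
      unfolding H_def K_def h1 Q1 by simp_all
    moreover have "upos (H + K)" using upos_star_mult_add_mult_star[of w] H K by simp
    ultimately have "upos (1 - K + (H + K))" by (blast intro: upos_add)
    then have 2: "upos (1 + H)" by (simp add: algebra_simps)
    have "norm (1 + H) \<le> 2"
    proof (rule upos_norm_le[OF 2])
      have "2 *\<^sub>R 1 - (1 + H) = 1 - H" by (simp only: scaleR_2) simp
      with 1 show "upos (2 *\<^sub>R 1 - (1 + H))" by (simp only:)
    qed simp
    moreover have "norm (1 - H) \<le> 2"
    proof (rule upos_norm_le[OF 1])
      have "2 *\<^sub>R 1 - (1 - H) = 1 + H" by (simp only: scaleR_2) simp
      with 2 show "upos (2 *\<^sub>R 1 - (1 - H))" by (simp only:)
    qed simp
    moreover have "2 *\<^sub>R H = (1 + H) - (1 - H)" by (simp add: scaleR_2)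
    then have "2 * norm H \<le> norm (1 + H) + norm (1 - H)"
      by (metis norm_triangle_ineq4 norm_scaleR abs_numeral)
    ultimately show ?thesis by (simp add: H_def)
  qed
  have "norm s \<le> norm (1::'a) + norm h" unfolding s_def by (rule norm_triangle_ineq4)
  then have ns: "norm s \<le> 2" using nh by simp
  \<comment> \<open>Only even exponents give the form \<open>star w * w\<close>; an odd one costs a
    further factor \<open>norm s \<le> 2\<close>.\<close>
  have bound': "norm (h * s ^ j) \<le> 4" for j
  proof (cases "even j")
    case True
    then show ?thesis using bound[of "j div 2"] by simp
  next
    case False
    then have "h * s ^ j = h * s ^ (2 * (j div 2)) * s"
      by (metis odd_two_times_div_two_succ power_Suc2 Suc_eq_plus1 mult.assoc)
    then have "norm (h * s ^ j) \<le> norm (h * s ^ (2 * (j div 2))) * norm s"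
      by (simp add: norm_mult_ineq)
    also have "\<dots> \<le> 2 * 2" by (intro mult_mono bound ns) auto
    finally show ?thesis by simp
  qed
  have "norm (s ^ k) \<le> 1 + 4 * real k" for k
  proof (induction k)
    case (Suc k)
    \<comment> \<open>Each further factor \<open>s\<close> changes the power by
      \<open>h * s ^ k\<close>, of norm at most \<open>4\<close>.\<close>
    have "s ^ Suc k = s ^ k - h * s ^ k" by (simp add: s_def left_diff_distrib)
    then have "norm (s ^ Suc k) \<le> norm (s ^ k) + norm (h * s ^ k)"
      by (simp add: norm_triangle_ineq4)
    then show ?case using Suc bound'[of k] by simp
  qed simp
  then have "norm s \<le> 1"
    by (rule norm_selfadjoint_le_one[OF upos_selfadjoint[OF s]])
  then show ?thesis
    unfolding upos_iff h_def[symmetric] using sh by (intro conjI exI[of _ 1]) (auto simp: s_def)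
qed

lemma upos_star_mult_self: "upos (star y * y)"
proof (cases "y = 0")
  case False
  have "upos (star ((1 / norm y) *\<^sub>R y) * ((1 / norm y) *\<^sub>R y))"
    by (rule upos_star_mult_self_aux) (use False in simp)
  then have "upos ((norm y)\<^sup>2 *\<^sub>R (star ((1 / norm y) *\<^sub>R y) * ((1 / norm y) *\<^sub>R y)))"
    by (rule upos_scaleR) simp
  then show ?thesis using False by (simp add: star_scaleR power2_eq_square)
qed simp

lemma upos_conjugate:
  assumes "upos h"
  shows "upos (star x * h * x)"
proof -
  obtain k where "star k = k" "h = k * k" using assms by (auto simp: upos_def)
  then have "star x * h * x = star (k * x) * (k * x)" by (simp add: star_mult mult.assoc)
  then show ?thesis using upos_star_mult_self by simp
qed

text \<open>With \<open>t\<close> for \<open>k\<^sup>2\<close>, this is the scalar estimate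
  \<open>N t (1 - t)\<^sup>N \<le> 1 - (1 - t)\<^sup>N \<le> 1\<close> on
  \<open>0 \<le> t \<le> 1\<close>: by the geometric sum, \<open>1 - (1 - t)\<^sup>N\<close> is
  \<open>t\<close> times a sum of \<open>N\<close> terms, each at least
  \<open>(1 - t)\<^sup>N\<close>.\<close>

lemma upos_mult_power_bound:
  fixes k :: "'a::{cstar_algebra,real_normed_algebra_1}"
  assumes k: "star k = k" "norm k \<le> 1"
  shows "real N * norm (k * k * (1 - k * k) ^ N) \<le> 1"
proof -
  define s where "s = 1 - k * k"
  have "norm (k * k) \<le> 1" using k by (simp add: norm_selfadjoint_square power_le_one)
  then have us: "upos s" unfolding s_def by (intro upos_one_minus) (auto simp: star_mult k)
  obtain r where r: "star r = r" "r * r = s" "\<And>z. z * s = s * z \<Longrightarrow> z * r = r * z"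
    using upos_sqrt[OF upos_selfadjoint[OF us] upos_norm_diff_le[OF us order_refl]] by blast
  have "k * r = r * k" by (rule r(3)) (simp add: s_def algebra_simps)
  then have kr: "r ^ n * k = k * r ^ n" for n
    using power_commuting_commutes[of r k n] by simp
  have rN: "r ^ n * r ^ n = s ^ n" for n
    unfolding r(2)[symmetric] by (metis power2_eq_square power_mult power_add mult_2)
  define e where "e n = k * k * s ^ n" for n
  have e1: "(k * r ^ n) * (k * r ^ n) = e n" for n
    unfolding e_def by (metis kr mult.assoc rN)
  have e2: "(k * k * r ^ n) * (k * k * r ^ n) = k * k * e n" for n
    unfolding e_def by (metis kr mult.assoc rN)
  have ue: "upos (e n)" for n
    unfolding e1[symmetric] by (rule upos_square) (simp add: star_mult star_power k r kr)
  have ue': "upos (k * k * e n)" for n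
    unfolding e2[symmetric] by (rule upos_square) (metis star_mult star_power k(1) r(1) kr mult.assoc)
  \<comment> \<open>This stronger inequality carries the induction: from \<open>n\<close> to
    \<open>Suc n\<close> the element gains the positive summand
    \<open>real (Suc n) *\<^sub>R (k * k * e n)\<close>.\<close>
  have "upos (1 - s ^ n - real n *\<^sub>R e n)" for n
  proof (induction n)
    case (Suc n)
    have sS: "s ^ Suc n = s ^ n - e n" by (simp add: s_def e_def left_diff_distrib)
    have eS: "e (Suc n) = e n - k * k * e n"
      unfolding e_def sS by (simp add: right_diff_distrib e_def)
    have "1 - s ^ Suc n - real (Suc n) *\<^sub>R e (Suc n) =
        (1 - s ^ n - real n *\<^sub>R e n) + real (Suc n) *\<^sub>R (k * k * e n)"
      unfolding sS eS by (simp add: scaleR_diff_right scaleR_add_left algebra_simps)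
    then show ?case using upos_add[OF Suc upos_scaleR[OF ue'[of n]]] by (metis of_nat_0_le_iff)
  qed simp
  moreover have "upos (s ^ N)"
    unfolding rN[symmetric] by (rule upos_square) (simp add: star_power r)
  ultimately have "upos (1 - s ^ N - real N *\<^sub>R e N + s ^ N)" using upos_add by blast
  then have "norm (real N *\<^sub>R e N) \<le> 1"
    by (intro upos_norm_le upos_scaleR ue) simp_all
  then show ?thesis by (simp add: e_def s_def)
qed

text \<open>The elements \<open>1 - (1 - k\<^sup>2)\<^sup>m\<close> act on \<open>x\<close> from the
  right like an approximate unit. Two square roots are lost:
  \<open>(norm (x s\<^sup>m))\<^sup>2 \<le> norm (k s\<^sup>m)\<close> from
  \<open>star x * x \<le> k\<close>, and \<open>(norm (k s\<^sup>m))\<^sup>2 \<le> 1 / m\<close>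
  from the power bound; hence the fourth power below.\<close>

lemma mult_one_minus_power_tendsto_zero:
  fixes k x :: "'a::{cstar_algebra,real_normed_algebra_1}"
  assumes k: "upos k" "norm k \<le> 1" and x: "upos (k - star x * x)"
  shows "(\<lambda>m. x * (1 - k * k) ^ m) \<longlonglongrightarrow> 0"
proof -
  note sk = upos_selfadjoint[OF k(1)]
  define s where "s = 1 - k * k"
  have ss: "star (s ^ m) = s ^ m" for m by (simp add: star_power s_def star_diff star_mult sk)
  have ns: "norm (s ^ m) \<le> 1" for m
  proof -
    have "norm (s ^ m) \<le> norm s ^ m" by (rule norm_power_ineq)
    also have "\<dots> \<le> 1" unfolding s_def by (intro power_le_one norm_one_minus_square sk k) simp
    finally show ?thesis .
  qed
  have "s * k = k * s" by (simp add: s_def algebra_simps)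
  then have comm: "s ^ m * k = k * s ^ m" for m by (rule power_commuting_commutes)
  have ks: "(norm (k * s ^ m))\<^sup>2 \<le> inverse (real m)" if "m > 0" for m
  proof -
    have "star (k * s ^ m) * (k * s ^ m) = k * k * s ^ (2 * m)"
      unfolding star_mult sk ss mult_2 power_add by (metis comm mult.assoc)
    then have "(norm (k * s ^ m))\<^sup>2 = norm (k * k * s ^ (2 * m))" by (metis cstar_identity)
    moreover have "real m * norm (k * k * s ^ (2 * m)) \<le> 1"
      using upos_mult_power_bound[OF sk k(2), of "2 * m"] norm_ge_zero[of "k * k * s ^ (2 * m)"]
      unfolding s_def[symmetric] by (simp add: mult.assoc)
    ultimately show ?thesis using that by (simp add: field_simps)
  qed
  have xs: "(norm (x * s ^ m))\<^sup>2 \<le> norm (k * s ^ m)" for m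
  proof -
    have "(norm (x * s ^ m))\<^sup>2 = norm (star (x * s ^ m) * (x * s ^ m))" by (simp add: cstar_identity)
    also have "star (x * s ^ m) * (x * s ^ m) = s ^ m * (star x * x) * s ^ m"
      by (simp add: star_mult ss mult.assoc)
    also have "norm \<dots> \<le> norm (s ^ m * k * s ^ m)"
    proof (rule upos_norm_mono)
      show "upos (s ^ m * (star x * x) * s ^ m)"
        using upos_conjugate[OF upos_star_mult_self[of x], of "s ^ m"] by (simp add: ss)
      show "upos (s ^ m * k * s ^ m - s ^ m * (star x * x) * s ^ m)"
        using upos_conjugate[OF x, of "s ^ m"] by (simp add: ss right_diff_distrib left_diff_distrib)
    qed
    also have "\<dots> \<le> norm (s ^ m) * norm (k * s ^ m)" by (simp add: mult.assoc norm_mult_ineq)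
    also have "\<dots> \<le> norm (k * s ^ m)" using ns[of m] by (simp add: mult_left_le_one_le)
    finally show ?thesis .
  qed
  have "(\<lambda>m. norm (x * s ^ m) ^ 4) \<longlonglongrightarrow> 0"
  proof (rule tendsto_sandwich[OF _ _ tendsto_const lim_inverse_n])
    show "\<forall>\<^sub>F m in sequentially. norm (x * s ^ m) ^ 4 \<le> inverse (real m)"
      using eventually_gt_at_top[of 0]
    proof eventually_elim
      case (elim m)
      have "norm (x * s ^ m) ^ 4 = ((norm (x * s ^ m))\<^sup>2)\<^sup>2" by (simp add: power_mult[symmetric])
      also have "\<dots> \<le> (norm (k * s ^ m))\<^sup>2" by (intro power_mono xs) simp
      also have "\<dots> \<le> inverse (real m)" by (rule ks[OF elim])
      finally show ?case .
    qed
  qed simp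
  then have "(\<lambda>m. root 4 (norm (x * s ^ m) ^ 4)) \<longlonglongrightarrow> root 4 0" by (rule tendsto_real_root)
  then have "(\<lambda>m. norm (x * s ^ m)) \<longlonglongrightarrow> 0" by (simp add: real_root_power_cancel)
  then show ?thesis unfolding s_def by (rule tendsto_norm_zero_cancel)
qed

section \<open>Unitization\<close>

datatype 'a unitization = Unitization (alg_part: 'a) (scalar_part: complex)

text \<open>Left multiplication by \<open>u\<close> on the algebra, seen as an ideal of its
  unitization; its operator norm enters the norm of the unitization.\<close>

definition unit_act :: "'a::cstar_algebra unitization \<Rightarrow> 'a \<Rightarrow> 'a" where
  "unit_act u x = alg_part u * x + scalar_part u *\<^sub>C x"

lemma bounded_linear_scaleC: "bounded_linear (\<lambda>x::'a::cstar_algebra. c *\<^sub>C x)"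
  by (rule bounded_linear_intro[where K = "cmod c"])
    (auto simp: scaleC_add_right scaleR_scaleC scaleC_scaleC norm_scaleC mult.commute)

lemma bounded_linear_unit_act: "bounded_linear (unit_act u)"
  unfolding unit_act_def[abs_def]
  by (intro bounded_linear_add bounded_linear_mult_right bounded_linear_scaleC)

instantiation unitization :: (cstar_algebra) complex_vector
begin

definition "0 = Unitization 0 0"
definition "u + v = Unitization (alg_part u + alg_part v) (scalar_part u + scalar_part v)"
definition "- u = Unitization (- alg_part u) (- scalar_part u)"
definition "u - v = Unitization (alg_part u - alg_part v) (scalar_part u - scalar_part v)"
definition "r *\<^sub>R u = Unitization (r *\<^sub>R alg_part u) (r *\<^sub>R scalar_part u)"
definition "c *\<^sub>C u = Unitization (c *\<^sub>C alg_part u) (c * scalar_part u)"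

instance
  by standard
    (auto simp: zero_unitization_def plus_unitization_def uminus_unitization_def minus_unitization_def
      scaleR_unitization_def scaleC_unitization_def algebra_simps scaleC_add_right scaleC_add_left
      scaleC_scaleC scaleR_scaleC scaleR_conv_of_real)

end

lemma unit_act_simps:
  "unit_act 0 x = 0"
  "unit_act (u + v) x = unit_act u x + unit_act v x"
  "unit_act (u - v) x = unit_act u x - unit_act v x"
  "unit_act (r *\<^sub>R u) x = r *\<^sub>R unit_act u x"
  "unit_act (c *\<^sub>C u) x = c *\<^sub>C unit_act u x"
  "unit_act u (x + y) = unit_act u x + unit_act u y"
  "unit_act u (x - y) = unit_act u x - unit_act u y"
  "unit_act u (c *\<^sub>C x) = c *\<^sub>C unit_act u x"
  "unit_act u (x * y) = unit_act u x * y"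
  by (simp_all add: unit_act_def zero_unitization_def plus_unitization_def minus_unitization_def
      scaleR_unitization_def scaleC_unitization_def distrib_left distrib_right left_diff_distrib right_diff_distrib
      scaleC_add_right scaleC_add_left scaleC_diff_right scaleR_add_right scaleR_conv_of_real
      scaleC_scaleC scaleR_scaleC mult_scaleC_left mult_scaleC_right mult.commute[of c for c :: complex]
      mult.assoc scaleC_minus_left scaleC_add_left[of a "- b" for a b, simplified])

text \<open>
  The second argument of the maximum is needed because the left action is not faithful when the
  algebra already has a unit.
\<close>

instantiation unitization :: (cstar_algebra) real_normed_algebra_1
begin

definition "1 = Unitization 0 1"
definition "u * v = Unitization
  (alg_part u * alg_part v + scalar_part u *\<^sub>C alg_part v + scalar_part v *\<^sub>C alg_part u)
  (scalar_part u * scalar_part v)"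
definition "norm u = max (onorm (unit_act u)) (cmod (scalar_part u))"
definition dist_unitization :: "'a unitization \<Rightarrow> 'a unitization \<Rightarrow> real"
  where "dist_unitization x y = norm (x - y)"
definition sgn_unitization :: "'a unitization \<Rightarrow> 'a unitization"
  where "sgn_unitization x = x /\<^sub>R norm x"
definition uniformity_unitization :: "('a unitization \<times> 'a unitization) filter" where
  "uniformity_unitization = (INF e\<in>{0<..}. principal {(x, y). dist x y < e})"
definition open_unitization :: "'a unitization set \<Rightarrow> bool" where
  "open_unitization U \<longleftrightarrow> (\<forall>x\<in>U. \<forall>\<^sub>F (x', y) in uniformity. x' = x \<longrightarrow> y \<in> U)"

lemma unit_act_mult: "unit_act (u * v) x = unit_act u (unit_act v x)"
  by (simp add: unit_act_def times_unitization_def algebra_simps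
      scaleC_add_right scaleC_scaleC mult_scaleC_left mult_scaleC_right)

instance
proof
  fix u v w :: "'a unitization" and r :: real
  show "u * v * w = u * (v * w)"
    by (simp add: times_unitization_def algebra_simps
      scaleC_add_right scaleC_scaleC mult_scaleC_left mult_scaleC_right)
  show "(u + v) * w = u * w + v * w" "u * (v + w) = u * v + u * w"
    by (simp_all add: times_unitization_def plus_unitization_def algebra_simps
      scaleC_add_right scaleC_add_left)
  show "r *\<^sub>R u * v = r *\<^sub>R (u * v)" "u * r *\<^sub>R v = r *\<^sub>R (u * v)"
    by (simp_all add: times_unitization_def scaleR_unitization_def algebra_simps
      scaleR_scaleC scaleC_add_right scaleC_scaleC scaleR_conv_of_real mult_scaleC_left mult_scaleC_right)
  show "1 * u = u" "u * 1 = u" "(0::'a unitization) \<noteq> 1"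
    by (simp_all add: times_unitization_def one_unitization_def zero_unitization_def)
  show "norm u = 0 \<longleftrightarrow> u = 0"
  proof
    assume "norm u = 0"
    then have n: "onorm (unit_act u) = 0" "scalar_part u = 0"
      using onorm_pos_le[OF bounded_linear_unit_act[of u]]
      by (simp_all add: norm_unitization_def max_def split: if_splits)
    \<comment> \<open>Test vector: as the scalar part is \<open>0\<close>, applying \<open>u\<close>
      to \<open>star (alg_part u)\<close> gives a product that vanishes only together with
      \<open>alg_part u\<close>.\<close>
    then have "unit_act u (star (alg_part u)) = 0"
      using onorm_eq_0[OF bounded_linear_unit_act] by blast
    then have "alg_part u * star (alg_part u) = 0" using n by (simp add: unit_act_def)
    then have "alg_part u = 0" using cstar_identity'[of "alg_part u"] by simp
    then show "u = 0" using n by (simp add: zero_unitization_def unitization.expand)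
  qed (simp add: norm_unitization_def zero_unitization_def unit_act_def[abs_def] onorm_zero)
  show "norm (u + v) \<le> norm u + norm v"
  proof -
    have "unit_act (u + v) = (\<lambda>x. unit_act u x + unit_act v x)" by (simp add: fun_eq_iff unit_act_simps)
    then have "onorm (unit_act (u + v)) \<le> onorm (unit_act u) + onorm (unit_act v)"
      using onorm_triangle[OF bounded_linear_unit_act[of u] bounded_linear_unit_act[of v]]
      by simp
    moreover have "cmod (scalar_part (u + v)) \<le> cmod (scalar_part u) + cmod (scalar_part v)"
      by (simp add: plus_unitization_def norm_triangle_ineq)
    ultimately show ?thesis unfolding norm_unitization_def by linarith
  qed
  show "norm (r *\<^sub>R u) = \<bar>r\<bar> * norm u"
  proof -
    have "unit_act (r *\<^sub>R u) = (\<lambda>x. r *\<^sub>R unit_act u x)" by (simp add: fun_eq_iff unit_act_simps)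
    then have "onorm (unit_act (r *\<^sub>R u)) = \<bar>r\<bar> * onorm (unit_act u)"
      using onorm_scaleR[OF bounded_linear_unit_act[of u]] by simp
    then show ?thesis
      by (simp add: norm_unitization_def scaleR_unitization_def max_mult_distrib_left)
  qed
  show "norm (u * v) \<le> norm u * norm v"
  proof -
    have "unit_act (u * v) = unit_act u \<circ> unit_act v" by (simp add: fun_eq_iff unit_act_mult)
    then have "onorm (unit_act (u * v)) \<le> onorm (unit_act u) * onorm (unit_act v)"
      using onorm_compose[OF bounded_linear_unit_act[of u] bounded_linear_unit_act[of v]] by simp
    also have "\<dots> \<le> norm u * norm v"
      unfolding norm_unitization_def
      by (intro mult_mono) (auto simp: onorm_pos_le bounded_linear_unit_act le_max_iff_disj)
    finally have "onorm (unit_act (u * v)) \<le> norm u * norm v" .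
    moreover have "cmod (scalar_part (u * v)) \<le> norm u * norm v"
      unfolding times_unitization_def norm_unitization_def unitization.sel norm_mult
      by (intro mult_mono) (auto simp: onorm_pos_le bounded_linear_unit_act le_max_iff_disj)
    ultimately show ?thesis by (simp add: norm_unitization_def)
  qed
  have "unit_act (1::'a unitization) = (\<lambda>x. x)"
    by (simp add: fun_eq_iff unit_act_def one_unitization_def)
  then show "norm (1::'a unitization) = 1"
    using onorm_id_le[where ?'a = 'a] by (simp add: norm_unitization_def one_unitization_def)
qed (simp_all add: dist_unitization_def sgn_unitization_def uniformity_unitization_def open_unitization_def)

end

abbreviation embed :: "'a \<Rightarrow> 'a unitization" where
  "embed a \<equiv> Unitization a 0"

lemma norm_embed [simp]: "norm (embed a) = norm (a::'a::cstar_algebra)"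
proof (rule antisym)
  have "onorm (unit_act (embed a)) \<le> norm a"
    by (rule onorm_bound) (auto simp: unit_act_def norm_mult_ineq)
  then show "norm (embed a) \<le> norm a" by (simp add: norm_unitization_def)
  \<comment> \<open>Left multiplication by \<open>a\<close> attains its norm at
    \<open>star a\<close>.\<close>
  have "norm (a * star a) \<le> onorm (unit_act (embed a)) * norm (star a)"
    using onorm[OF bounded_linear_unit_act, of "embed a" "star a"] by (simp add: unit_act_def)
  then have "norm a * norm a \<le> onorm (unit_act (embed a)) * norm a"
    by (simp add: cstar_identity' power2_eq_square)
  then have "norm a \<le> onorm (unit_act (embed a))"
    using onorm_pos_le[OF bounded_linear_unit_act, of "embed a"] by (cases "norm a = 0") auto
  then show "norm a \<le> norm (embed a)" by (simp add: norm_unitization_def)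
qed

lemma embed_simps:
  "embed 0 = 0" "embed (a + b) = embed a + embed b" "embed (a - b) = embed a - embed b"
  "embed (r *\<^sub>R a) = r *\<^sub>R embed a" "embed (a * b) = embed a * embed (b::'a::cstar_algebra)"
  by (simp_all add: zero_unitization_def plus_unitization_def minus_unitization_def
      scaleR_unitization_def times_unitization_def)

text \<open>Continuity of both components reduces completeness to that of the algebra and of the
  complex numbers. The factor \<open>2\<close> arises because the algebra part is \<open>u\<close>
  minus its scalar part.\<close>

lemma norm_unitization_bounds:
  "cmod (scalar_part u) \<le> norm u" "norm (alg_part u) \<le> 2 * norm (u::'a::cstar_algebra unitization)"
proof -
  show 1: "cmod (scalar_part u) \<le> norm u" by (simp add: norm_unitization_def)
  have 2: "norm (Unitization (0::'a) c) \<le> cmod c" for c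
  proof -
    have "onorm (unit_act (Unitization (0::'a) c)) \<le> cmod c"
      by (rule onorm_bound) (auto simp: unit_act_def norm_scaleC)
    then show ?thesis by (simp add: norm_unitization_def)
  qed
  have "embed (alg_part u) = u - Unitization 0 (scalar_part u)"
    by (simp add: minus_unitization_def)
  then have "norm (embed (alg_part u)) \<le> norm u + norm (Unitization (0::'a) (scalar_part u))"
    by (metis norm_triangle_ineq4)
  then show "norm (alg_part u) \<le> 2 * norm u" using 1 2[of "scalar_part u"] by simp
qed

instance unitization :: (cstar_algebra) banach
proof
  fix X :: "nat \<Rightarrow> 'a unitization"
  assume X: "Cauchy X"
  have bl: "bounded_linear (alg_part :: 'a unitization \<Rightarrow> 'a)"
    by (rule bounded_linear_intro[where K = 2])
      (use norm_unitization_bounds(2) in \<open>auto simp: plus_unitization_def scaleR_unitization_def mult.commute[of _ 2]\<close>)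
  have bl2: "bounded_linear (scalar_part :: 'a unitization \<Rightarrow> complex)"
    by (rule bounded_linear_intro[where K = 1])
      (auto simp: plus_unitization_def scaleR_unitization_def norm_unitization_bounds)
  obtain a where a: "(\<lambda>n. alg_part (X n)) \<longlonglongrightarrow> a"
    using bounded_linear.Cauchy[OF bl X] Cauchy_convergent convergent_def by blast
  obtain c where c: "(\<lambda>n. scalar_part (X n)) \<longlonglongrightarrow> c"
    using bounded_linear.Cauchy[OF bl2 X] Cauchy_convergent convergent_def by blast
  have bd: "norm (u::'a unitization) \<le> norm (alg_part u) + cmod (scalar_part u)" for u
  proof -
    have "onorm (unit_act u) \<le> norm (alg_part u) + cmod (scalar_part u)"
    proof (rule onorm_bound)
      fix x show "norm (unit_act u x) \<le> (norm (alg_part u) + cmod (scalar_part u)) * norm x"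
        unfolding unit_act_def distrib_right
        by (rule order_trans[OF norm_triangle_ineq]) (simp add: norm_mult_ineq norm_scaleC)
    qed simp
    then show ?thesis by (simp add: norm_unitization_def)
  qed
  have "(\<lambda>n. norm (alg_part (X n) - a) + cmod (scalar_part (X n) - c)) \<longlonglongrightarrow> 0"
    by (intro tendsto_add_zero tendsto_norm_zero LIM_zero a c)
  moreover have "norm (X n - Unitization a c) \<le> norm (alg_part (X n) - a) + cmod (scalar_part (X n) - c)" for n
    using bd[of "X n - Unitization a c"] by (simp add: minus_unitization_def)
  ultimately have "(\<lambda>n. X n - Unitization a c) \<longlonglongrightarrow> 0"
    by (metis (no_types, lifting) Lim_null_comparison always_eventually)
  then have "X \<longlonglongrightarrow> Unitization a c" by (rule LIM_zero_cancel)
  then show "convergent X" by (auto simp: convergent_def)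
qed

instantiation unitization :: (cstar_algebra) cstar_algebra
begin

definition "star u = Unitization (star (alg_part u)) (cnj (scalar_part u))"

text \<open>With \<open>star x * y\<close> as an inner product with values in the algebra, the
  actions of \<open>u\<close> and \<open>star u\<close> are adjoint to each other. The C*-identity
  then follows as for operators on a Hilbert space.\<close>

lemma star_unit_act: "star (unit_act u x) * y = star x * unit_act (star u) y"
  by (simp add: unit_act_def star_unitization_def star_add star_mult star_scaleC distrib_left distrib_right
      mult_scaleC_left mult_scaleC_right mult.assoc)

instance
proof
  fix u v :: "'a unitization" and c :: complex
  have le: "onorm (unit_act (c *\<^sub>C u)) \<le> cmod c * onorm (unit_act u)" for c and u :: "'a unitization"
    by (rule onorm_bound)
      (auto simp: unit_act_simps norm_scaleC mult.assoc intro!: mult_nonneg_nonneg mult_left_mono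
        onorm onorm_pos_le bounded_linear_unit_act)
  show "c *\<^sub>C u * v = c *\<^sub>C (u * v)" "u * c *\<^sub>C v = c *\<^sub>C (u * v)"
    by (simp_all add: times_unitization_def scaleC_unitization_def algebra_simps
      scaleC_add_right scaleC_scaleC mult_scaleC_left mult_scaleC_right)
  have nle: "norm (c *\<^sub>C u) \<le> cmod c * norm u" for c and u :: "'a unitization"
  proof -
    have "cmod (scalar_part (c *\<^sub>C u)) = cmod c * cmod (scalar_part u)"
      by (simp add: scaleC_unitization_def norm_mult)
    moreover have "onorm (unit_act u) \<le> norm u" "cmod (scalar_part u) \<le> norm u"
      by (simp_all add: norm_unitization_def)
    ultimately have "cmod (scalar_part (c *\<^sub>C u)) \<le> cmod c * norm u"
        "onorm (unit_act (c *\<^sub>C u)) \<le> cmod c * norm u"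
      using order_trans[OF le[of c u] mult_left_mono[of "onorm (unit_act u)" "norm u" "cmod c"]]
      by (simp_all add: mult_left_mono)
    then show ?thesis by (simp add: norm_unitization_def[of "c *\<^sub>C u"])
  qed
  show "norm (c *\<^sub>C u) = cmod c * norm u"
  proof (cases "c = 0")
    case False
    have "u = inverse c *\<^sub>C (c *\<^sub>C u)" using False by (simp add: scaleC_scaleC)
    then have "norm u \<le> inverse (cmod c) * norm (c *\<^sub>C u)" using nle by (metis norm_inverse)
    then have "cmod c * norm u \<le> norm (c *\<^sub>C u)" using False by (simp add: field_simps)
    then show ?thesis using nle[of c u] by simp
  qed simp
  show "star (star u) = u" by (simp add: star_unitization_def star_star)
  show "star (u + v) = star u + star v"
    by (simp add: star_unitization_def plus_unitization_def star_add)
  show "star (c *\<^sub>C u) = cnj c *\<^sub>C star u"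
    by (simp add: star_unitization_def scaleC_unitization_def star_scaleC)
  show "star (u * v) = star v * star u"
    by (simp add: star_unitization_def times_unitization_def star_add star_mult star_scaleC algebra_simps)
  \<comment> \<open>The inequality with content: submultiplicativity then makes \<open>star\<close>
    isometric, and this gives the reverse inequality.\<close>
  have le2: "(norm u)\<^sup>2 \<le> norm (star u * u)" for u :: "'a unitization"
  proof -
    let ?N = "norm (star u * u)"
    have "onorm (unit_act u) \<le> sqrt ?N"
    proof (rule onorm_bound)
      fix x
      have "(norm (unit_act u x))\<^sup>2 = norm (star x * unit_act (star u * u) x)"
        by (simp add: cstar_identity[symmetric] star_unit_act unit_act_mult)
      also have "\<dots> \<le> norm x * (onorm (unit_act (star u * u)) * norm x)"
        by (rule order_trans[OF norm_mult_ineq]) (simp add: mult_left_mono onorm bounded_linear_unit_act)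
      also have "\<dots> \<le> norm x * (?N * norm x)"
        by (intro mult_left_mono mult_right_mono) (auto simp: norm_unitization_def)
      also have "\<dots> = (sqrt ?N * norm x)\<^sup>2" by (simp add: power_mult_distrib power2_eq_square)
      finally show "norm (unit_act u x) \<le> sqrt ?N * norm x" by (rule power2_le_imp_le) simp
    qed simp
    moreover have "cmod (scalar_part u) \<le> sqrt ?N"
    proof (rule real_le_rsqrt)
      have "(cmod (scalar_part u))\<^sup>2 = cmod (scalar_part (star u * u))"
        by (simp add: star_unitization_def times_unitization_def norm_mult power2_eq_square)
      also have "\<dots> \<le> ?N" by (rule norm_unitization_bounds)
      finally show "(cmod (scalar_part u))\<^sup>2 \<le> ?N" .
    qed
    ultimately have "norm u \<le> sqrt ?N" by (simp add: norm_unitization_def[of u])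
    then have "(norm u)\<^sup>2 \<le> (sqrt ?N)\<^sup>2" by (intro power_mono) auto
    then show ?thesis by simp
  qed
  have ss: "star (star u) = u" for u :: "'a unitization" by (simp add: star_unitization_def star_star)
  have *: "norm u \<le> norm (star u)" for u :: "'a unitization"
  proof (cases "u = 0")
    case False
    have "norm u * norm u \<le> norm (star u) * norm u"
      using le2[of u] norm_mult_ineq[of "star u" u] by (simp add: power2_eq_square)
    then show ?thesis using False by simp
  qed simp
  have "norm (star u * u) \<le> norm u * norm u"
    using norm_mult_ineq[of "star u" u] *[of "star u"] mult_right_mono[of "norm (star u)" "norm u" "norm u"]
    by (simp add: ss)
  then show "norm (star u * u) = (norm u)\<^sup>2" using le2[of u] by (simp add: power2_eq_square)
qed

end

lemma star_embed: "star (embed a) = embed (star a)"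
  by (simp add: star_unitization_def)

section \<open>Positive elements and ideals\<close>

text \<open>From right to left, the scalar part of the root found in the unitization squares to
  \<open>0\<close>, so the root already lies in the algebra.\<close>

lemma cstar_positive_iff_upos: "cstar_positive a \<longleftrightarrow> upos (embed a)"
proof
  assume "cstar_positive a"
  then obtain y where "a = star y * y" by (auto simp: cstar_positive_def)
  then have "embed a = star (embed y) * embed y" by (simp add: embed_simps star_embed)
  then show "upos (embed a)" by (simp add: upos_star_mult_self)
next
  assume "upos (embed a)"
  then obtain k where k: "star k = k" "embed a = k * k" by (auto simp: upos_def)
  have "scalar_part k * scalar_part k = 0"
    using arg_cong[OF k(2), of scalar_part] by (simp add: times_unitization_def)
  then have "k = embed (alg_part k)" by (simp add: unitization.expand)
  then have "embed a = embed (star (alg_part k) * alg_part k)"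
    using k by (metis embed_simps(5) star_embed)
  then show "cstar_positive a" by (auto simp: cstar_positive_def)
qed

lemma cstar_positive_star_mult [simp]: "cstar_positive (star y * y)"
  by (auto simp: cstar_positive_def)

lemma cstar_positive_zero [simp]: "cstar_positive 0"
  using cstar_positive_star_mult[of 0] by simp

lemma cstar_positive_add: "cstar_positive a \<Longrightarrow> cstar_positive b \<Longrightarrow> cstar_positive (a + b)"
  by (simp add: cstar_positive_iff_upos embed_simps upos_add)

lemma cstar_positive_sum: "(\<And>i. i \<in> I \<Longrightarrow> cstar_positive (f i)) \<Longrightarrow> cstar_positive (\<Sum>i\<in>I. f i)"
  by (induction I rule: infinite_finite_induct) (auto intro: cstar_positive_add)

lemma cstar_positive_scaleR: "cstar_positive a \<Longrightarrow> 0 \<le> c \<Longrightarrow> cstar_positive (c *\<^sub>R a)"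
  by (simp add: cstar_positive_iff_upos embed_simps upos_scaleR)

lemma bounded_linear_embed: "bounded_linear (embed :: 'a::cstar_algebra \<Rightarrow> _)"
  by (rule bounded_linear_intro[where K = 1]) (auto simp: embed_simps)

lemma cstar_positive_tendsto:
  assumes "\<And>n. cstar_positive (h n)" "h \<longlonglongrightarrow> l"
  shows "cstar_positive l"
  using upos_tendsto[OF _ bounded_linear.tendsto[OF bounded_linear_embed assms(2)]] assms(1)
  by (simp add: cstar_positive_iff_upos)

lemma cstar_positive_norm_mono:
  assumes "cstar_positive a" "cstar_positive (b - a)"
  shows "norm a \<le> norm b"
  using upos_norm_mono[of "embed a" "embed b"] assms by (simp add: cstar_positive_iff_upos embed_simps)

lemma norm_square_le_norm_sum:
  assumes "finite I" "i \<in> I"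
  shows "(norm (y i))\<^sup>2 \<le> norm (\<Sum>j\<in>I. star (y j) * y j :: 'a::cstar_algebra)"
proof -
  have "(\<Sum>j\<in>I. star (y j) * y j) - star (y i) * y i = (\<Sum>j\<in>I - {i}. star (y j) * y j)"
    using assms by (simp add: sum_diff1)
  then have "norm (star (y i) * y i) \<le> norm (\<Sum>j\<in>I. star (y j) * y j)"
    by (intro cstar_positive_norm_mono) (auto intro: cstar_positive_sum)
  then show ?thesis by (simp add: cstar_identity)
qed

lemma projection_positive: "projection p \<Longrightarrow> cstar_positive p"
  using cstar_positive_star_mult[of p] by (simp add: projection_def)

lemma projection_zero [simp]: "projection 0"
  by (simp add: projection_def)

section \<open>Closed ideals and their generators\<close>

lemma idealD:
  assumes "ideal I"
  shows ideal_closed: "closed I" and ideal_zero: "0 \<in> I"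
    and ideal_add: "\<And>x y. x \<in> I \<Longrightarrow> y \<in> I \<Longrightarrow> x + y \<in> I"
    and ideal_scaleC: "\<And>c x. x \<in> I \<Longrightarrow> c *\<^sub>C x \<in> I"
    and ideal_mult_left: "\<And>a x. x \<in> I \<Longrightarrow> a * x \<in> I"
    and ideal_mult_right: "\<And>a x. x \<in> I \<Longrightarrow> x * a \<in> I"
  using assms by (auto simp: ideal_def)

lemma ideal_scaleR: "ideal I \<Longrightarrow> x \<in> I \<Longrightarrow> r *\<^sub>R x \<in> I"
  by (simp add: scaleR_scaleC ideal_scaleC)

lemma ideal_sum: "ideal I \<Longrightarrow> (\<And>j. j \<in> J \<Longrightarrow> f j \<in> I) \<Longrightarrow> (\<Sum>j\<in>J. f j) \<in> I"
  by (induction J rule: infinite_finite_induct) (auto intro: ideal_add ideal_zero)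

lemma ideal_tendsto: "ideal I \<Longrightarrow> (\<And>n. f n \<in> I) \<Longrightarrow> f \<longlonglongrightarrow> l \<Longrightarrow> l \<in> I"
  using closed_sequentially[OF ideal_closed] by blast

lemma ideal_ideal_hull: "ideal (ideal hull S)"
proof (rule hull_in)
  fix F :: "'a set set"
  assume "\<forall>s\<in>F. ideal s"
  then show "ideal (\<Inter>F)" unfolding ideal_def by (intro conjI closed_Inter) auto
qed

lemma ideal_hull_minimal: "S \<subseteq> I \<Longrightarrow> ideal I \<Longrightarrow> ideal hull S \<subseteq> I"
  by (rule hull_minimal)

lemma ideal_hull_self: "a \<in> ideal hull {a}"
  by (rule hull_inc) simp

text \<open>Heredity of closed ideals. After scaling to \<open>norm k' = 1\<close>, the elements
  \<open>x' (1 - k'\<^sup>2)\<^sup>n\<close> tend to \<open>0\<close>, while their differences from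
  \<open>x'\<close> lie in the ideal generated by \<open>k\<close>.\<close>

lemma mem_ideal_hull_if_le:
  fixes k x :: "'a::cstar_algebra"
  assumes k: "cstar_positive k" and x: "cstar_positive (k - star x * x)"
  shows "x \<in> ideal hull {k}"
proof (cases "k = 0")
  case True
  then have "norm (star x * x) = 0"
    using cstar_positive_norm_mono[OF cstar_positive_star_mult x] by simp
  then have "x = 0" by (simp add: cstar_identity)
  then show ?thesis by (simp add: ideal_zero ideal_ideal_hull)
next
  case False
  define c where "c = norm k"
  have c: "c > 0" using False by (simp add: c_def)
  \<comment> \<open>The square root in the scaling of \<open>x\<close> preserves the inequality:
    \<open>star x' * x' \<le> k'\<close>.\<close>
  define k' x' where "k' = (1/c) *\<^sub>R k" and "x' = (1 / sqrt c) *\<^sub>R x"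
  \<comment> \<open>The recursion forms \<open>x' (1 - k'\<^sup>2)\<^sup>n\<close> inside the
    algebra, which may lack a unit; \<open>emb\<close> identifies it in the unitization.\<close>
  define z where "z = rec_nat x' (\<lambda>_ w. w - w * (k' * k'))"
  have z0: "z 0 = x'" and zS: "z (Suc n) = z n - z n * (k' * k')" for n
    by (auto simp: z_def)
  have emb: "embed (z n) = embed x' * (1 - embed k' * embed k') ^ n" for n
  proof (induction n)
    case (Suc n)
    then show ?case
      by (simp add: zS embed_simps power_commutes[symmetric] right_diff_distrib mult.assoc[symmetric])
  qed (simp add: z0)
  have "k' - star x' * x' = (1/c) *\<^sub>R (k - star x * x)"
    using c by (simp add: k'_def x'_def star_scaleR scaleR_diff_right)
  then have "cstar_positive (k' - star x' * x')"
    using cstar_positive_scaleR[OF x, of "1/c"] c by simp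
  then have "(\<lambda>n. embed x' * (1 - embed k' * embed k') ^ n) \<longlonglongrightarrow> 0"
    using cstar_positive_scaleR[OF k, of "1/c"] c
    by (intro mult_one_minus_power_tendsto_zero)
      (simp_all add: cstar_positive_iff_upos k'_def c_def embed_simps star_embed)
  then have "(\<lambda>n. norm (embed (z n))) \<longlonglongrightarrow> 0" unfolding emb by (rule tendsto_norm_zero)
  then have "z \<longlonglongrightarrow> 0" by (simp add: tendsto_norm_zero_cancel)
  then have "(\<lambda>n. x' - z n) \<longlonglongrightarrow> x' - 0" by (intro tendsto_intros)
  moreover have "x' - z n \<in> ideal hull {k}" for n
  proof (induction n)
    case (Suc n)
    have "z n * (k' * k') \<in> ideal hull {k}"
      unfolding k'_def by (intro ideal_mult_left ideal_scaleR ideal_ideal_hull ideal_hull_self)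
    from ideal_add[OF ideal_ideal_hull Suc this] show ?case by (simp add: zS algebra_simps)
  qed (simp add: z0 ideal_zero ideal_ideal_hull)
  ultimately have "x' \<in> ideal hull {k}" using ideal_tendsto[OF ideal_ideal_hull] by fastforce
  then have "sqrt c *\<^sub>R x' \<in> ideal hull {k}" by (rule ideal_scaleR[OF ideal_ideal_hull])
  then show ?thesis using c by (simp add: x'_def)
qed

lemma mem_ideal_hull_star_mult_self: "x \<in> ideal hull {star x * x}"
  by (rule mem_ideal_hull_if_le) simp_all

section \<open>Cuntz comparison\<close>

lemma vec_norm_le_sum: "vec_norm n w \<le> (\<Sum>i<n. norm (w i))"
proof -
  have "norm (\<Sum>i<n. star (w i) * w i) \<le> (\<Sum>i<n. (norm (w i))\<^sup>2)"
    using norm_sum[of "\<lambda>i. star (w i) * w i" "{..<n}"] by (simp add: cstar_identity)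
  then have "vec_norm n w \<le> L2_set (\<lambda>i. norm (w i)) {..<n}"
    unfolding vec_norm_def L2_set_def by (rule real_sqrt_le_mono)
  also have "\<dots> \<le> (\<Sum>i<n. norm (w i))" by (rule L2_set_le_sum) simp
  finally show ?thesis .
qed

lemma norm_le_vec_norm: "i < n \<Longrightarrow> norm (w i) \<le> vec_norm n w"
  unfolding vec_norm_def by (intro real_le_rsqrt norm_square_le_norm_sum) auto

lemma vec_norm_mult_le:
  assumes "vec_norm n v \<le> 1"
  shows "vec_norm n (\<lambda>i. \<Sum>j<n. x i j * v j) \<le> (\<Sum>i<n. \<Sum>j<n. norm (x i j))"
proof -
  have "norm (\<Sum>j<n. x i j * v j) \<le> (\<Sum>j<n. norm (x i j))" for i
  proof (rule sum_norm_le)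
    fix j assume "j \<in> {..<n}"
    then have "norm (v j) \<le> 1" using norm_le_vec_norm[of j n v] assms by simp
    then have "norm (x i j) * norm (v j) \<le> norm (x i j)" by (simp add: mult_left_le)
    then show "norm (x i j * v j) \<le> norm (x i j)" using norm_mult_ineq order_trans by blast
  qed
  then show ?thesis by (intro order_trans[OF vec_norm_le_sum] sum_mono)
qed

lemma mat_norm_le_sum: "mat_norm n x \<le> (\<Sum>i<n. \<Sum>j<n. norm (x i j))"
  unfolding mat_norm_def
proof (rule cSup_least)
  have "vec_norm n (\<lambda>_. 0::'a) \<le> 1" by (simp add: vec_norm_def)
  then show "{vec_norm n (\<lambda>i. \<Sum>j<n. x i j * v j) |v. vec_norm n v \<le> 1} \<noteq> {}" by blast
qed (use vec_norm_mult_le in blast)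

lemma norm_entry_le_mat_norm:
  assumes "i < n" "j < n"
  shows "norm (x i j) \<le> mat_norm n x"
proof (cases "x i j = 0")
  case True
  have bdd: "bdd_above {vec_norm n (\<lambda>i. \<Sum>j<n. x i j * v j) |v. vec_norm n v \<le> 1}"
    using vec_norm_mult_le by (auto simp: bdd_above_def)
  have "0 \<le> mat_norm n x"
    unfolding mat_norm_def
    by (rule cSup_upper2[OF _ _ bdd, of "vec_norm n (\<lambda>i. \<Sum>j<n. x i j * (\<lambda>_. 0) j)"])
      (auto simp: vec_norm_def intro!: exI[of _ "\<lambda>_. 0::'a"])
  then show ?thesis using True by simp
next
  case False
  have bdd: "bdd_above {vec_norm n (\<lambda>i. \<Sum>j<n. x i j * v j) |v. vec_norm n v \<le> 1}"
    using vec_norm_mult_le by (auto simp: bdd_above_def)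
  \<comment> \<open>The normalized vector with entry \<open>star (x i j)\<close> at position
    \<open>j\<close> makes the \<open>i\<close>-th entry of its image attain
    \<open>norm (x i j)\<close>.\<close>
  define c where "c = inverse (norm (x i j))"
  define v where "v l = (if l = j then c *\<^sub>R star (x i j) else 0)" for l
  have "(\<Sum>l<n. star (v l) * v l) = star (v j) * v j"
    using assms(2) by (subst sum.remove[of _ j]) (auto simp: v_def intro!: sum.neutral)
  then have "vec_norm n v = norm (v j)" by (simp add: vec_norm_def cstar_identity)
  then have v1: "vec_norm n v \<le> 1" using False by (simp add: v_def c_def)
  have "(\<Sum>l<n. x i l * v l) = x i j * v j"
    using assms(2) by (subst sum.remove[of _ j]) (auto simp: v_def intro!: sum.neutral)
  then have "norm (x i j) = norm (\<Sum>l<n. x i l * v l)"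
    using False by (simp add: v_def c_def cstar_identity' power2_eq_square)
  also have "\<dots> \<le> vec_norm n (\<lambda>i. \<Sum>j<n. x i j * v j)"
    using norm_le_vec_norm[OF assms(1), of "\<lambda>i. \<Sum>j<n. x i j * v j"] by simp
  also have "\<dots> \<le> mat_norm n x"
    unfolding mat_norm_def by (rule cSup_upper[OF _ bdd]) (use v1 in blast)
  finally show ?thesis .
qed

text \<open>The operator norm lies between each single entry norm and the sum of all of them. This
  reduces Cuntz comparison to entrywise limits.\<close>

lemma mat_norm_tendsto_zero_iff:
  "(\<lambda>k. mat_norm n (z k)) \<longlonglongrightarrow> 0 \<longleftrightarrow> (\<forall>i<n. \<forall>j<n. (\<lambda>k. z k i j) \<longlonglongrightarrow> 0)"
proof (intro iffI allI impI)
  fix i j assume lim: "(\<lambda>k. mat_norm n (z k)) \<longlonglongrightarrow> 0" and ij: "i < n" "j < n"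
  show "(\<lambda>k. z k i j) \<longlonglongrightarrow> 0"
    by (rule Lim_null_comparison[OF _ lim]) (simp add: norm_entry_le_mat_norm ij)
next
  assume *: "\<forall>i<n. \<forall>j<n. (\<lambda>k. z k i j) \<longlonglongrightarrow> 0"
  show "(\<lambda>k. mat_norm n (z k)) \<longlonglongrightarrow> 0"
  proof (rule Lim_null_comparison)
    have "0 \<le> mat_norm n (z k)" for k
    proof (cases "n = 0")
      case True
      then show ?thesis by (simp add: mat_norm_def vec_norm_def)
    next
      case False
      then show ?thesis using norm_entry_le_mat_norm[of 0 n 0 "z k"] norm_ge_zero order_trans by blast
    qed
    then show "\<forall>\<^sub>F k in sequentially. norm (mat_norm n (z k)) \<le> (\<Sum>i<n. \<Sum>j<n. norm (z k i j))"
      by (simp add: mat_norm_le_sum)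
    show "(\<lambda>k. \<Sum>i<n. \<Sum>j<n. norm (z k i j)) \<longlonglongrightarrow> 0"
      using * by (intro tendsto_null_sum tendsto_norm_zero) auto
  qed
qed

section \<open>Conjugation of matrices and the comparison relation\<close>

definition mat_conj :: "nat \<Rightarrow> 'a::cstar_algebra infmat \<Rightarrow> 'a infmat \<Rightarrow> 'a infmat" where
  "mat_conj n x b = mat_mult n (mat_mult n x b) (mat_star x)"

lemma MatI: "(\<And>i j. n \<le> i \<or> n \<le> j \<Longrightarrow> x i j = 0) \<Longrightarrow> x \<in> Mat n"
  by (auto simp: Mat_def)

lemma MatD: "x \<in> Mat n \<Longrightarrow> n \<le> i \<or> n \<le> j \<Longrightarrow> x i j = 0"
  by (auto simp: Mat_def)

lemma Mat_mono: "x \<in> Mat m \<Longrightarrow> m \<le> n \<Longrightarrow> x \<in> Mat n"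
  by (auto simp: Mat_def)

lemma mat_mult_Mat: "x \<in> Mat n \<Longrightarrow> y \<in> Mat n \<Longrightarrow> mat_mult m x y \<in> Mat n"
  by (auto intro!: MatI sum.neutral simp: mat_mult_def MatD)

lemma mat_star_Mat: "x \<in> Mat n \<Longrightarrow> mat_star x \<in> Mat n"
  by (auto intro!: MatI simp: mat_star_def MatD)

lemma mat_conj_Mat: "x \<in> Mat n \<Longrightarrow> b \<in> Mat n \<Longrightarrow> mat_conj m x b \<in> Mat n"
  by (simp add: mat_conj_def mat_mult_Mat mat_star_Mat)

lemma mat_conj_entry:
  "mat_conj n x b i j = (\<Sum>q<n. \<Sum>p<n. x i p * b p q * star (x j q))"
  by (simp add: mat_conj_def mat_mult_def mat_star_def sum_distrib_right)

text \<open>Only the support of \<open>b\<close> contributes, so an entry does not depend on the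
  ambient size \<open>n\<close>; \<open>Cuntz_subE\<close> changes the matrix size by this.\<close>

lemma mat_conj_entry_Mat:
  assumes "b \<in> Mat m" "m \<le> n"
  shows "mat_conj n x b i j = (\<Sum>q<m. \<Sum>p<m. x i p * b p q * star (x j q))"
proof -
  have "(\<Sum>p<n. x i p * b p q * star (x j q)) = (\<Sum>p<m. x i p * b p q * star (x j q))" for q
    by (rule sum.mono_neutral_right) (use assms in \<open>auto simp: MatD\<close>)
  then have "mat_conj n x b i j = (\<Sum>q<n. \<Sum>p<m. x i p * b p q * star (x j q))"
    by (simp add: mat_conj_entry)
  also have "\<dots> = (\<Sum>q<m. \<Sum>p<m. x i p * b p q * star (x j q))"
    by (rule sum.mono_neutral_right) (use assms in \<open>auto intro!: sum.neutral simp: MatD\<close>)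
  finally show ?thesis .
qed

lemma mat_mult_assoc: "mat_mult n (mat_mult n x y) z = mat_mult n x (mat_mult n y z)"
proof (intro ext)
  fix i j
  have "(\<Sum>k<n. (\<Sum>l<n. x i l * y l k) * z k j) = (\<Sum>k<n. \<Sum>l<n. x i l * (y l k * z k j))"
    by (simp add: sum_distrib_right mult.assoc)
  also have "\<dots> = (\<Sum>l<n. \<Sum>k<n. x i l * (y l k * z k j))" by (rule sum.swap)
  finally show "mat_mult n (mat_mult n x y) z i j = mat_mult n x (mat_mult n y z) i j"
    by (simp add: mat_mult_def sum_distrib_left)
qed

lemma mat_star_mult: "mat_star (mat_mult n x y) = mat_mult n (mat_star y) (mat_star x)"
  by (simp add: mat_star_def mat_mult_def star_sum star_mult)

lemma mat_conj_mat_conj: "mat_conj n x (mat_conj n y c) = mat_conj n (mat_mult n x y) c"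
  by (simp add: mat_conj_def mat_star_mult mat_mult_assoc)

lemma Cuntz_subI:
  assumes "a \<in> Mat n" "b \<in> Mat n" "\<And>k. x k \<in> Mat n"
    and "\<And>i j. i < n \<Longrightarrow> j < n \<Longrightarrow> (\<lambda>k. mat_conj n (x k) b i j) \<longlonglongrightarrow> a i j"
  shows "a \<precsim> b"
proof -
  have "(\<lambda>k. mat_norm n (mat_conj n (x k) b - a)) \<longlonglongrightarrow> 0"
    unfolding mat_norm_tendsto_zero_iff using assms(4) by (auto intro: LIM_zero)
  then show ?thesis unfolding Cuntz_sub_def mat_conj_def[symmetric] using assms(1-3) by blast
qed

text \<open>The definition of comparison supplies some matrix size; here the witnesses are cut to
  any size that contains \<open>a\<close> and \<open>b\<close>. The discarded entries meet only
  zeros of \<open>b\<close> or belong to rows in which \<open>a\<close> vanishes.\<close>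

lemma Cuntz_subE:
  assumes ab: "a \<precsim> b" and a: "a \<in> Mat n" and b: "b \<in> Mat n"
  obtains x where "\<And>k. x k \<in> Mat n" "\<And>i j. (\<lambda>k. mat_conj n (x k) b i j) \<longlonglongrightarrow> a i j"
proof -
  obtain m x where m: "a \<in> Mat m" "b \<in> Mat m" and x: "\<And>k. x k \<in> Mat m"
    and lim: "(\<lambda>k. mat_norm m (mat_conj m (x k) b - a)) \<longlonglongrightarrow> 0"
    using ab unfolding Cuntz_sub_def mat_conj_def[symmetric] by blast
  define l where "l = min m n"
  have bl: "b \<in> Mat l" using b m by (auto simp: l_def min_def)
  have lim': "(\<lambda>k. mat_conj m (x k) b i j) \<longlonglongrightarrow> a i j" for i j
  proof (cases "i < m \<and> j < m")
    case True
    then show ?thesis using lim unfolding mat_norm_tendsto_zero_iff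
      by (auto intro: LIM_zero_cancel)
  next
    case False
    then have "m \<le> i \<or> m \<le> j" by linarith
    then show ?thesis using MatD[OF mat_conj_Mat[OF x m(2)]] MatD[OF m(1)] by simp
  qed
  define y where "y k i j = (if i < n \<and> j < n then x k i j else 0)" for k i j
  have y: "y k \<in> Mat n" for k by (rule MatI) (auto simp: y_def)
  have "(\<lambda>k. mat_conj n (y k) b i j) \<longlonglongrightarrow> a i j" for i j
  proof (cases "i < n \<and> j < n")
    case True
    have "mat_conj n (y k) b i j = mat_conj m (x k) b i j" for k
      using True by (simp add: mat_conj_entry_Mat[OF bl] l_def y_def)
    then show ?thesis using lim' by simp
  next
    case False
    then have "n \<le> i \<or> n \<le> j" by linarith
    then show ?thesis using MatD[OF mat_conj_Mat[OF y b]] MatD[OF a] by simp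
  qed
  then show ?thesis using that y by blast
qed

text \<open>A diagonal choice: for each \<open>k\<close>, one conjugate of \<open>b\<close> that
  approximates all of the finitely many entries of \<open>f k\<close> up to
  \<open>1 / (k + 1)\<close>.\<close>

lemma Cuntz_sub_limit:
  assumes sub: "\<And>k. f k \<precsim> b" and f: "\<And>k. f k \<in> Mat n" and a: "a \<in> Mat n" and b: "b \<in> Mat n"
    and lim: "\<And>i j. (\<lambda>k. f k i j) \<longlonglongrightarrow> a i j"
  shows "a \<precsim> b"
proof -
  have "\<exists>x\<in>Mat n. \<forall>i<n. \<forall>j<n. norm (mat_conj n x b i j - f k i j) \<le> inverse (real (Suc k))" for k
  proof -
    obtain x where x: "\<And>l. x l \<in> Mat n" "\<And>i j. (\<lambda>l. mat_conj n (x l) b i j) \<longlonglongrightarrow> f k i j"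
      using Cuntz_subE[OF sub f b] by blast
    have "\<forall>\<^sub>F l in sequentially. dist (mat_conj n (x l) b i j) (f k i j) < inverse (real (Suc k))" for i j
      by (rule tendstoD[OF x(2)]) simp
    then have "\<forall>\<^sub>F l in sequentially. \<forall>i\<in>{..<n}. \<forall>j\<in>{..<n}.
        dist (mat_conj n (x l) b i j) (f k i j) < inverse (real (Suc k))"
      by (intro eventually_ball_finite ballI) auto
    then obtain l where "\<forall>i\<in>{..<n}. \<forall>j\<in>{..<n}.
        dist (mat_conj n (x l) b i j) (f k i j) < inverse (real (Suc k))"
      using eventually_happens trivial_limit_sequentially by blast
    then show ?thesis using x(1) by (intro bexI[of _ "x l"]) (auto simp: dist_norm less_imp_le)
  qed
  then obtain x where x: "\<And>k. x k \<in> Mat n"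
    "\<And>k i j. i < n \<Longrightarrow> j < n \<Longrightarrow> norm (mat_conj n (x k) b i j - f k i j) \<le> inverse (real (Suc k))"
    by metis
  show ?thesis
  proof (rule Cuntz_subI[OF a b x(1)])
    fix i j assume ij: "i < n" "j < n"
    have "(\<lambda>k. mat_conj n (x k) b i j - f k i j) \<longlonglongrightarrow> 0"
      by (rule Lim_null_comparison[OF _ LIMSEQ_inverse_real_of_nat]) (use x(2) ij in auto)
    from tendsto_add[OF this lim[of i j]] show "(\<lambda>k. mat_conj n (x k) b i j) \<longlonglongrightarrow> a i j" by simp
  qed
qed

lemma Cuntz_sub_mat_conj:
  assumes "b \<precsim> c" and b: "b \<in> Mat n" and c: "c \<in> Mat n" and x: "x \<in> Mat n"
  shows "mat_conj n x b \<precsim> c"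
proof -
  obtain y where y: "\<And>k. y k \<in> Mat n" "\<And>i j. (\<lambda>k. mat_conj n (y k) c i j) \<longlonglongrightarrow> b i j"
    using Cuntz_subE[OF assms(1-3)] by blast
  show ?thesis
  proof (rule Cuntz_subI[where x = "\<lambda>k. mat_mult n x (y k)"])
    fix i j
    have "(\<lambda>k. mat_conj n x (mat_conj n (y k) c) i j) \<longlonglongrightarrow> mat_conj n x b i j"
      unfolding mat_conj_entry[of n x] by (intro tendsto_intros y)
    then show "(\<lambda>k. mat_conj n (mat_mult n x (y k)) c i j) \<longlonglongrightarrow> mat_conj n x b i j"
      by (simp add: mat_conj_mat_conj)
  qed (simp_all add: assms mat_conj_Mat mat_mult_Mat y)
qed

text \<open>\<open>a\<close> is a limit of conjugates of \<open>b\<close>, and each of these is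
  below \<open>c\<close>.\<close>

lemma Cuntz_sub_trans:
  assumes ab: "a \<precsim> b" and bc: "b \<precsim> c"
  shows "a \<precsim> c"
proof -
  obtain m m' where m: "a \<in> Mat m" "b \<in> Mat m" "b \<in> Mat m'" "c \<in> Mat m'"
    using ab bc unfolding Cuntz_sub_def by blast
  define n where "n = max m m'"
  have n: "a \<in> Mat n" "b \<in> Mat n" "c \<in> Mat n"
    using m Mat_mono unfolding n_def by (blast intro: max.cobounded1 max.cobounded2)+
  obtain x where x: "\<And>k. x k \<in> Mat n" "\<And>i j. (\<lambda>k. mat_conj n (x k) b i j) \<longlonglongrightarrow> a i j"
    using Cuntz_subE[OF ab n(1,2)] by blast
  show ?thesis
    by (rule Cuntz_sub_limit[OF Cuntz_sub_mat_conj[OF bc n(2,3) x(1)] mat_conj_Mat[OF x(1) n(2)] n(1,3) x(2)])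
qed

text \<open>The converse of what pure infiniteness asserts, valid in every C*-algebra: the entries
  of \<open>x b x\<^sup>*\<close> are sums of products with a factor in \<open>I\<close>, and
  \<open>I\<close> is closed.\<close>

lemma Cuntz_sub_entries_in_ideal:
  assumes "a \<precsim> b" and I: "ideal I" "\<And>i j. b i j \<in> I"
  shows "a i j \<in> I"
proof -
  obtain n where n: "a \<in> Mat n" "b \<in> Mat n" using assms(1) unfolding Cuntz_sub_def by blast
  obtain x where x: "\<And>k. x k \<in> Mat n" "\<And>i j. (\<lambda>k. mat_conj n (x k) b i j) \<longlonglongrightarrow> a i j"
    using Cuntz_subE[OF assms(1) n] by blast
  have "mat_conj n (x k) b i j \<in> I" for k
    unfolding mat_conj_entry by (intro ideal_sum ideal_mult_left ideal_mult_right I)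
  then show ?thesis using ideal_tendsto[OF I(1) _ x(2)] by blast
qed

section \<open>Corners and their classes in the Cuntz semigroup\<close>

lemma corner_Mat: "corner a \<in> Mat (Suc n)"
  by (auto intro: MatI simp: corner_def)

lemma corner_sub_corner_imp_mem_ideal_hull:
  assumes "corner a \<precsim> corner b"
  shows "a \<in> ideal hull {b}"
  using Cuntz_sub_entries_in_ideal[OF assms ideal_ideal_hull, of "{b}" 0 0]
  by (simp add: corner_def ideal_hull_self ideal_zero ideal_ideal_hull split: if_splits)

lemma corner_Cuntz_sub_limit:
  assumes "\<And>k. corner (f k) \<precsim> b" and "f \<longlonglongrightarrow> a"
  shows "corner a \<precsim> b"
proof -
  obtain m where "b \<in> Mat m" using assms(1)[of 0] unfolding Cuntz_sub_def by blast
  \<comment> \<open>A corner needs size at least \<open>1\<close>, hence the successor.\<close>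
  then have "b \<in> Mat (Suc m)" using Mat_mono by fastforce
  then show ?thesis
    by (rule Cuntz_sub_limit[where f = "\<lambda>k. corner (f k)", OF assms(1) corner_Mat corner_Mat])
      (simp add: corner_def assms(2))
qed

lemma corner_Mat_inf_pos:
  assumes "cstar_positive a"
  shows "corner a \<in> Mat_inf_pos"
proof -
  obtain y where "a = star y * y" using assms by (auto simp: cstar_positive_def)
  then have "corner a = mat_mult 1 (mat_star (corner y)) (corner y)"
    by (auto simp: fun_eq_iff corner_def mat_mult_def mat_star_def)
  then show ?thesis using corner_Mat[of y 0] unfolding Mat_inf_pos_def by auto
qed

text \<open>Reflexivity of comparison enters as a hypothesis; for positive elements of a purely
  infinite algebra it is \<open>purely_infinite_Cuntz_refl\<close>.\<close>

lemma corner_mem_Cuntz_class: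
  "cstar_positive a \<Longrightarrow> corner a \<precsim> corner a \<Longrightarrow> corner a \<in> Cuntz_class a"
  by (simp add: Cuntz_class_def Cuntz_rel_def corner_Mat_inf_pos)

lemma Cuntz_class_mem_Cuntz_W: "cstar_positive a \<Longrightarrow> Cuntz_class a \<in> Cuntz_W"
  by (simp add: Cuntz_class_def Cuntz_W_def quotientI corner_Mat_inf_pos)

lemma Cuntz_W_Cuntz_sub:
  assumes "u \<in> Cuntz_W" "c \<in> u" "d \<in> u"
  shows "c \<precsim> d"
proof -
  obtain b where "u = Cuntz_rel `` {b}" using assms(1) unfolding Cuntz_W_def by (rule quotientE)
  then show ?thesis using assms by (auto simp: Cuntz_rel_def intro: Cuntz_sub_trans)
qed

lemma Cuntz_le_Cuntz_classD:
  assumes "Cuntz_le (Cuntz_class a) u"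
  obtains c where "c \<in> u" "corner a \<precsim> c"
  using assms unfolding Cuntz_le_def Cuntz_class_def Cuntz_rel_def
  by (auto intro: Cuntz_sub_trans)

lemma Cuntz_le_Cuntz_classI:
  assumes "cstar_positive a" "corner a \<precsim> corner a" "c \<in> u" "corner a \<precsim> c"
  shows "Cuntz_le (Cuntz_class a) u"
  using corner_mem_Cuntz_class[OF assms(1,2)] assms(3,4) by (auto simp: Cuntz_le_def)

lemma Cuntz_le_Cuntz_class_iff:
  assumes "cstar_positive a" "corner a \<precsim> corner a" "cstar_positive b" "corner b \<precsim> corner b"
  shows "Cuntz_le (Cuntz_class a) (Cuntz_class b) \<longleftrightarrow> corner a \<precsim> corner b"
proof
  assume "Cuntz_le (Cuntz_class a) (Cuntz_class b)"
  then obtain c where "c \<in> Cuntz_class b" "corner a \<precsim> c" by (rule Cuntz_le_Cuntz_classD)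
  then show "corner a \<precsim> corner b"
    by (auto simp: Cuntz_class_def Cuntz_rel_def intro: Cuntz_sub_trans)
qed (use assms corner_mem_Cuntz_class in \<open>auto intro: Cuntz_le_Cuntz_classI\<close>)

section \<open>Operators on the sequence space\<close>

lemma vector_space_scaleC: "vector_space (scaleC :: complex \<Rightarrow> 'a \<Rightarrow> 'a::complex_vector)"
  by unfold_locales (auto simp: scaleC_add_right scaleC_add_left scaleC_scaleC)

lemma clinear_iff:
  "clinear f \<longleftrightarrow> (\<forall>x y. f (x + y) = f x + f y) \<and> (\<forall>c x. f (c *\<^sub>C x) = c *\<^sub>C f x)"
  by (simp add: Vector_Spaces.linear_iff vector_space_scaleC)

lemma clinear_zero: "clinear f \<Longrightarrow> f 0 = 0"
  and clinear_minus: "clinear f \<Longrightarrow> f (- x) = - f x"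
  and clinear_diff: "clinear f \<Longrightarrow> f (x - y) = f x - f y"
  and clinear_scaleR: "clinear f \<Longrightarrow> f (r *\<^sub>R x) = r *\<^sub>R f x"
proof -
  assume f: "clinear f"
  then have add: "f (x + y) = f x + f y" and sc: "f (c *\<^sub>C x) = c *\<^sub>C f x" for x y c
    by (simp_all add: clinear_iff)
  show "f (r *\<^sub>R x) = r *\<^sub>R f x" for r x by (simp add: scaleR_scaleC sc)
  show 0: "f 0 = 0" using sc[of 0 0] by simp
  have "f x + f (- x) = 0" for x using add[of x "- x"] 0 by simp
  then show m: "f (- x) = - f x" for x by (simp add: eq_neg_iff_add_eq_0 add.commute)
  show "f (x - y) = f x - f y" for x y using add[of x "- y"] m by simp
qed

lemma clinear_sum: "clinear f \<Longrightarrow> f (\<Sum>i\<in>I. c i *\<^sub>C g i) = (\<Sum>i\<in>I. c i *\<^sub>C f (g i))"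
  by (induction I rule: infinite_finite_induct) (auto simp: clinear_zero clinear_iff)

section \<open>Inner product and completeness of \<open>ell2\<close>\<close>

lemmas ell2_coord_simps =
  zero_ell2.rep_eq plus_ell2.rep_eq minus_ell2.rep_eq uminus_ell2.rep_eq scaleC_ell2.rep_eq

lemma ell2_eqI: "(\<And>n. ell2_coord x n = ell2_coord y n) \<Longrightarrow> x = y"
  by (metis ell2_coord_inject ext)

lemma summable_ell2_coord: "summable (\<lambda>n. (cmod (ell2_coord x n))\<^sup>2)"
  using ell2_coord[of x] by simp

lemma Abs_ell2_coord: "summable (\<lambda>n. (cmod (f n))\<^sup>2) \<Longrightarrow> ell2_coord (Abs_ell2 f) = f"
  by (simp add: Abs_ell2_inverse)

lemma norm_ell2_square: "(norm x)\<^sup>2 = (\<Sum>n. (cmod (ell2_coord x n))\<^sup>2)"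
  by (simp add: norm_ell2.rep_eq suminf_nonneg summable_ell2_coord)

lemma L2_set_ell2_coord_le: "L2_set (\<lambda>i. cmod (ell2_coord x i)) {..<n} \<le> norm x"
  unfolding L2_set_def norm_ell2.rep_eq
  by (intro real_sqrt_le_mono sum_le_suminf summable_ell2_coord) auto

lemma cmod_ell2_coord_le: "cmod (ell2_coord x n) \<le> norm x"
  by (rule order_trans[OF member_le_L2_set L2_set_ell2_coord_le[of x "Suc n"]]) auto

lemma summable_cmod_ell2_inner: "summable (\<lambda>n. cmod (ell2_coord x n * cnj (ell2_coord y n)))"
proof (rule summable_comparison_test')
  show "summable (\<lambda>n. (cmod (ell2_coord x n))\<^sup>2 + (cmod (ell2_coord y n))\<^sup>2)"
    by (intro summable_add summable_ell2_coord)
  fix n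
  have "2 * (cmod (ell2_coord x n) * cmod (ell2_coord y n)) \<le> (cmod (ell2_coord x n))\<^sup>2 + (cmod (ell2_coord y n))\<^sup>2"
    using sum_squares_bound[of "cmod (ell2_coord x n)" "cmod (ell2_coord y n)"] by simp
  then show "norm (cmod (ell2_coord x n * cnj (ell2_coord y n))) \<le> (cmod (ell2_coord x n))\<^sup>2 + (cmod (ell2_coord y n))\<^sup>2"
    using mult_nonneg_nonneg[of "cmod (ell2_coord x n)" "cmod (ell2_coord y n)"]
    by (simp add: norm_mult del: mult_nonneg_nonneg)
qed

lemma summable_ell2_inner: "summable (\<lambda>n. ell2_coord x n * cnj (ell2_coord y n))"
  by (rule summable_norm_cancel) (rule summable_cmod_ell2_inner)

lemma ell2_inner_sums: "(\<lambda>n. ell2_coord x n * cnj (ell2_coord y n)) sums ell2_inner x y"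
  unfolding ell2_inner.rep_eq by (rule summable_sums[OF summable_ell2_inner])

lemma ell2_inner_add_left: "ell2_inner (x + y) z = ell2_inner x z + ell2_inner y z"
  using sums_add[OF ell2_inner_sums[of x z] ell2_inner_sums[of y z]] ell2_inner_sums[of "x + y" z]
  by (simp add: ell2_coord_simps distrib_right sums_unique2)

lemma ell2_inner_scaleC_left: "ell2_inner (c *\<^sub>C x) z = c * ell2_inner x z"
  using sums_mult[OF ell2_inner_sums[of x z], of c] ell2_inner_sums[of "c *\<^sub>C x" z]
  by (simp add: ell2_coord_simps mult.assoc sums_unique2)

lemma ell2_inner_cnj: "cnj (ell2_inner x y) = ell2_inner y x"
  using sums_cnj[THEN iffD2, OF ell2_inner_sums[of x y]] ell2_inner_sums[of y x]
  by (simp add: mult.commute sums_unique2)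

lemma ell2_inner_diff_left: "ell2_inner (x - y) z = ell2_inner x z - ell2_inner y z"
  using ell2_inner_add_left[of "x - y" y z] by simp

lemma ell2_inner_zero_left [simp]: "ell2_inner 0 z = 0"
  using ell2_inner_diff_left[of 0 0 z] by simp

lemma ell2_inner_sum_left: "ell2_inner (\<Sum>i\<in>I. c i *\<^sub>C g i) z = (\<Sum>i\<in>I. c i * ell2_inner (g i) z)"
  by (induction I rule: infinite_finite_induct) (auto simp: ell2_inner_add_left ell2_inner_scaleC_left)

lemma ell2_inner_self: "ell2_inner x x = of_real ((norm x)\<^sup>2)"
proof -
  have "(\<lambda>n. complex_of_real ((cmod (ell2_coord x n))\<^sup>2)) sums of_real ((norm x)\<^sup>2)"
    unfolding norm_ell2_square by (intro sums_of_real summable_sums summable_ell2_coord)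
  then show ?thesis
    using ell2_inner_sums[of x x] unfolding complex_norm_square by (rule sums_unique2[symmetric])
qed

lemma norm_ell2_inner_le: "cmod (ell2_inner x y) \<le> norm x * norm y"
proof -
  have "cmod (\<Sum>i<n. ell2_coord x i * cnj (ell2_coord y i)) \<le> norm x * norm y" for n
  proof -
    have "cmod (\<Sum>i<n. ell2_coord x i * cnj (ell2_coord y i))
        \<le> (\<Sum>i<n. \<bar>cmod (ell2_coord x i)\<bar> * \<bar>cmod (ell2_coord y i)\<bar>)"
      by (rule order_trans[OF norm_sum]) (simp add: norm_mult)
    also have "\<dots> \<le> L2_set (\<lambda>i. cmod (ell2_coord x i)) {..<n} * L2_set (\<lambda>i. cmod (ell2_coord y i)) {..<n}"
      by (rule L2_set_mult_ineq)
    also have "\<dots> \<le> norm x * norm y"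
      by (intro mult_mono L2_set_ell2_coord_le) (auto simp: L2_set_nonneg)
    finally show ?thesis .
  qed
  then show ?thesis
    by (intro LIMSEQ_le_const2[OF tendsto_norm[OF ell2_inner_sums[unfolded sums_def]]]) auto
qed

text \<open>Completeness is what makes closed totally bounded sets compact in the proof that
  adjoints of compact operators are compact.\<close>

instance ell2 :: banach
proof
  fix X :: "nat \<Rightarrow> ell2"
  assume X: "Cauchy X"
  have "Cauchy (\<lambda>m. ell2_coord (X m) n)" for n
  proof (rule CauchyI)
    fix e :: real assume "e > 0"
    then obtain M where M: "\<And>m k. m \<ge> M \<Longrightarrow> k \<ge> M \<Longrightarrow> norm (X m - X k) < e"
      using CauchyD[OF X] by blast
    show "\<exists>M. \<forall>m\<ge>M. \<forall>k\<ge>M. norm (ell2_coord (X m) n - ell2_coord (X k) n) < e"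
    proof (intro exI[of _ M] allI impI)
      fix m k assume "m \<ge> M" "k \<ge> M"
      then show "norm (ell2_coord (X m) n - ell2_coord (X k) n) < e"
        using cmod_ell2_coord_le[of "X m - X k" n] M[of m k] by (simp add: ell2_coord_simps)
    qed
  qed
  then have "\<forall>n. \<exists>a. (\<lambda>m. ell2_coord (X m) n) \<longlonglongrightarrow> a"
    using Cauchy_convergent convergent_def by blast
  then obtain l where l: "\<And>n. (\<lambda>m. ell2_coord (X m) n) \<longlonglongrightarrow> l n" by metis
  \<comment> \<open>Finite sections of \<open>X m - X k\<close> keep the bound \<open>e\<close> in
    the limit over \<open>k\<close>; only then does their length tend to infinity.\<close>
  have tail: "summable (\<lambda>n. (cmod (ell2_coord (X m) n - l n))\<^sup>2) \<and>
      sqrt (\<Sum>n. (cmod (ell2_coord (X m) n - l n))\<^sup>2) \<le> e"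
    if M: "\<And>m k. m \<ge> M \<Longrightarrow> k \<ge> M \<Longrightarrow> norm (X m - X k) < e" and "m \<ge> M" for m M e
  proof -
    have "L2_set (\<lambda>i. cmod (ell2_coord (X m) i - l i)) {..<n} \<le> e" for n
    proof (rule LIMSEQ_le_const2)
      show "(\<lambda>k. L2_set (\<lambda>i. cmod (ell2_coord (X m) i - ell2_coord (X k) i)) {..<n})
          \<longlonglongrightarrow> L2_set (\<lambda>i. cmod (ell2_coord (X m) i - l i)) {..<n}"
        unfolding L2_set_def by (intro tendsto_intros l)
      show "\<exists>N. \<forall>k\<ge>N. L2_set (\<lambda>i. cmod (ell2_coord (X m) i - ell2_coord (X k) i)) {..<n} \<le> e"
      proof (intro exI[of _ M] allI impI)
        fix k assume "k \<ge> M"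
        then show "L2_set (\<lambda>i. cmod (ell2_coord (X m) i - ell2_coord (X k) i)) {..<n} \<le> e"
          using L2_set_ell2_coord_le[of "X m - X k" n] M[OF \<open>m \<ge> M\<close>, of k]
          by (simp add: ell2_coord_simps)
      qed
    qed
    then have le: "(\<Sum>i<n. (cmod (ell2_coord (X m) i - l i))\<^sup>2) \<le> e\<^sup>2" for n
      unfolding L2_set_def by (rule sqrt_le_D)
    have s: "summable (\<lambda>n. (cmod (ell2_coord (X m) n - l n))\<^sup>2)"
      by (rule summableI_nonneg_bounded[OF _ le]) simp
    have "(\<Sum>n. (cmod (ell2_coord (X m) n - l n))\<^sup>2) \<le> e\<^sup>2"
      by (rule suminf_le_const[OF s le])
    moreover have "e \<ge> 0" using M[OF that(2) that(2)] by simp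
    ultimately show ?thesis using s by (simp add: real_le_lsqrt)
  qed
  obtain M where "\<And>m k. m \<ge> M \<Longrightarrow> k \<ge> M \<Longrightarrow> norm (X m - X k) < 1"
    using CauchyD[OF X, of 1] by auto
  then have "summable (\<lambda>n. (cmod (l n - ell2_coord (X M) n))\<^sup>2)"
    using tail[of M 1 M] by (simp add: norm_minus_commute)
  from summable_ell2_add[OF this summable_ell2_coord[of "X M"]]
  have "summable (\<lambda>n. (cmod (l n))\<^sup>2)" by simp
  then have L: "ell2_coord (Abs_ell2 l) = l" by (rule Abs_ell2_coord)
  have "X \<longlonglongrightarrow> Abs_ell2 l"
  proof (rule LIMSEQ_I)
    fix r :: real assume r: "r > 0"
    then obtain M where M: "\<And>m k. m \<ge> M \<Longrightarrow> k \<ge> M \<Longrightarrow> norm (X m - X k) < r / 2"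
      using CauchyD[OF X, of "r / 2"] by auto
    have "norm (X m - Abs_ell2 l) < r" if "m \<ge> M" for m
      using tail[OF M that] r unfolding norm_ell2.rep_eq by (simp add: ell2_coord_simps L)
    then show "\<exists>no. \<forall>n\<ge>no. norm (X n - Abs_ell2 l) < r" by blast
  qed
  then show "convergent X" by (auto simp: convergent_def)
qed

section \<open>Finite sections and adjoints of bounded operators\<close>

lift_definition ell2_basis :: "nat \<Rightarrow> ell2" is "\<lambda>j n. if n = j then 1 else 0"
  by (rule summable_finite[of "{j}" for j]) auto

lemma ell2_coord_sum_basis:
  "ell2_coord (\<Sum>j<N. c j *\<^sub>C ell2_basis j) n = (if n < N then c n else 0)"
  by (induction N) (auto simp: ell2_coord_simps ell2_basis.rep_eq less_Suc_eq)

lemma norm_sum_basis_square: "(norm (\<Sum>j<N. c j *\<^sub>C ell2_basis j))\<^sup>2 = (\<Sum>j<N. (cmod (c j))\<^sup>2)"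
proof -
  have "(\<lambda>n. (cmod (if n < N then c n else 0))\<^sup>2) = (\<lambda>n. if n \<in> {..<N} then (cmod (c n))\<^sup>2 else 0)"
    by auto
  then show ?thesis
    unfolding norm_ell2_square ell2_coord_sum_basis
    using sums_If_finite_set[of "{..<N}" "\<lambda>n. (cmod (c n))\<^sup>2"] by (simp add: sums_iff)
qed

lemma ell2_basis_expansion: "(\<lambda>N. \<Sum>j<N. ell2_coord x j *\<^sub>C ell2_basis j) \<longlonglongrightarrow> x"
proof -
  let ?g = "\<lambda>n. (cmod (ell2_coord x n))\<^sup>2"
  have "(norm (x - (\<Sum>j<N. ell2_coord x j *\<^sub>C ell2_basis j)))\<^sup>2 = suminf ?g - (\<Sum>j<N. ?g j)" for N
  proof -
    have "(\<lambda>n. ?g n - (if n \<in> {..<N} then ?g n else 0)) sums (suminf ?g - (\<Sum>j<N. ?g j))"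
      by (intro sums_diff summable_sums summable_ell2_coord sums_If_finite_set) simp
    moreover have "(\<lambda>n. ?g n - (if n \<in> {..<N} then ?g n else 0)) =
        (\<lambda>n. (cmod (ell2_coord (x - (\<Sum>j<N. ell2_coord x j *\<^sub>C ell2_basis j)) n))\<^sup>2)"
      by (auto simp: ell2_coord_simps ell2_coord_sum_basis)
    ultimately show ?thesis unfolding norm_ell2_square by (simp add: sums_iff)
  qed
  moreover have "(\<lambda>N. suminf ?g - (\<Sum>j<N. ?g j)) \<longlonglongrightarrow> suminf ?g - suminf ?g"
    by (intro tendsto_diff tendsto_const summable_LIMSEQ summable_ell2_coord)
  ultimately have "(\<lambda>N. (norm (x - (\<Sum>j<N. ell2_coord x j *\<^sub>C ell2_basis j)))\<^sup>2) \<longlonglongrightarrow> 0" by simp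
  then have "(\<lambda>N. sqrt ((norm (x - (\<Sum>j<N. ell2_coord x j *\<^sub>C ell2_basis j)))\<^sup>2)) \<longlonglongrightarrow> sqrt 0"
    by (rule tendsto_real_sqrt)
  then have "(\<lambda>N. x - (\<Sum>j<N. ell2_coord x j *\<^sub>C ell2_basis j)) \<longlonglongrightarrow> 0"
    by (simp add: tendsto_norm_zero_cancel)
  then have "(\<lambda>N. x - (x - (\<Sum>j<N. ell2_coord x j *\<^sub>C ell2_basis j))) \<longlonglongrightarrow> x - 0"
    by (intro tendsto_intros)
  then show ?thesis by simp
qed

lemma clinear_continuous_on:
  fixes S :: "ell2 \<Rightarrow> ell2"
  assumes "clinear S" "\<And>x. norm (S x) \<le> B * norm x"
  shows "continuous_on A S"
proof (rule linear_continuous_on)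
  show "bounded_linear S"
    by (rule bounded_linear_intro[where K = B])
      (use assms in \<open>auto simp: clinear_iff clinear_scaleR mult.commute\<close>)
qed

text \<open>The coordinates of \<open>S' y\<close> can only be the inner products of
  \<open>y\<close> with \<open>S (ell2_basis j)\<close>. Testing on their own finite section
  \<open>z\<close> shows that they are square summable: \<open>(norm z)\<^sup>2\<close> equals
  \<open>ell2_inner (S z) y\<close> and so is at most \<open>B * norm z * norm y\<close>.\<close>

lemma ell2_adjoint_exists:
  assumes lin: "clinear S" and bd: "\<And>x. norm (S x) \<le> B * norm x" and B: "B \<ge> 0"
  obtains S' where "clinear S'" "\<And>y. norm (S' y) \<le> B * norm y" "ell2_adjoint S S'"
proof -
  define t where "t y j = ell2_inner y (S (ell2_basis j))" for y j
  have bound: "(\<Sum>j<N. (cmod (t y j))\<^sup>2) \<le> (B * norm y)\<^sup>2" for y N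
  proof -
    define z where "z = (\<Sum>j<N. t y j *\<^sub>C ell2_basis j)"
    have z: "(norm z)\<^sup>2 = (\<Sum>j<N. (cmod (t y j))\<^sup>2)"
      unfolding z_def by (rule norm_sum_basis_square)
    have "ell2_inner (S z) y = (\<Sum>j<N. t y j * cnj (t y j))"
      by (simp add: z_def clinear_sum[OF lin] ell2_inner_sum_left t_def ell2_inner_cnj)
    also have "\<dots> = of_real ((norm z)\<^sup>2)"
      unfolding z of_real_sum complex_norm_square ..
    finally have "(norm z)\<^sup>2 = cmod (ell2_inner (S z) y)" by (metis norm_of_real abs_power2)
    also have "\<dots> \<le> norm (S z) * norm y" by (rule norm_ell2_inner_le)
    also have "\<dots> \<le> B * norm z * norm y" by (intro mult_right_mono bd) simp
    finally have "norm z * norm z \<le> norm z * (B * norm y)" by (simp add: power2_eq_square mult_ac)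
    then have "norm z \<le> B * norm y"
      using B by (cases "norm z = 0") auto
    then show ?thesis unfolding z[symmetric] by (intro power_mono) simp_all
  qed
  have s: "summable (\<lambda>j. (cmod (t y j))\<^sup>2)" for y
    by (rule summableI_nonneg_bounded[OF _ bound]) simp
  define S' where "S' y = Abs_ell2 (t y)" for y
  have coord: "ell2_coord (S' y) = t y" for y unfolding S'_def by (rule Abs_ell2_coord[OF s])
  show ?thesis
  proof (rule that[of S'])
    show "clinear S'"
      unfolding clinear_iff
      by (auto intro!: ell2_eqI simp: coord ell2_coord_simps t_def ell2_inner_add_left ell2_inner_scaleC_left)
    fix y
    have "(norm (S' y))\<^sup>2 \<le> (B * norm y)\<^sup>2"
      unfolding norm_ell2_square coord by (rule suminf_le_const[OF s bound])
    then show "norm (S' y) \<le> B * norm y" by (rule power2_le_imp_le) (simp add: B)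
  next
    show "ell2_adjoint S S'"
      unfolding ell2_adjoint_def
    proof (intro allI)
      fix x y
      \<comment> \<open>Both sides are continuous in \<open>x\<close>, so it suffices to compare
        them on the finite sections \<open>X N\<close>.\<close>
      define X where "X N = (\<Sum>j<N. ell2_coord x j *\<^sub>C ell2_basis j)" for N
      have eq: "ell2_inner (S (X N)) y = (\<Sum>j<N. ell2_coord x j * cnj (ell2_coord (S' y) j))" for N
        by (simp add: X_def clinear_sum[OF lin] ell2_inner_sum_left coord t_def ell2_inner_cnj)
      have "(\<lambda>N. ell2_inner (S (X N)) y) \<longlonglongrightarrow> ell2_inner x (S' y)"
        unfolding eq by (rule ell2_inner_sums[unfolded sums_def])
      moreover have "(\<lambda>N. ell2_inner (S (X N)) y - ell2_inner (S x) y) \<longlonglongrightarrow> 0"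
      proof (rule Lim_null_comparison)
        show "\<forall>\<^sub>F N in sequentially. norm (ell2_inner (S (X N)) y - ell2_inner (S x) y) \<le> B * norm (X N - x) * norm y"
        proof (rule always_eventually, rule allI)
          fix N
          have "norm (ell2_inner (S (X N)) y - ell2_inner (S x) y) \<le> norm (S (X N - x)) * norm y"
            unfolding ell2_inner_diff_left[symmetric] clinear_diff[OF lin, symmetric]
            by (rule norm_ell2_inner_le)
          also have "\<dots> \<le> B * norm (X N - x) * norm y" by (intro mult_right_mono bd) simp
          finally show "norm (ell2_inner (S (X N)) y - ell2_inner (S x) y) \<le> B * norm (X N - x) * norm y" .
        qed
        have "X \<longlonglongrightarrow> x" unfolding X_def by (rule ell2_basis_expansion)
        then show "(\<lambda>N. B * norm (X N - x) * norm y) \<longlonglongrightarrow> 0"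
          by (intro tendsto_mult_left_zero tendsto_mult_right_zero tendsto_norm_zero LIM_zero)
      qed
      then have "(\<lambda>N. ell2_inner (S (X N)) y) \<longlonglongrightarrow> ell2_inner (S x) y"
        by (rule LIM_zero_cancel)
      ultimately show "ell2_inner (S x) y = ell2_inner x (S' y)"
        by (rule LIMSEQ_unique[rotated])
    qed
  qed
qed

section \<open>Compact operators: boundedness, products, adjoints\<close>

lemma compact_ops_bound:
  assumes "S \<in> compact_ops"
  obtains B where "B \<ge> 0" "\<And>x. norm (S x) \<le> B * norm x"
proof -
  have lin: "clinear S" and "bounded (closure (S ` cball 0 1))"
    using assms compact_imp_bounded by (auto simp: compact_ops_def)
  then have "bounded (S ` cball 0 1)" using bounded_subset closure_subset by blast
  then obtain B where "\<forall>y\<in>S ` cball 0 1. norm y \<le> B" unfolding bounded_iff by blast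
  then have B: "norm (S x) \<le> B" if "norm x \<le> 1" for x using that by simp
  have "norm (S x) \<le> B * norm x" for x
  proof (cases "x = 0")
    case False
    have "norm (S ((1 / norm x) *\<^sub>R x)) \<le> B" by (rule B) simp
    then show ?thesis using False by (simp add: clinear_scaleR[OF lin] field_simps)
  qed (simp add: clinear_zero[OF lin])
  moreover have "B \<ge> 0" by (rule order_trans[OF norm_ge_zero B[of 0]]) simp
  ultimately show ?thesis using that by blast
qed

lemma compact_ops_comp_left:
  assumes V: "clinear V" "\<And>x. norm (V x) \<le> B * norm x" and T: "T \<in> compact_ops"
  shows "V \<circ> T \<in> compact_ops"
proof -
  have lin: "clinear (V \<circ> T)" using V(1) T by (simp add: compact_ops_def clinear_iff)
  have c: "compact (V ` closure (T ` cball 0 1))"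
    using T by (intro compact_continuous_image clinear_continuous_on[OF V]) (simp add: compact_ops_def)
  have "closure ((V \<circ> T) ` cball 0 1) \<subseteq> V ` closure (T ` cball 0 1)"
    by (intro closure_minimal compact_imp_closed[OF c]) (use closure_subset in fastforce)
  then have "compact (closure ((V \<circ> T) ` cball 0 1))"
    by (metis compact_Int_closed c closed_closure Int_absorb1)
  then show ?thesis using lin by (simp add: compact_ops_def)
qed

lemma compact_ops_comp_right:
  assumes W: "clinear W" "\<And>x. norm (W x) \<le> norm x" and T: "T \<in> compact_ops"
  shows "T \<circ> W \<in> compact_ops"
proof -
  have "closure ((T \<circ> W) ` cball 0 1) \<subseteq> closure (T ` cball 0 1)"
    by (intro closure_mono) (use W(2) in \<open>force intro: order_trans\<close>)
  then have "compact (closure ((T \<circ> W) ` cball 0 1))"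
    using compact_Int_closed[of "closure (T ` cball 0 1)" "closure ((T \<circ> W) ` cball 0 1)"] T
    by (simp add: Int_absorb1 compact_ops_def)
  then show ?thesis using W(1) T by (simp add: compact_ops_def clinear_iff)
qed

text \<open>Schauder's theorem by way of
  \<open>(norm (S' w))\<^sup>2 = ell2_inner (S (S' w)) w\<close>. As \<open>S \<circ> S'\<close>
  maps the unit ball into a compact set, a finite net there yields a finite net for the image of the
  ball under \<open>S'\<close>.\<close>

lemma compact_ops_adjoint:
  assumes S: "S \<in> compact_ops"
  obtains S' where "S' \<in> compact_ops" "ell2_adjoint S S'"
proof -
  have lin: "clinear S" using S by (simp add: compact_ops_def)
  obtain B where B: "B \<ge> 0" "\<And>x. norm (S x) \<le> B * norm x" using compact_ops_bound[OF S] by blast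
  obtain S' where S': "clinear S'" "\<And>y. norm (S' y) \<le> B * norm y" "ell2_adjoint S S'"
    using ell2_adjoint_exists[OF lin B(2,1)] by blast
  \<comment> \<open>\<open>S'\<close> maps the unit ball into the ball of radius \<open>B\<close>,
    so \<open>C\<close> captures the values of \<open>S \<circ> S'\<close> on the unit ball.\<close>
  define C where "C = (\<lambda>x. B *\<^sub>R x) ` closure (S ` cball 0 1)"
  have C: "compact C"
    unfolding C_def using S by (intro compact_continuous_image continuous_intros) (simp add: compact_ops_def)
  have SC: "S (S' y) \<in> C" if "norm y \<le> 1" for y
  proof (cases "B = 0")
    case True
    have "S 0 \<in> closure (S ` cball 0 1)" by (intro subsetD[OF closure_subset] imageI) simp
    moreover have "S (S' y) = B *\<^sub>R S 0" using B(2)[of "S' y"] True by simp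
    ultimately show ?thesis unfolding C_def by blast
  next
    case False
    have "norm (S' y) \<le> B" by (rule order_trans[OF S'(2) mult_left_le[OF that B(1)]])
    with False have "norm ((1/B) *\<^sub>R S' y) \<le> 1" using B(1) by (simp add: field_simps)
    then have "S ((1/B) *\<^sub>R S' y) \<in> closure (S ` cball 0 1)"
      by (intro subsetD[OF closure_subset] imageI) simp
    moreover have "S (S' y) = B *\<^sub>R S ((1/B) *\<^sub>R S' y)"
      using False by (simp add: clinear_scaleR[OF lin])
    ultimately show ?thesis unfolding C_def by blast
  qed
  have "\<exists>k. finite k \<and> closure (S' ` cball 0 1) \<subseteq> (\<Union>x\<in>k. ball x e)" if e: "e > 0" for e
  proof -
    \<comment> \<open>Two points of the ball near the same centre differ by \<open>w\<close> with
      \<open>norm w \<le> 2\<close> and \<open>norm (S (S' w)) \<le> 2 * d\<close>, whence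
      \<open>(norm (S' w))\<^sup>2 \<le> 4 * d = (e / 2)\<^sup>2\<close>.\<close>
    define d where "d = e\<^sup>2 / 16"
    have d: "d > 0" using e by (simp add: d_def)
    obtain k where k: "finite k" "C \<subseteq> (\<Union>x\<in>k. ball x d)"
      using C d unfolding compact_eq_totally_bounded by blast
    \<comment> \<open>Centres of the net need not be values of \<open>S \<circ> S'\<close>; a point
      of the ball with value near the centre is chosen where one exists.\<close>
    define f where "f z = (SOME y. norm y \<le> 1 \<and> dist z (S (S' y)) < d)" for z
    have "S' ` cball 0 1 \<subseteq> (\<Union>x\<in>(\<lambda>z. S' (f z)) ` k. cball x (e / 2))"
    proof (rule image_subsetI)
      fix y :: ell2 assume "y \<in> cball 0 1"
      then have y: "norm y \<le> 1" by simp
      then have "S (S' y) \<in> (\<Union>x\<in>k. ball x d)" by (intro subsetD[OF k(2)] SC)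
      then obtain z where z: "z \<in> k" "dist z (S (S' y)) < d" by auto
      have "\<exists>y. norm y \<le> 1 \<and> dist z (S (S' y)) < d" using y z(2) by blast
      then have f: "norm (f z) \<le> 1 \<and> dist z (S (S' (f z))) < d"
        unfolding f_def by (rule someI_ex)
      define w where "w = f z - y"
      have "norm (S (S' w)) = dist (S (S' (f z))) (S (S' y))"
        by (simp add: w_def clinear_diff[OF lin] clinear_diff[OF S'(1)] dist_norm)
      also have "\<dots> \<le> 2 * d"
        using f z(2) dist_triangle[of "S (S' (f z))" "S (S' y)" z] by (simp add: dist_commute)
      finally have 1: "norm (S (S' w)) \<le> 2 * d" .
      have 2: "norm w \<le> 2" using norm_triangle_ineq4[of "f z" y] f y by (simp add: w_def)
      have "ell2_inner (S (S' w)) w = of_real ((norm (S' w))\<^sup>2)"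
        using S'(3) by (simp add: ell2_adjoint_def ell2_inner_self)
      then have "(norm (S' w))\<^sup>2 = cmod (ell2_inner (S (S' w)) w)" by (metis norm_of_real abs_power2)
      also have "\<dots> \<le> norm (S (S' w)) * norm w" by (rule norm_ell2_inner_le)
      also have "\<dots> \<le> (2 * d) * 2"
        by (rule mult_mono[OF 1 2]) (use d in simp_all)
      also have "\<dots> = (e / 2)\<^sup>2" by (simp add: d_def power2_eq_square)
      finally have "norm (S' w) \<le> e / 2" by (rule power2_le_imp_le) (use e in simp)
      then have "dist (S' (f z)) (S' y) \<le> e / 2" by (simp add: w_def clinear_diff[OF S'(1)] dist_norm)
      then show "S' y \<in> (\<Union>x\<in>(\<lambda>z. S' (f z)) ` k. cball x (e / 2))"
        unfolding UN_iff mem_cball using z(1) by blast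
    qed
    then have "closure (S' ` cball 0 1) \<subseteq> (\<Union>x\<in>(\<lambda>z. S' (f z)) ` k. cball x (e / 2))"
      using k(1) by (intro closure_minimal closed_UN) auto
    also have "\<dots> \<subseteq> (\<Union>x\<in>(\<lambda>z. S' (f z)) ` k. ball x e)" using e by fastforce
    finally show ?thesis using k(1) by blast
  qed
  then have "compact (closure (S' ` cball 0 1))"
    by (simp add: compact_eq_totally_bounded complete_eq_closed)
  then show ?thesis using that S' by (simp add: compact_ops_def)
qed

text \<open>For strictly increasing \<open>g\<close>, the isometry that carries basis vector
  \<open>n\<close> to basis vector \<open>g n\<close>; \<open>coshift g\<close> is its
  adjoint.\<close>

definition shift :: "(nat \<Rightarrow> nat) \<Rightarrow> ell2 \<Rightarrow> ell2" where
  "shift g x = Abs_ell2 (\<lambda>m. if m \<in> range g then ell2_coord x (inv g m) else 0)"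

definition coshift :: "(nat \<Rightarrow> nat) \<Rightarrow> ell2 \<Rightarrow> ell2" where
  "coshift g x = Abs_ell2 (\<lambda>n. ell2_coord x (g n))"

context
  fixes g :: "nat \<Rightarrow> nat"
  assumes g: "strict_mono g"
begin

lemma inv_strict_mono: "inv g (g n) = n"
  using g by (simp add: strict_mono_imp_inj_on)

lemma ell2_coord_shift:
  "ell2_coord (shift g x) m = (if m \<in> range g then ell2_coord x (inv g m) else 0)"
proof -
  have "summable (\<lambda>m. (cmod (if m \<in> range g then ell2_coord x (inv g m) else 0))\<^sup>2)"
    by (subst summable_mono_reindex[OF g, symmetric])
      (auto simp: inv_strict_mono summable_ell2_coord)
  then show ?thesis unfolding shift_def by (simp add: Abs_ell2_coord)
qed

lemma ell2_coord_coshift: "ell2_coord (coshift g x) n = ell2_coord x (g n)"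
proof -
  have "summable (\<lambda>m. if m \<in> range g then (cmod (ell2_coord x m))\<^sup>2 else 0)"
    by (rule summable_comparison_test'[OF summable_ell2_coord[of x]]) auto
  from summable_mono_reindex[OF g, THEN iffD2, OF _ this]
  have "summable (\<lambda>n. (cmod (ell2_coord x (g n)))\<^sup>2)" by simp
  then show ?thesis unfolding coshift_def by (simp add: Abs_ell2_coord)
qed

lemma ell2_inner_shift: "ell2_inner (shift g x) y = ell2_inner x (coshift g y)"
proof -
  have "ell2_inner (shift g x) y = (\<Sum>n. ell2_coord (shift g x) (g n) * cnj (ell2_coord y (g n)))"
    unfolding ell2_inner.rep_eq
    by (rule suminf_mono_reindex[OF g, symmetric]) (simp add: ell2_coord_shift)
  then show ?thesis
    by (simp add: ell2_inner.rep_eq ell2_coord_shift ell2_coord_coshift inv_strict_mono)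
qed

lemma coshift_shift: "coshift g (shift g x) = x"
  by (rule ell2_eqI) (simp add: ell2_coord_coshift ell2_coord_shift inv_strict_mono)

lemma clinear_shift: "clinear (shift g)" and clinear_coshift: "clinear (coshift g)"
  unfolding clinear_iff
  by (auto intro!: ell2_eqI simp: ell2_coord_coshift ell2_coord_shift ell2_coord_simps)

lemma norm_coshift_le: "norm (coshift g x) \<le> norm x"
  and norm_shift: "norm (shift g x) = norm x"
proof -
  have "complex_of_real ((norm (shift g x))\<^sup>2) = of_real ((norm x)\<^sup>2)" for x
    by (simp only: ell2_inner_self[symmetric] ell2_inner_shift coshift_shift)
  then show n: "norm (shift g x) = norm x" for x
    by (simp only: of_real_eq_iff) (simp add: power2_eq_iff_nonneg)
  have "of_real ((norm (coshift g x))\<^sup>2) = ell2_inner (shift g (coshift g x)) x"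
    by (simp only: ell2_inner_self[symmetric] ell2_inner_shift)
  then have "(norm (coshift g x))\<^sup>2 = cmod (ell2_inner (shift g (coshift g x)) x)"
    by (metis norm_of_real abs_power2)
  also have "\<dots> \<le> norm (coshift g x) * norm x"
    using norm_ell2_inner_le[of "shift g (coshift g x)" x] n by simp
  finally show "norm (coshift g x) \<le> norm x"
    by (cases "norm (coshift g x) = 0") (simp_all add: power2_eq_square)
qed

end

lemma coshift_shift_disjoint:
  assumes "strict_mono g" "strict_mono h" "range g \<inter> range h = {}"
  shows "coshift g (shift h x) = 0"
  by (rule ell2_eqI)
    (use assms in \<open>auto simp: ell2_coord_coshift ell2_coord_shift ell2_coord_simps\<close>)

section \<open>Orthogonal copies in stable algebras\<close>

lemma tensor_compactsD:
  assumes "tensor_compacts \<tau>"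
  shows tensor_clinear: "T \<in> compact_ops \<Longrightarrow> clinear (\<lambda>a. \<tau> a T)"
    and tensor_scaleC: "T \<in> compact_ops \<Longrightarrow> \<tau> a (\<lambda>x. c *\<^sub>C T x) = c *\<^sub>C \<tau> a T"
    and tensor_mult: "S \<in> compact_ops \<Longrightarrow> T \<in> compact_ops \<Longrightarrow> \<tau> a S * \<tau> b T = \<tau> (a * b) (S \<circ> T)"
    and tensor_star: "S \<in> compact_ops \<Longrightarrow> T \<in> compact_ops \<Longrightarrow> ell2_adjoint S T \<Longrightarrow>
      star (\<tau> a S) = \<tau> (star a) T"
    and tensor_dense: "closure (cspan {\<tau> a T | a T. T \<in> compact_ops}) = UNIV"
proof -
  note * = assms[unfolded tensor_compacts_def]
  show "T \<in> compact_ops \<Longrightarrow> clinear (\<lambda>a. \<tau> a T)"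
    using *[THEN conjunct1] by blast
  show "T \<in> compact_ops \<Longrightarrow> \<tau> a (\<lambda>x. c *\<^sub>C T x) = c *\<^sub>C \<tau> a T"
    using *[THEN conjunct2, THEN conjunct2, THEN conjunct1] by blast
  show "S \<in> compact_ops \<Longrightarrow> T \<in> compact_ops \<Longrightarrow> \<tau> a S * \<tau> b T = \<tau> (a * b) (S \<circ> T)"
    using *[THEN conjunct2, THEN conjunct2, THEN conjunct2, THEN conjunct1] by blast
  show "S \<in> compact_ops \<Longrightarrow> T \<in> compact_ops \<Longrightarrow> ell2_adjoint S T \<Longrightarrow> star (\<tau> a S) = \<tau> (star a) T"
    using *[THEN conjunct2, THEN conjunct2, THEN conjunct2, THEN conjunct2, THEN conjunct1] by blast
  show "closure (cspan {\<tau> a T | a T. T \<in> compact_ops}) = UNIV"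
    using *[THEN conjunct2, THEN conjunct2, THEN conjunct2, THEN conjunct2, THEN conjunct2, THEN conjunct2] .
qed

lemma shift_comp_compact_ops: "strict_mono g \<Longrightarrow> T \<in> compact_ops \<Longrightarrow> shift g \<circ> T \<in> compact_ops"
  by (rule compact_ops_comp_left[where B = 1]) (auto simp: clinear_shift norm_shift)

text \<open>The adjoint of \<open>shift g \<circ> S\<close> is \<open>S' \<circ> coshift g\<close>,
  so the product contains \<open>coshift g \<circ> shift h\<close>: the identity if
  \<open>g = h\<close>, and \<open>0\<close> if the ranges are disjoint.\<close>

lemma star_tensor_shift_mult:
  assumes \<tau>: "tensor_compacts \<tau>" and gh: "strict_mono g" "strict_mono h"
    and S: "S \<in> compact_ops" "S' \<in> compact_ops" "ell2_adjoint S S'" and T: "T \<in> compact_ops"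
  shows "star (\<tau> a (shift g \<circ> S)) * \<tau> b (shift h \<circ> T) = \<tau> (star a * b) (\<lambda>x. S' (coshift g (shift h (T x))))"
proof -
  have S'c: "S' \<circ> coshift g \<in> compact_ops"
    using gh(1) by (intro compact_ops_comp_right S clinear_coshift norm_coshift_le)
  have "ell2_adjoint (shift g \<circ> S) (S' \<circ> coshift g)"
    using S(3) gh(1) by (simp add: ell2_adjoint_def ell2_inner_shift)
  then have "star (\<tau> a (shift g \<circ> S)) = \<tau> (star a) (S' \<circ> coshift g)"
    by (rule tensor_star[OF \<tau> shift_comp_compact_ops[OF gh(1) S(1)] S'c])
  then show ?thesis
    using tensor_mult[OF \<tau> S'c shift_comp_compact_ops[OF gh(2) T]] by (simp add: o_def)
qed

lemma star_tensor_shift_mult_same: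
  assumes \<tau>: "tensor_compacts \<tau>" and g: "strict_mono g" and S: "S \<in> compact_ops" and T: "T \<in> compact_ops"
  shows "star (\<tau> a (shift g \<circ> S)) * \<tau> b (shift g \<circ> T) = star (\<tau> a S) * \<tau> b T"
proof -
  obtain S' where S': "S' \<in> compact_ops" "ell2_adjoint S S'" by (rule compact_ops_adjoint[OF S])
  show ?thesis
    by (simp only: star_tensor_shift_mult[OF \<tau> g g S S' T] coshift_shift[OF g]
        tensor_star[OF \<tau> S S'] tensor_mult[OF \<tau> S'(1) T]) (simp only: o_def)
qed

lemma star_tensor_shift_mult_disjoint:
  assumes \<tau>: "tensor_compacts \<tau>" and gh: "strict_mono g" "strict_mono h" "range g \<inter> range h = {}"
    and S: "S \<in> compact_ops" and T: "T \<in> compact_ops"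
  shows "star (\<tau> a (shift g \<circ> S)) * \<tau> b (shift h \<circ> T) = 0"
proof -
  obtain S' where S': "S' \<in> compact_ops" "ell2_adjoint S S'" by (rule compact_ops_adjoint[OF S])
  have "S' 0 = 0" using S'(1) by (simp add: compact_ops_def clinear_zero)
  \<comment> \<open>The zero operator is written as a multiple of \<open>T\<close>, so that
    homogeneity of \<open>\<tau>\<close> gives the value \<open>0\<close>.\<close>
  then have "star (\<tau> a (shift g \<circ> S)) * \<tau> b (shift h \<circ> T) = \<tau> (star a * b) (\<lambda>x. 0 *\<^sub>C T x)"
    by (simp add: star_tensor_shift_mult[OF \<tau> gh(1,2) S S' T] coshift_shift_disjoint[OF gh])
  then show ?thesis by (simp only: tensor_scaleC[OF \<tau> T]) simp
qed

text \<open>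
  \<open>tensor_shift \<tau> g\<close> is the graph of left multiplication by the multiplier \<open>1 \<otimes> shift g\<close> on the
  algebraic tensor product.
\<close>

inductive tensor_shift ::
  "('a::cstar_algebra \<Rightarrow> (ell2 \<Rightarrow> ell2) \<Rightarrow> 'a) \<Rightarrow> (nat \<Rightarrow> nat) \<Rightarrow> 'a \<Rightarrow> 'a \<Rightarrow> bool" for \<tau> g where
  zero: "tensor_shift \<tau> g 0 0"
| step: "tensor_shift \<tau> g x y \<Longrightarrow> T \<in> compact_ops \<Longrightarrow>
    tensor_shift \<tau> g (x + \<tau> a T) (y + \<tau> a (shift g \<circ> T))"

lemma tensor_shift_star_mult:
  assumes \<tau>: "tensor_compacts \<tau>" and g: "strict_mono g"
    and "tensor_shift \<tau> g x y" "tensor_shift \<tau> g x' y'"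
  shows "star y * y' = star x * x'"
proof -
  have *: "star (\<tau> a (shift g \<circ> S)) * y' = star (\<tau> a S) * x'" if S: "S \<in> compact_ops" for a S
    using assms(4)
    by induction (simp_all only: mult_zero_right add_0_right distrib_left star_tensor_shift_mult_same[OF \<tau> g S])
  show ?thesis
    using assms(3) by induction (auto simp: star_add distrib_right *)
qed

lemma tensor_shift_star_mult_disjoint:
  assumes \<tau>: "tensor_compacts \<tau>" and gh: "strict_mono g" "strict_mono h" "range g \<inter> range h = {}"
    and "tensor_shift \<tau> g x y" "tensor_shift \<tau> h x' y'"
  shows "star y * y' = 0"
proof -
  have *: "star (\<tau> a (shift g \<circ> S)) * y' = 0" if S: "S \<in> compact_ops" for a S
    using assms(6)
    by induction (simp_all only: mult_zero_right add_0_right distrib_left star_tensor_shift_mult_disjoint[OF \<tau> gh S])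
  show ?thesis
    using assms(5) by induction (auto simp: star_add distrib_right *)
qed

text \<open>Together with \<open>tensor_shift_norm\<close> this makes images as far apart as their
  arguments; in particular the image does not depend on the expansion into elementary
  tensors.\<close>

lemma tensor_shift_diff:
  assumes \<tau>: "tensor_compacts \<tau>" and g: "strict_mono g"
    and "tensor_shift \<tau> g x y" "tensor_shift \<tau> g x' y'"
  shows "tensor_shift \<tau> g (x - x') (y - y')"
  using assms(4)
proof induction
  case (step x' y' T a)
  have "\<tau> (- a) T = - \<tau> a T" "\<tau> (- a) (shift g \<circ> T) = - \<tau> a (shift g \<circ> T)"
    using clinear_minus[OF tensor_clinear[OF \<tau>]] shift_comp_compact_ops[OF g] step by blast+
  then show ?case
    using tensor_shift.step[OF step.IH step.hyps(2), of "- a"] by (simp only: diff_diff_eq add_uminus_conv_diff)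
qed (simp add: assms)

lemma tensor_shift_norm:
  assumes \<tau>: "tensor_compacts \<tau>" and g: "strict_mono g" and "tensor_shift \<tau> g x y"
  shows "norm y = norm x"
  using cstar_identity[of y] cstar_identity[of x] tensor_shift_star_mult[OF \<tau> g assms(3,3)]
  by (simp add: power2_eq_iff_nonneg)

lemma tensor_shift_exists:
  assumes \<tau>: "tensor_compacts \<tau>" and "x \<in> cspan {\<tau> a T | a T. T \<in> compact_ops}"
  shows "\<exists>y. tensor_shift \<tau> g x y"
proof -
  interpret vector_space "scaleC :: complex \<Rightarrow> 'a \<Rightarrow> 'a" by (rule vector_space_scaleC)
  show ?thesis
    using assms(2)
  proof (induction rule: span_induct_alt)
    case base
    then show ?case using tensor_shift.zero by blast
  next
    case (step c z x)
    then obtain a T y where "z = \<tau> a T" "T \<in> compact_ops" "tensor_shift \<tau> g x y" by blast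
    moreover from this have "c *\<^sub>C z = \<tau> (c *\<^sub>C a) T"
      using tensor_clinear[OF \<tau>] by (simp add: clinear_iff)
    ultimately show ?case
      using tensor_shift.step[of \<tau> g x y T "c *\<^sub>C a"] by (auto simp: add.commute)
  qed
qed

text \<open>The multiplier is extended to the whole algebra by density and isometry. Keeping the
  approximating sequences instead of a map lets the product formulas pass to the limit
  directly.\<close>

lemma tensor_shift_approx:
  assumes \<tau>: "tensor_compacts \<tau>" and g: "strict_mono g"
  obtains xs ys and y where "\<And>n. tensor_shift \<tau> g (xs n) (ys n)" "xs \<longlonglongrightarrow> p" "ys \<longlonglongrightarrow> y"
proof -
  have "p \<in> closure (cspan {\<tau> a T | a T. T \<in> compact_ops})" using tensor_dense[OF \<tau>] by simp
  then obtain xs where xs: "\<And>n. xs n \<in> cspan {\<tau> a T | a T. T \<in> compact_ops}" "xs \<longlonglongrightarrow> p"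
    unfolding closure_sequential by blast
  have "\<forall>n. \<exists>y. tensor_shift \<tau> g (xs n) y" using tensor_shift_exists[OF \<tau> xs(1)] by blast
  then obtain ys where ys: "\<And>n. tensor_shift \<tau> g (xs n) (ys n)" by metis
  have n: "norm (ys m - ys n) = norm (xs m - xs n)" for m n
    by (rule tensor_shift_norm[OF \<tau> g tensor_shift_diff[OF \<tau> g ys ys]])
  have "Cauchy xs" using xs(2) by (rule LIMSEQ_imp_Cauchy)
  then have "Cauchy ys" unfolding Cauchy_iff n .
  then obtain y where "ys \<longlonglongrightarrow> y" using Cauchy_convergent convergent_def by blast
  then show ?thesis using that ys xs(2) by blast
qed

text \<open>\<open>x\<close> and \<open>y\<close> are the images of \<open>p\<close> and
  \<open>q\<close> under the multipliers \<open>1 \<otimes> shift g\<close> and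
  \<open>1 \<otimes> shift h\<close>. With \<open>g\<close> onto the even and \<open>h\<close> onto
  the odd numbers these are isometries with orthogonal ranges.\<close>

lemma stable_orthogonal_copies:
  fixes p q :: "'a::cstar_algebra"
  assumes "cstar_stable TYPE('a)"
  obtains x y where "star x * x = star p * p" "star y * y = star q * q" "star x * y = 0"
proof -
  obtain \<tau> :: "'a \<Rightarrow> (ell2 \<Rightarrow> ell2) \<Rightarrow> 'a" where \<tau>: "tensor_compacts \<tau>"
    using assms by (auto simp: cstar_stable_def)
  define g h :: "nat \<Rightarrow> nat" where "g n = 2 * n" and "h n = 2 * n + 1" for n
  have gh: "strict_mono g" "strict_mono h" "range g \<inter> range h = {}"
    by (auto simp: strict_mono_def g_def h_def) presburger
  obtain ps xs x where x: "\<And>n. tensor_shift \<tau> g (ps n) (xs n)" "ps \<longlonglongrightarrow> p" "xs \<longlonglongrightarrow> x"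
    using tensor_shift_approx[OF \<tau> gh(1), of p] by metis
  obtain qs ys y where y: "\<And>n. tensor_shift \<tau> h (qs n) (ys n)" "qs \<longlonglongrightarrow> q" "ys \<longlonglongrightarrow> y"
    using tensor_shift_approx[OF \<tau> gh(2), of q] by metis
  show ?thesis
  proof (rule that)
    have "(\<lambda>n. star (xs n) * xs n) \<longlonglongrightarrow> star x * x" by (intro tendsto_mult tendsto_star x)
    moreover have "(\<lambda>n. star (xs n) * xs n) \<longlonglongrightarrow> star p * p"
      unfolding tensor_shift_star_mult[OF \<tau> gh(1) x(1) x(1)] by (intro tendsto_mult tendsto_star x)
    ultimately show "star x * x = star p * p" by (rule LIMSEQ_unique)
    have "(\<lambda>n. star (ys n) * ys n) \<longlonglongrightarrow> star y * y" by (intro tendsto_mult tendsto_star y)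
    moreover have "(\<lambda>n. star (ys n) * ys n) \<longlonglongrightarrow> star q * q"
      unfolding tensor_shift_star_mult[OF \<tau> gh(2) y(1) y(1)] by (intro tendsto_mult tendsto_star y)
    ultimately show "star y * y = star q * q" by (rule LIMSEQ_unique)
    have "(\<lambda>n. star (xs n) * ys n) \<longlonglongrightarrow> star x * y" by (intro tendsto_mult tendsto_star x y)
    then show "star x * y = 0"
      unfolding tensor_shift_star_mult_disjoint[OF \<tau> gh x(1) y(1)] by (simp add: LIMSEQ_const_iff)
  qed
qed

text \<open>\<open>x\<close> and \<open>y\<close> are partial isometries from \<open>p\<close> and
  \<open>q\<close> onto orthogonal projections with sum \<open>r\<close>. The ideals agree since
  \<open>p = star x * r * x\<close>, \<open>q = star y * r * y\<close> and
  \<open>r = x * p * star x + y * q * star y\<close>.\<close>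

lemma stable_projection_join:
  fixes p q :: "'a::cstar_algebra"
  assumes "cstar_stable TYPE('a)" and p: "projection p" and q: "projection q"
  obtains r where "projection r" "ideal hull {r} = ideal hull {p, q}"
proof -
  obtain x y where "star x * x = star p * p" "star y * y = star q * q" and xy: "star x * y = 0"
    by (rule stable_orthogonal_copies[OF assms(1)])
  then have x: "star x * x = p" and y: "star y * y = q" using p q by (simp_all add: projection_def)
  \<comment> \<open>By the C*-identity, it suffices that \<open>star d * d = 0\<close> for
    \<open>d = z - z * e\<close>.\<close>
  have absorb: "z * e = z" if e: "star z * z = e" "projection e" for z e :: 'a
  proof -
    have ee: "star e = e" "e * e = e" using e(2) by (simp_all add: projection_def)
    have "star (z - z * e) * (z - z * e) =
        star z * z - e * (star z * z) - ((star z * z) * e - e * (star z * z) * e)"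
      by (simp only: star_diff star_mult ee left_diff_distrib right_diff_distrib mult.assoc)
    also have "\<dots> = 0" by (simp only: e(1) ee) simp
    finally show ?thesis using cstar_identity[of "z - z * e"] by simp
  qed
  have xp: "x * p = x" and yq: "y * q = y" using absorb x y p q by blast+
  have yx: "star y * x = 0" using arg_cong[OF xy, of star] by (simp add: star_mult star_star)
  define r where "r = x * star x + y * star y"
  have rx: "r * x = x" and ry: "r * y = y"
    by (simp_all add: r_def distrib_right mult.assoc x y xy yx xp yq)
  have sr: "star r = r" by (simp add: r_def star_add star_mult star_star)
  have "r * r = (r * x) * star x + (r * y) * star y" by (subst (2) r_def) (simp add: distrib_left mult.assoc)
  then have "r * r = r" by (simp add: rx ry) (simp add: r_def)
  with sr have r: "projection r" by (simp add: projection_def)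
  have "star x * r * x = p" "star y * r * y = q" by (simp_all add: mult.assoc rx ry x y)
  then have "p \<in> ideal hull {r}" "q \<in> ideal hull {r}"
    by (metis ideal_mult_left ideal_mult_right ideal_ideal_hull ideal_hull_self)+
  then have "ideal hull {p, q} \<subseteq> ideal hull {r}" by (intro ideal_hull_minimal ideal_ideal_hull) simp
  moreover have "x * p * star x + y * q * star y \<in> ideal hull {p, q}"
    by (intro ideal_add ideal_mult_left ideal_mult_right ideal_ideal_hull hull_inc) simp_all
  then have "r \<in> ideal hull {p, q}" by (simp add: xp yq r_def)
  then have "ideal hull {r} \<subseteq> ideal hull {p, q}" by (intro ideal_hull_minimal ideal_ideal_hull) simp
  ultimately show ?thesis using that r by blast
qed

section \<open>The ideal property\<close>

lemma purely_infinite_Cuntz_sub: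
  fixes a b :: "'a::cstar_algebra"
  assumes "purely_infinite TYPE('a)" "cstar_positive a" "cstar_positive b" "a \<in> ideal hull {b}"
  shows "corner a \<precsim> corner b"
  using assms unfolding purely_infinite_def by blast

lemma purely_infinite_Cuntz_refl:
  fixes a :: "'a::cstar_algebra"
  assumes "purely_infinite TYPE('a)" "cstar_positive a"
  shows "corner a \<precsim> corner a"
  by (rule purely_infinite_Cuntz_sub) (auto simp: assms ideal_hull_self)

text \<open>The chain condition serves addition: two elements of the union lie in a common
  member.\<close>

lemma ideal_closure_Union:
  fixes I :: "nat \<Rightarrow> 'a::cstar_algebra set"
  assumes I: "\<And>n. ideal (I n)" "incseq I"
  shows "ideal (closure (\<Union>n. I n))"
proof -
  let ?U = "\<Union>n. I n"
  have add: "x + y \<in> ?U" if xy: "x \<in> ?U" "y \<in> ?U" for x y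
  proof -
    obtain m n where mn: "x \<in> I m" "y \<in> I n" using xy by blast
    have "x \<in> I (max m n)" using mn(1) incseqD[OF I(2) max.cobounded1] by blast
    moreover have "y \<in> I (max m n)" using mn(2) incseqD[OF I(2) max.cobounded2] by blast
    ultimately show ?thesis using ideal_add[OF I(1)] by blast
  qed
  have bl: "f x \<in> closure ?U"
    if f: "bounded_linear f" "\<And>z. z \<in> ?U \<Longrightarrow> f z \<in> ?U" and x: "x \<in> closure ?U" for f :: "'a \<Rightarrow> 'a" and x
  proof -
    obtain s where s: "\<And>n. s n \<in> ?U" "s \<longlonglongrightarrow> x" using x unfolding closure_sequential by blast
    show ?thesis
    proof (rule closed_sequentially[OF closed_closure _ bounded_linear.tendsto[OF f(1) s(2)]])
      fix n
      show "f (s n) \<in> closure ?U" by (rule subsetD[OF closure_subset f(2)[OF s(1)]])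
    qed
  qed
  show ?thesis
    unfolding ideal_def
  proof (intro conjI ballI allI)
    show "0 \<in> closure ?U" by (rule subsetD[OF closure_subset UN_I[of 0]]) (simp_all add: ideal_zero[OF I(1)])
  next
    fix x y assume "x \<in> closure ?U" "y \<in> closure ?U"
    then obtain s t where s: "\<And>n. s n \<in> ?U" "s \<longlonglongrightarrow> x" and t: "\<And>n. t n \<in> ?U" "t \<longlonglongrightarrow> y"
      unfolding closure_sequential by blast
    show "x + y \<in> closure ?U"
    proof (rule closed_sequentially[OF closed_closure _ tendsto_add[OF s(2) t(2)]])
      fix n
      show "s n + t n \<in> closure ?U" by (rule subsetD[OF closure_subset add[OF s(1) t(1)]])
    qed
  next
    fix c x assume "x \<in> closure ?U"
    then show "c *\<^sub>C x \<in> closure ?U"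
      by (rule bl[OF bounded_linear_scaleC, rotated]) (use ideal_scaleC[OF I(1)] in blast)
  next
    fix a x assume "x \<in> closure ?U"
    then show "a * x \<in> closure ?U"
      by (rule bl[OF bounded_linear_mult_right, rotated]) (use ideal_mult_left[OF I(1)] in blast)
  next
    fix a x assume "x \<in> closure ?U"
    then show "x * a \<in> closure ?U"
      by (rule bl[OF bounded_linear_mult_left, rotated]) (use ideal_mult_right[OF I(1)] in blast)
  qed simp
qed

text \<open>The elements reached from countable subsets of \<open>S\<close> form an ideal.
  Closedness is the decisive point: a convergent sequence involves countably many countable sets,
  whose union is countable.\<close>

lemma ideal_hull_countable:
  assumes "x \<in> ideal hull S"
  obtains C where "C \<subseteq> S" "countable C" "x \<in> ideal hull C"
proof -
  let ?J = "{x. \<exists>C\<subseteq>S. countable C \<and> x \<in> ideal hull C}"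
  have memI: "x \<in> ?J" if "C \<subseteq> S" "countable C" "x \<in> ideal hull C" for x C
    using that by blast
  have "ideal ?J"
    unfolding ideal_def[of ?J]
  proof (intro conjI ballI allI)
    show "closed ?J"
      unfolding closed_sequential_limits
    proof (intro allI impI)
      fix s l assume "(\<forall>n. s n \<in> ?J) \<and> s \<longlonglongrightarrow> l"
      then obtain C where C: "\<And>n. C n \<subseteq> S" "\<And>n. countable (C n)" "\<And>n. s n \<in> ideal hull C n"
        and l: "s \<longlonglongrightarrow> l"
        by (auto simp: choice_iff)
      have "s n \<in> ideal hull (\<Union>n. C n)" for n
        using C(3)[of n] hull_mono[of "C n" "\<Union>n. C n" ideal] by blast
      then have "l \<in> ideal hull (\<Union>n. C n)" using ideal_tendsto[OF ideal_ideal_hull _ l] by blast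
      then show "l \<in> ?J" by (rule memI[rotated 2]) (use C(1,2) in auto)
    qed
    show "0 \<in> ?J" by (rule memI[of "{}"]) (auto intro: ideal_zero ideal_ideal_hull)
  next
    fix x y assume "x \<in> ?J" "y \<in> ?J"
    then obtain C D where CD: "C \<subseteq> S" "countable C" "x \<in> ideal hull C"
      "D \<subseteq> S" "countable D" "y \<in> ideal hull D" by blast
    have "x \<in> ideal hull (C \<union> D)" "y \<in> ideal hull (C \<union> D)"
      using CD(3,6) hull_mono[of C "C \<union> D" ideal] hull_mono[of D "C \<union> D" ideal] by blast+
    then have "x + y \<in> ideal hull (C \<union> D)" by (rule ideal_add[OF ideal_ideal_hull])
    then show "x + y \<in> ?J" by (rule memI[rotated 2]) (use CD in auto)
  next
    fix c x assume "x \<in> ?J"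
    then show "c *\<^sub>C x \<in> ?J" using ideal_scaleC[OF ideal_ideal_hull] by blast
  next
    fix a x assume "x \<in> ?J"
    then show "a * x \<in> ?J" using ideal_mult_left[OF ideal_ideal_hull] by blast
  next
    fix a x assume "x \<in> ?J"
    then show "x * a \<in> ?J" using ideal_mult_right[OF ideal_ideal_hull] by blast
  qed
  moreover have "S \<subseteq> ?J"
  proof
    fix y assume "y \<in> S"
    then show "y \<in> ?J" by (intro memI[of "{y}"]) (auto simp: ideal_hull_self)
  qed
  ultimately have "ideal hull S \<subseteq> ?J" by (intro ideal_hull_minimal)
  then show ?thesis using assms that by blast
qed

lemma projection_chain_exists:
  fixes a :: "'a::cstar_algebra"
  assumes stable: "cstar_stable TYPE('a)" and ip: "ideal_property TYPE('a)"
  obtains q where "\<And>n. projection (q n)" "incseq (\<lambda>n. ideal hull {q n})"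
    "ideal hull {a} = closure (\<Union>n. ideal hull {q n})"
proof -
  let ?P = "{p \<in> ideal hull {a}. projection p}"
  have "ideal hull {a} = ideal hull ?P"
    using ip ideal_ideal_hull[of "{a}"] unfolding ideal_property_def by blast
  then have "a \<in> ideal hull ?P" using ideal_hull_self by blast
  then obtain C where C: "C \<subseteq> ?P" "countable C" "a \<in> ideal hull C" by (rule ideal_hull_countable)
  \<comment> \<open>\<open>C\<close> may be empty; adding the projection \<open>0\<close> allows an
    enumeration by the natural numbers.\<close>
  define p where "p = from_nat_into (insert 0 C)"
  have rp: "range p = insert 0 C" unfolding p_def using C(2) by (intro range_from_nat_into) auto
  have p: "projection (p n)" "p n \<in> ideal hull {a}" for n
  proof -
    have "p n \<in> insert 0 C" using rp by blast
    then show "projection (p n)" "p n \<in> ideal hull {a}"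
      using C(1) by (auto simp: ideal_zero ideal_ideal_hull)
  qed
  \<comment> \<open>By stability, each new projection can generate the ideal of its predecessor
    together with the next \<open>p\<close>.\<close>
  have "\<exists>q. \<forall>n. (projection (q n) \<and> p n \<in> ideal hull {q n} \<and> q n \<in> ideal hull {a})
      \<and> ideal hull {q n} \<subseteq> ideal hull {q (Suc n)}"
  proof (rule dependent_nat_choice)
    show "\<exists>r. projection r \<and> p 0 \<in> ideal hull {r} \<and> r \<in> ideal hull {a}"
      using p ideal_hull_self by blast
  next
    fix r n
    assume r: "projection r \<and> p n \<in> ideal hull {r} \<and> r \<in> ideal hull {a}"
    obtain s where s: "projection s" "ideal hull {s} = ideal hull {r, p (Suc n)}"
      using stable_projection_join[OF stable, of r "p (Suc n)"] r p(1) by blast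
    have "ideal hull {s} \<subseteq> ideal hull {a}"
      unfolding s(2) using r p(2) by (intro ideal_hull_minimal ideal_ideal_hull) simp
    moreover have "{r, p (Suc n)} \<subseteq> ideal hull {s}" unfolding s(2) by (rule hull_subset)
    ultimately show "\<exists>s. (projection s \<and> p (Suc n) \<in> ideal hull {s} \<and> s \<in> ideal hull {a})
        \<and> ideal hull {r} \<subseteq> ideal hull {s}"
      using s(1) ideal_hull_self[of s]
      by (intro exI[of _ s] conjI ideal_hull_minimal ideal_ideal_hull) auto
  qed
  then obtain q where q: "\<And>n. projection (q n)" "\<And>n. p n \<in> ideal hull {q n}"
    "\<And>n. q n \<in> ideal hull {a}" and incS: "\<And>n. ideal hull {q n} \<subseteq> ideal hull {q (Suc n)}" by blast
  have inc: "incseq (\<lambda>n. ideal hull {q n})" by (rule incseq_SucI) (rule incS)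
  let ?U = "closure (\<Union>n. ideal hull {q n})"
  have U: "ideal ?U" by (rule ideal_closure_Union[OF ideal_ideal_hull inc])
  have "p n \<in> ?U" for n using q(2)[of n] by (intro subsetD[OF closure_subset]) blast
  then have "range p \<subseteq> ?U" by blast
  then have "C \<subseteq> ?U" unfolding rp by simp
  then have "ideal hull C \<subseteq> ?U" by (rule ideal_hull_minimal[OF _ U])
  then have 1: "ideal hull {a} \<subseteq> ?U" using C(3) by (intro ideal_hull_minimal U) auto
  have "ideal hull {q n} \<subseteq> ideal hull {a}" for n
    using q(3) by (intro ideal_hull_minimal ideal_ideal_hull) simp
  then have "?U \<subseteq> ideal hull {a}"
    by (intro closure_minimal ideal_closed ideal_ideal_hull) blast
  with 1 show ?thesis using that q(1) inc by blast
qed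

lemma Cuntz_sup_projection_chain:
  fixes a :: "'a::cstar_algebra"
  assumes pi: "purely_infinite TYPE('a)" and a: "cstar_positive a"
    and q: "\<And>n. projection (q n)" and inc: "incseq (\<lambda>n. ideal hull {q n})"
    and hull: "ideal hull {a} = closure (\<Union>n. ideal hull {q n})"
  shows "Cuntz_le (Cuntz_class (q n)) (Cuntz_class (q (Suc n)))"
    and "Cuntz_is_sup (Cuntz_class a) (range (\<lambda>n. Cuntz_class (q n)))"
proof -
  note qpos = projection_positive[OF q]
  note refl = purely_infinite_Cuntz_refl[OF pi]
  note le_iff = Cuntz_le_Cuntz_class_iff[OF _ refl _ refl]
  have "q n \<in> ideal hull {q (Suc n)}" using incseq_SucD[OF inc, of n] ideal_hull_self by blast
  then show "Cuntz_le (Cuntz_class (q n)) (Cuntz_class (q (Suc n)))"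
    by (simp add: le_iff qpos purely_infinite_Cuntz_sub[OF pi])
  have "q n \<in> ideal hull {a}" for n
    unfolding hull by (intro subsetD[OF closure_subset] UN_I[of n]) (simp_all add: ideal_hull_self)
  then have upper: "Cuntz_le (Cuntz_class (q n)) (Cuntz_class a)" for n
    by (simp add: le_iff qpos a purely_infinite_Cuntz_sub[OF pi])
  have least: "Cuntz_le (Cuntz_class a) u"
    if u: "u \<in> Cuntz_W" and le: "\<And>n. Cuntz_le (Cuntz_class (q n)) u" for u
  proof -
    \<comment> \<open>\<open>b\<close> is a matrix of unknown size, so comparison with it has to go
      by transitivity through the corners of the \<open>q n\<close>.\<close>
    obtain b where b: "b \<in> u" using Cuntz_le_Cuntz_classD[OF le[of 0]] by blast
    have qb: "corner (q n) \<precsim> b" for n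
      using Cuntz_le_Cuntz_classD[OF le[of n]] Cuntz_W_Cuntz_sub[OF u _ b] Cuntz_sub_trans by metis
    obtain y where y: "a = star y * y" using a by (auto simp: cstar_positive_def)
    \<comment> \<open>The factor \<open>y\<close> lies in the ideal generated by \<open>a\<close>;
      approximating it keeps \<open>star (s k) * s k\<close> positive, as pure infiniteness
      requires.\<close>
    have "y \<in> closure (\<Union>n. ideal hull {q n})"
      using mem_ideal_hull_star_mult_self[of y] y hull by simp
    then obtain s where s: "\<And>k. s k \<in> (\<Union>n. ideal hull {q n})" "s \<longlonglongrightarrow> y"
      unfolding closure_sequential by blast
    have "corner (star (s k) * s k) \<precsim> b" for k
    proof -
      obtain n where "s k \<in> ideal hull {q n}" using s(1) by blast
      then have "star (s k) * s k \<in> ideal hull {q n}" by (rule ideal_mult_left[OF ideal_ideal_hull])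
      then have "corner (star (s k) * s k) \<precsim> corner (q n)"
        by (intro purely_infinite_Cuntz_sub[OF pi]) (simp_all add: qpos)
      then show ?thesis using qb Cuntz_sub_trans by blast
    qed
    moreover have "(\<lambda>k. star (s k) * s k) \<longlonglongrightarrow> a"
      unfolding y by (intro tendsto_mult tendsto_star s)
    ultimately have "corner a \<precsim> b" by (rule corner_Cuntz_sub_limit)
    then show ?thesis by (rule Cuntz_le_Cuntz_classI[OF a refl[OF a] b])
  qed
  show "Cuntz_is_sup (Cuntz_class a) (range (\<lambda>n. Cuntz_class (q n)))"
    unfolding Cuntz_is_sup_def using Cuntz_class_mem_Cuntz_W[OF a] upper least by blast
qed

lemma norm_projection_le: "projection p \<Longrightarrow> norm p \<le> 1"
  using cstar_identity[of p] by (cases "p = 0") (auto simp: projection_def power2_eq_square)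

text \<open>The weights and \<open>norm (p n) \<le> 1\<close> give convergence. The other terms of
  the series being positive, \<open>c n \<le> suminf c\<close>, and heredity puts \<open>p n\<close>
  into the ideal generated by the sum.\<close>

lemma positive_generator_of_projections:
  fixes p :: "nat \<Rightarrow> 'a::cstar_algebra"
  assumes p: "\<And>n. projection (p n)"
  shows "\<exists>b. cstar_positive b \<and> (\<forall>n. p n \<in> ideal hull {b}) \<and> b \<in> ideal hull (range p)"
proof -
  define c where "c n = (1/2::real) ^ n *\<^sub>R p n" for n
  have "summable c"
    by (rule summable_comparison_test'[OF summable_geometric[of "1/2 :: real"]])
      (use norm_projection_le[OF p] in \<open>auto simp: c_def mult_left_le\<close>)
  then have lim: "(\<lambda>N. \<Sum>k<N. c k) \<longlonglongrightarrow> suminf c" by (rule summable_LIMSEQ)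
  have cpos: "cstar_positive (c n)" for n
    unfolding c_def by (intro cstar_positive_scaleR projection_positive p) simp
  have pos: "cstar_positive (suminf c)"
    by (rule cstar_positive_tendsto[OF _ lim]) (intro cstar_positive_sum cpos)
  show ?thesis
  proof (intro exI[of _ "suminf c"] conjI allI)
    show "cstar_positive (suminf c)" by (rule pos)
  next
    show "suminf c \<in> ideal hull (range p)"
      unfolding c_def[abs_def]
    proof (rule ideal_tendsto[OF ideal_ideal_hull _ lim[unfolded c_def[abs_def]]])
      fix N
      show "(\<Sum>k<N. (1/2::real) ^ k *\<^sub>R p k) \<in> ideal hull (range p)"
        by (intro ideal_sum ideal_scaleR ideal_ideal_hull hull_inc rangeI)
    qed
  next
    fix n
    \<comment> \<open>Scaled so that \<open>star x * x = c n\<close>, the form in which heredity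
      applies.\<close>
    define x where "x = sqrt ((1/2) ^ n) *\<^sub>R p n"
    have x: "star x * x = c n"
      using p[of n] by (simp add: x_def c_def star_scaleR projection_def)
    have "cstar_positive (suminf c - c n)"
    proof (rule cstar_positive_tendsto)
      \<comment> \<open>The offset \<open>Suc n\<close> puts the \<open>n\<close>-th term into every
        partial sum.\<close>
      show "(\<lambda>N. (\<Sum>k<N + Suc n. c k) - c n) \<longlonglongrightarrow> suminf c - c n"
        by (intro tendsto_diff tendsto_const LIMSEQ_ignore_initial_segment lim)
      fix N
      have "(\<Sum>k<N + Suc n. c k) - c n = (\<Sum>k\<in>{..<N + Suc n} - {n}. c k)"
        by (subst sum_diff1) auto
      then show "cstar_positive ((\<Sum>k<N + Suc n. c k) - c n)"
        by (simp only:) (intro cstar_positive_sum cpos)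
    qed
    then have "x \<in> ideal hull {suminf c}" by (intro mem_ideal_hull_if_le pos) (simp add: x)
    then have "(1 / sqrt ((1/2) ^ n)) *\<^sub>R x \<in> ideal hull {suminf c}"
      by (rule ideal_scaleR[OF ideal_ideal_hull])
    then show "p n \<in> ideal hull {suminf c}" by (simp add: x_def)
  qed
qed

text \<open>The first claim uses that the class of \<open>a\<close> is an upper bound, the second
  that it is the least: the positive generator \<open>b\<close> lies in the ideal of the projections
  and its class is another upper bound.\<close>

lemma mem_ideal_hull_range_if_Cuntz_sup:
  fixes a :: "'a::cstar_algebra" and p :: "nat \<Rightarrow> 'a"
  assumes pi: "purely_infinite TYPE('a)" and a: "cstar_positive a" and p: "\<And>n. projection (p n)"
    and sup: "Cuntz_is_sup (Cuntz_class a) (range (\<lambda>n. Cuntz_class (p n)))"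
  shows "p n \<in> ideal hull {a}" and "a \<in> ideal hull (range p)"
proof -
  note ppos = projection_positive[OF p]
  note refl = purely_infinite_Cuntz_refl[OF pi]
  note le_iff = Cuntz_le_Cuntz_class_iff[OF _ refl _ refl]
  have "Cuntz_le (Cuntz_class (p n)) (Cuntz_class a)"
    using sup unfolding Cuntz_is_sup_def by blast
  then show "p n \<in> ideal hull {a}"
    by (intro corner_sub_corner_imp_mem_ideal_hull) (simp add: le_iff ppos a)
  obtain b where b: "cstar_positive b" "\<And>n. p n \<in> ideal hull {b}" "b \<in> ideal hull (range p)"
    using positive_generator_of_projections[of p, OF p] by blast
  have "Cuntz_le (Cuntz_class (p n)) (Cuntz_class b)" for n
    by (simp add: le_iff ppos b purely_infinite_Cuntz_sub[OF pi])
  then have "Cuntz_le (Cuntz_class a) (Cuntz_class b)"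
    using sup Cuntz_class_mem_Cuntz_W[OF b(1)] unfolding Cuntz_is_sup_def by blast
  then have "a \<in> ideal hull {b}"
    by (intro corner_sub_corner_imp_mem_ideal_hull) (simp add: le_iff a b)
  moreover have "ideal hull {b} \<subseteq> ideal hull (range p)"
    using b(3) by (intro ideal_hull_minimal ideal_ideal_hull) simp
  ultimately show "a \<in> ideal hull (range p)" by blast
qed

theorem theorem2p5:
  assumes "purely_infinite TYPE('a::cstar_algebra)" and "cstar_stable TYPE('a)"
  defines "i \<equiv> ideal_property TYPE('a)"
  defines "ii \<equiv> (\<forall>a :: 'a. cstar_positive a \<longrightarrow>
      (\<exists>p :: nat \<Rightarrow> 'a. (\<forall>n. projection (p n)) \<and>
        Cuntz_is_sup (Cuntz_class a) (range (\<lambda>n. Cuntz_class (p n)))))"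
  defines "iii \<equiv> (\<forall>a :: 'a. cstar_positive a \<longrightarrow>
      (\<exists>q :: nat \<Rightarrow> 'a. (\<forall>n. projection (q n)) \<and>
        (\<forall>n. Cuntz_le (Cuntz_class (q n)) (Cuntz_class (q (Suc n)))) \<and>
        Cuntz_is_sup (Cuntz_class a) (range (\<lambda>n. Cuntz_class (q n)))))"
  defines "iv \<equiv> (\<forall>a :: 'a. cstar_positive a \<longrightarrow>
      (\<exists>I :: nat \<Rightarrow> 'a set. (\<forall>n. ideal (I n)) \<and> incseq I \<and>
        (\<forall>n. \<exists>p. projection p \<and> I n = ideal hull {p}) \<and>
        ideal hull {a} = closure (\<Union>n. I n)))"
  shows "(i \<longleftrightarrow> ii) \<and> (ii \<longleftrightarrow> iii) \<and> (iii \<longleftrightarrow> iv)"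
proof -
  have "iv" if "i"
    unfolding iv_def
  proof (intro allI impI)
    fix a :: 'a
    obtain q where q: "\<And>n. projection (q n)" "incseq (\<lambda>n. ideal hull {q n})"
      "ideal hull {a} = closure (\<Union>n. ideal hull {q n})"
      using projection_chain_exists[OF assms(2)] \<open>i\<close> unfolding i_def by blast
    show "\<exists>I :: nat \<Rightarrow> 'a set. (\<forall>n. ideal (I n)) \<and> incseq I \<and>
        (\<forall>n. \<exists>p. projection p \<and> I n = ideal hull {p}) \<and> ideal hull {a} = closure (\<Union>n. I n)"
      by (rule exI[of _ "\<lambda>n. ideal hull {q n}"]) (use q ideal_ideal_hull in blast)
  qed
  moreover have "iii" if "iv"
    unfolding iii_def
  proof (intro allI impI)
    fix a :: 'a assume a: "cstar_positive a"
    obtain I :: "nat \<Rightarrow> 'a set" where I: "incseq I"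
        "\<forall>n. \<exists>p. projection p \<and> I n = ideal hull {p}" "ideal hull {a} = closure (\<Union>n. I n)"
      using \<open>iv\<close> a unfolding iv_def by blast
    obtain q where q: "\<And>n. projection (q n)" "\<And>n. I n = ideal hull {q n}" using I(2) by metis
    have "I = (\<lambda>n. ideal hull {q n})" using q(2) by blast
    with I(1,3) have "incseq (\<lambda>n. ideal hull {q n})" "ideal hull {a} = closure (\<Union>n. ideal hull {q n})"
      by simp_all
    from Cuntz_sup_projection_chain[OF assms(1) a q(1) this] q(1)
    show "\<exists>q :: nat \<Rightarrow> 'a. (\<forall>n. projection (q n)) \<and>
        (\<forall>n. Cuntz_le (Cuntz_class (q n)) (Cuntz_class (q (Suc n)))) \<and>
        Cuntz_is_sup (Cuntz_class a) (range (\<lambda>n. Cuntz_class (q n)))" by blast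
  qed
  moreover have "ii" if "iii"
    using that unfolding ii_def iii_def by blast
  moreover have "i" if "ii"
    unfolding i_def ideal_property_def
  proof (intro allI impI)
    fix I :: "'a set" assume I: "ideal I"
    let ?P = "{p \<in> I. projection p}"
    have "x \<in> ideal hull ?P" if x: "x \<in> I" for x
    proof -
      \<comment> \<open>A positive element of \<open>I\<close> whose generated ideal still contains
        \<open>x\<close>.\<close>
      let ?a = "star x * x"
      obtain p :: "nat \<Rightarrow> 'a" where p: "\<And>n. projection (p n)"
        "Cuntz_is_sup (Cuntz_class ?a) (range (\<lambda>n. Cuntz_class (p n)))"
        using \<open>ii\<close> cstar_positive_star_mult unfolding ii_def by blast
      note mem = mem_ideal_hull_range_if_Cuntz_sup[OF assms(1) cstar_positive_star_mult p]
      have "ideal hull {?a} \<subseteq> I" using ideal_mult_left[OF I x] by (intro ideal_hull_minimal I) simp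
      \<comment> \<open>Each \<open>p n\<close> is below \<open>?a\<close>, hence lies in its ideal
        and so in \<open>I\<close>.\<close>
      then have "range p \<subseteq> ?P" using mem(1) p(1) by blast
      then have "?a \<in> ideal hull ?P" using mem(2) hull_mono by blast
      then have "ideal hull {?a} \<subseteq> ideal hull ?P" by (intro ideal_hull_minimal ideal_ideal_hull) simp
      then show ?thesis using mem_ideal_hull_star_mult_self by blast
    qed
    moreover have "ideal hull ?P \<subseteq> I" by (intro ideal_hull_minimal I) blast
    ultimately show "I = ideal hull ?P" by blast
  qed
  ultimately show ?thesis by blast
qed

end
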